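(* Let $K$ be an algebraically closed field of characteristic $2$ and let $n\ge 2$. A hypersurface singularity $f\in\mathfrak m^2\subset K[[x_1,\dots,x_n]]$ (with $\mu(f)<\infty$) is right simple if and only if $n$ is even and $f$ is right equivalent to $$\mathrm A_1:\quad x_1x_2+x_3x_4+\dots+x_{n-1}x_n.$$
   Context: $K[[\mathbf x]]=K[[x_1,\dots,x_n]]$, with maximal ideal $\mathfrak m$. The Milnor number is $\mu(f)=\dim_K K[[\mathbf x]]/j(f)$, with $j(f)$ the ideal generated by all partial derivatives of $f$. The right group is $\mathcal R=\mathrm{Aut}_K(K[[\mathbf x]])$; $f\sim_r g$ (right equivalent) means $g=\Phi(f)$ for some $\Phi\in\mathcal R$. Let $J_k:=\mathfrak m/\mathfrak m^{k+1}$ (an affine space), $j^k f$ the class of $f\in\mathfrak m$ in $J_k$, and $\mathcal R_k$ the affine algebraic group of $k$-jets $\Phi_k=(j^k\Phi(x_1),\dots,j^k\Phi(x_n))$ of elements $\Phi\in\mathcal R$, acting algebraically on $J_k$ by $\Phi_k\cdot j^kf=j^k(\Phi(f))$. Varieties are separated schemes of finite type over $K$, points are closed points. For an algebraic group $H$ acting on a variety $X$, a Rosenlicht stratification is a finite disjoint decomposition $X=X_1\cup\dots\cup X_s$ into $H$-invariant locally closed subvarieties, $X_i$ open dense in $X\setminus(X_1\cup\dots\cup X_{i-1})$, such that each $X_i$ has a geometric quotient $p_i:X_i\to X_i/H$ which is a variety (it always exists). For $U\subset X$ open put $H\text{-}\mathrm{mod}(U)=\max_i\dim p_i(U\cap X_i)$,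 and for $x\in X$ put $H\text{-}\mathrm{mod}(x)=\min\{H\text{-}\mathrm{mod}(U): U \text{ an open neighbourhood of }x\}$; these are independent of the stratification. A series $g\in\mathfrak m$ is right $k$-determined if every $h\in\mathfrak m$ with $j^kh=j^kg$ satisfies $h\sim_r g$. An integer $k$ is sufficiently large for $f$ w.r.t. $\mathcal R$ if there is a neighbourhood $U$ of $j^kf$ in $J_k$ such that every $g\in\mathfrak m$ with $j^kg\in U$ is right $k$-determined. For $f\in\mathfrak m$ with $\mu(f)<\infty$, the right modality $\mathcal R\text{-}\mathrm{mod}(f)$ is the $\mathcal R_k$-modality of the point $j^kf$ in $J_k$ for $k$ sufficiently large (such $k$ exist and the value is independent of $k$). $f$ is right simple if $\mathcal R\text{-}\mathrm{mod}(f)=0$. *)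

theory Defs
  imports
    "HOL-Analysis.Abstract_Topology"
    "HOL-Library.Extended_Nat"
    "HOL-Library.Multiset"
    "HOL-Computational_Algebra.Polynomial"
    "HOL-Algebra.QuotRing"
    "HOL-Algebra.Ideal_Product"
    "HOL-Algebra.Embedded_Algebras"
begin

section \<open>Formal power series in \<open>n\<close> variables\<close>

text \<open>
  As for the indexed polynomials of HOL-Algebra, a monomial is a multiset of variables. The
  variables are indexed by \<open>1, \<dots>, n\<close>, and a power series is the function mapping a monomial to
  its coefficient.
\<close>

type_synonym monom = "nat multiset"
type_synonym 'a series = "monom \<Rightarrow> 'a"

definition power_series :: "nat \<Rightarrow> ('a::field) series ring" where
  "power_series n =
    \<lparr>carrier = {f. \<forall>m. f m \<noteq> 0 \<longrightarrow> set_mset m \<subseteq> {1..n}},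
     monoid.mult = (\<lambda>f g m. \<Sum>a | a \<subseteq># m. f a * g (m - a)),
     one = (\<lambda>m. if m = {#} then 1 else 0),
     zero = (\<lambda>m. 0),
     add = (\<lambda>f g m. f m + g m)\<rparr>"

definition const :: "'a::field \<Rightarrow> 'a series" where
  "const c = (\<lambda>m. if m = {#} then c else 0)"

definition var :: "nat \<Rightarrow> ('a::field) series" where
  "var i = (\<lambda>m. if m = {#i#} then 1 else 0)"

definition max_ideal :: "nat \<Rightarrow> ('a::field) series set" where
  "max_ideal n = {f \<in> carrier (power_series n). f {#} = 0}"

definition max_ideal_squared :: "nat \<Rightarrow> ('a::field) series set" where
  "max_ideal_squared n = ideal_prod (power_series n) (max_ideal n) (max_ideal n)"

definition partial_deriv :: "nat \<Rightarrow> ('a::field) series \<Rightarrow> 'a series" where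
  "partial_deriv i f = (\<lambda>m. of_nat (Suc (count m i)) * f (add_mset i m))"

definition jacobian_ideal :: "nat \<Rightarrow> ('a::field) series \<Rightarrow> 'a series set" where
  "jacobian_ideal n f = genideal (power_series n) ((\<lambda>i. partial_deriv i f) ` {1..n})"

text \<open>
  The field of scalars of the Milnor algebra is the image of the constant series in the quotient ring.
\<close>

definition milnor_number :: "nat \<Rightarrow> ('a::field) series \<Rightarrow> enat" where
  "milnor_number n f =
    (let Q = power_series n Quot jacobian_ideal n f;
         K = range (\<lambda>c. jacobian_ideal n f +>\<^bsub>power_series n\<^esub> const c)
     in if \<exists>d. ring.dimension Q d K (carrier Q)
        then enat (THE d. ring.dimension Q d K (carrier Q)) else \<infinity>)"

definition right_group :: "nat \<Rightarrow> (('a::field) series \<Rightarrow> 'a series) set" where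
  "right_group n =
    {\<Phi> \<in> ring_iso (power_series n) (power_series n). \<forall>c. \<Phi> (const c) = const c}"

definition right_equivalent :: "nat \<Rightarrow> ('a::field) series \<Rightarrow> 'a series \<Rightarrow> bool" where
  "right_equivalent n f g \<longleftrightarrow> (\<exists>\<Phi>\<in>right_group n. g = \<Phi> f)"

definition A1_series :: "nat \<Rightarrow> ('a::field) series" where
  "A1_series n =
    (\<Oplus>\<^bsub>power_series n\<^esub>i\<in>{1..n div 2}. var (2 * i - 1) \<otimes>\<^bsub>power_series n\<^esub> var (2 * i))"


section \<open>Varieties\<close>

text \<open>
  Varieties over an algebraically closed field \<open>K\<close> are treated classically: a variety is its set of
  closed points with the Zariski topology, and its structure sheaf is a sheaf of \<open>K\<close>-valued
  functions (varieties thus carry their reduced structure). Regular functions on an open set \<open>U\<close> are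
  represented by total functions of which only the values on \<open>U\<close> matter.
\<close>

record ('p, 'k) kspace =
  zariski :: "'p topology"
  regular :: "'p set \<Rightarrow> ('p \<Rightarrow> 'k) set"

text \<open>
  The affine space \<open>K\<^sup>I\<close> over a finite index set \<open>I\<close>; its points are extended by \<open>0\<close> outside \<open>I\<close>.
\<close>

inductive_set polyfun :: "'i set \<Rightarrow> (('i \<Rightarrow> 'k::field) \<Rightarrow> 'k) set" for I :: "'i set" where
  const: "(\<lambda>a. c) \<in> polyfun I"
| coord: "i \<in> I \<Longrightarrow> (\<lambda>a. a i) \<in> polyfun I"
| add: "p \<in> polyfun I \<Longrightarrow> q \<in> polyfun I \<Longrightarrow> (\<lambda>a. p a + q a) \<in> polyfun I"
| mult: "p \<in> polyfun I \<Longrightarrow> q \<in> polyfun I \<Longrightarrow> (\<lambda>a. p a * q a) \<in> polyfun I"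

definition affine_points :: "'i set \<Rightarrow> ('i \<Rightarrow> 'k::field) set" where
  "affine_points I = {a. \<forall>i. i \<notin> I \<longrightarrow> a i = 0}"

definition affine_space :: "'i set \<Rightarrow> ('i \<Rightarrow> 'k::field, 'k) kspace" where
  "affine_space I =
    \<lparr>zariski = topology_generated_by {{a \<in> affine_points I. p a \<noteq> 0} | p. p \<in> polyfun I},
     regular = (\<lambda>U. {f. \<forall>a\<in>U. \<exists>p\<in>polyfun I. \<exists>q\<in>polyfun I.
        q a \<noteq> 0 \<and> (\<forall>b\<in>U. q b \<noteq> 0 \<longrightarrow> f b = p b / q b)})\<rparr>"

text \<open>
  The reduced structure on a locally closed subset \<open>S\<close>: regular functions are those that extend
  locally to regular functions of the ambient space.
\<close>

definition induced :: "('p, 'k) kspace \<Rightarrow> 'p set \<Rightarrow> ('p, 'k) kspace" where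
  "induced X S =
    \<lparr>zariski = subtopology (zariski X) S,
     regular = (\<lambda>V. {f. \<forall>x\<in>V. \<exists>W h. openin (zariski X) W \<and> x \<in> W \<and> h \<in> regular X W \<and>
        (\<forall>y\<in>V \<inter> W. f y = h y)})\<rparr>"

definition kspace_iso :: "('p, 'k) kspace \<Rightarrow> ('q, 'k) kspace \<Rightarrow> ('p \<Rightarrow> 'q) \<Rightarrow> bool" where
  "kspace_iso X Y \<phi> \<longleftrightarrow>
    homeomorphic_map (zariski X) (zariski Y) \<phi> \<and>
    (\<forall>V g. openin (zariski Y) V \<longrightarrow>
      (g \<in> regular Y V \<longleftrightarrow> g \<circ> \<phi> \<in> regular X {x \<in> topspace (zariski X). \<phi> x \<in> V}))"

definition affine_variety :: "('p, 'k::field) kspace \<Rightarrow> bool" where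
  "affine_variety X \<longleftrightarrow>
    (\<exists>(N::nat) C \<phi>. closedin (zariski (affine_space {..<N} :: (nat \<Rightarrow> 'k, 'k) kspace)) C \<and>
      kspace_iso X (induced (affine_space {..<N}) C) \<phi>)"

text \<open>
  The first condition says that \<open>regular X\<close> is a sheaf of functions (restriction, gluing, and
  independence of the values outside the open set).
\<close>

definition prevariety :: "('p, 'k::field) kspace \<Rightarrow> bool" where
  "prevariety X \<longleftrightarrow>
    (\<forall>V. openin (zariski X) V \<longrightarrow> regular X V = regular (induced X (topspace (zariski X))) V) \<and>
    (\<exists>\<U>. finite \<U> \<and> \<Union>\<U> = topspace (zariski X) \<and>
      (\<forall>U\<in>\<U>. openin (zariski X) U \<and> affine_variety (induced X U)))"

text \<open>
  The Zariski topology of the product of two prevarieties (not the product topology): on a product of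
  affine open sets \<open>U \<times> V\<close>, the coordinate ring is the tensor product of those of \<open>U\<close> and \<open>V\<close>.
\<close>

definition product_zariski ::
    "('p, 'k::field) kspace \<Rightarrow> ('q, 'k) kspace \<Rightarrow> ('p \<times> 'q) topology" where
  "product_zariski X Y = topology_generated_by
    {{(x, y). x \<in> U \<and> y \<in> V \<and> (\<Sum>i<r. f i x * g i y) \<noteq> 0} | U V (r::nat) f g.
      openin (zariski X) U \<and> openin (zariski Y) V \<and>
      (\<forall>i<r. f i \<in> regular X U \<and> g i \<in> regular Y V)}"

definition variety :: "('p, 'k::field) kspace \<Rightarrow> bool" where
  "variety X \<longleftrightarrow> prevariety X \<and>
    closedin (product_zariski X X) ((\<lambda>x. (x, x)) ` topspace (zariski X))"

definition irreducible_closedin :: "'p topology \<Rightarrow> 'p set \<Rightarrow> bool" where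
  "irreducible_closedin T C \<longleftrightarrow> closedin T C \<and> C \<noteq> {} \<and>
    (\<forall>A B. closedin T A \<and> closedin T B \<and> C \<subseteq> A \<union> B \<longrightarrow> C \<subseteq> A \<or> C \<subseteq> B)"

text \<open>Krull dimension; by convention the dimension of the empty space is \<open>0\<close>.\<close>

definition krull_dim :: "'p topology \<Rightarrow> enat" where
  "krull_dim T = Sup {enat l | l. \<exists>C.
    (\<forall>i\<le>l. irreducible_closedin T (C i)) \<and> (\<forall>i<l. C i \<subset> C (Suc i))}"


section \<open>Geometric quotients, Rosenlicht stratifications and modality\<close>

text \<open>
  A group enters through the set \<open>G\<close> of its elements and the map \<open>act\<close>. The last condition is
  \<open>\<O>\<^sub>Y = (p\<^sub>* \<O>\<^sub>X)\<^sup>G\<close>: since the fibres of \<open>p\<close> are the orbits, an invariant function is of the form \<open>h \<circ> p\<close>.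
\<close>

definition geometric_quotient ::
    "'g set \<Rightarrow> ('g \<Rightarrow> 'p \<Rightarrow> 'p) \<Rightarrow> ('p, 'k) kspace \<Rightarrow> ('p \<Rightarrow> 'q) \<Rightarrow> ('q, 'k) kspace \<Rightarrow> bool" where
  "geometric_quotient G act X p Y \<longleftrightarrow>
    quotient_map (zariski X) (zariski Y) p \<and>
    (\<forall>x\<in>topspace (zariski X). \<forall>y\<in>topspace (zariski X). p x = p y \<longleftrightarrow> (\<exists>g\<in>G. y = act g x)) \<and>
    (\<forall>V h. openin (zariski Y) V \<longrightarrow>
      (h \<in> regular Y V \<longleftrightarrow> h \<circ> p \<in> regular X {x \<in> topspace (zariski X). p x \<in> V}))"

definition locally_closedin :: "'p topology \<Rightarrow> 'p set \<Rightarrow> bool" where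
  "locally_closedin T S \<longleftrightarrow> (\<exists>U C. openin T U \<and> closedin T C \<and> S = U \<inter> C)"

text \<open>
  A stratification is the list of its strata \<open>X\<^sub>i\<close>, each with its quotient \<open>p\<^sub>i : X\<^sub>i \<rightarrow> Y\<^sub>i\<close>. The points of
  a geometric quotient correspond to orbits, so taking \<open>Y\<^sub>i\<close> with points in the type \<open>'p set\<close> is no
  restriction.
\<close>

type_synonym ('p, 'k) stratum = "'p set \<times> ('p \<Rightarrow> 'p set) \<times> ('p set, 'k) kspace"

definition rosenlicht_stratification ::
    "'g set \<Rightarrow> ('g \<Rightarrow> 'p \<Rightarrow> 'p) \<Rightarrow> ('p, 'k::field) kspace \<Rightarrow> ('p, 'k) stratum list \<Rightarrow> bool" where
  "rosenlicht_stratification G act X strat \<longleftrightarrow>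
    (\<Union>(S, p, Y)\<in>set strat. S) = topspace (zariski X) \<and>
    (\<forall>i<length strat. case strat ! i of (S, p, Y) \<Rightarrow>
      let R = topspace (zariski X) - (\<Union>(S', p', Y')\<in>set (take i strat). S') in
        S \<subseteq> R \<and> openin (subtopology (zariski X) R) S \<and>
        (subtopology (zariski X) R) closure_of S = R \<and>
        locally_closedin (zariski X) S \<and> (\<forall>g\<in>G. act g ` S \<subseteq> S) \<and>
        variety Y \<and> geometric_quotient G act (induced X S) p Y)"

definition strat_modality :: "('p, 'k) stratum list \<Rightarrow> 'p set \<Rightarrow> enat" where
  "strat_modality strat U =
    (SUP (S, p, Y)\<in>set strat. krull_dim (subtopology (zariski Y) (p ` (U \<inter> S))))"

text \<open>
  The value does not depend on the stratification, and a stratification always exists; the infimum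
  is the common value.
\<close>

definition open_modality ::
    "'g set \<Rightarrow> ('g \<Rightarrow> 'p \<Rightarrow> 'p) \<Rightarrow> ('p, 'k::field) kspace \<Rightarrow> 'p set \<Rightarrow> enat" where
  "open_modality G act X U =
    (INF strat\<in>{strat. rosenlicht_stratification G act X strat}. strat_modality strat U)"

definition modality ::
    "'g set \<Rightarrow> ('g \<Rightarrow> 'p \<Rightarrow> 'p) \<Rightarrow> ('p, 'k::field) kspace \<Rightarrow> 'p \<Rightarrow> enat" where
  "modality G act X x = (INF U\<in>{U. openin (zariski X) U \<and> x \<in> U}. open_modality G act X U)"


section \<open>Jets and right modality\<close>

text \<open>
  The class of \<open>f\<close> modulo the \<open>(k+1)\<close>-st power of the maximal ideal is represented by its unique
  representative without terms of degree above \<open>k\<close>; the coordinates of the affine space \<open>J\<^sub>k\<close> are the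
  coefficients of the monomials of degrees \<open>1, \<dots>, k\<close>.
\<close>

definition jet :: "nat \<Rightarrow> ('a::field) series \<Rightarrow> 'a series" where
  "jet k f = (\<lambda>m. if size m \<le> k then f m else 0)"

definition jet_space :: "nat \<Rightarrow> nat \<Rightarrow> (('a::field) series, 'a) kspace" where
  "jet_space n k = affine_space {m. set_mset m \<subseteq> {1..n} \<and> 1 \<le> size m \<and> size m \<le> k}"

definition aut_jet :: "nat \<Rightarrow> nat \<Rightarrow> (('a::field) series \<Rightarrow> 'a series) \<Rightarrow> nat \<Rightarrow> 'a series" where
  "aut_jet n k \<Phi> = (\<lambda>i. if i \<in> {1..n} then jet k (\<Phi> (var i)) else (\<lambda>m. 0))"

definition right_jet_group :: "nat \<Rightarrow> nat \<Rightarrow> (nat \<Rightarrow> ('a::field) series) set" where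
  "right_jet_group n k = aut_jet n k ` right_group n"

definition jet_act :: "nat \<Rightarrow> nat \<Rightarrow> (nat \<Rightarrow> ('a::field) series) \<Rightarrow> 'a series \<Rightarrow> 'a series" where
  "jet_act n k \<phi> a = (THE b. \<exists>\<Phi>\<in>right_group n. \<exists>f\<in>max_ideal n.
    aut_jet n k \<Phi> = \<phi> \<and> jet k f = a \<and> b = jet k (\<Phi> f))"

definition right_determined :: "nat \<Rightarrow> nat \<Rightarrow> ('a::field) series \<Rightarrow> bool" where
  "right_determined n k g \<longleftrightarrow>
    (\<forall>h\<in>max_ideal n. jet k h = jet k g \<longrightarrow> right_equivalent n h g)"

definition sufficiently_large :: "nat \<Rightarrow> ('a::field) series \<Rightarrow> nat \<Rightarrow> bool" where
  "sufficiently_large n f k \<longleftrightarrow>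
    (\<exists>U. openin (zariski (jet_space n k)) U \<and> jet k f \<in> U \<and>
      (\<forall>g\<in>max_ideal n. jet k g \<in> U \<longrightarrow> right_determined n k g))"

text \<open>
  For \<open>f\<close> with finite Milnor number, sufficiently large \<open>k\<close> exist and the value does not depend on
  \<open>k\<close>; the infimum is the common value.
\<close>

definition right_modality :: "nat \<Rightarrow> ('a::field) series \<Rightarrow> enat" where
  "right_modality n f =
    (INF k\<in>{k. sufficiently_large n f k}.
      modality (right_jet_group n k) (jet_act n k) (jet_space n k) (jet k f))"

definition right_simple :: "nat \<Rightarrow> ('a::field) series \<Rightarrow> bool" where
  "right_simple n f \<longleftrightarrow> right_modality n f = 0"

end

theory Submission
  imports Defs "Jordan_Normal_Form.Determinant"
begin

text \<open>
  The 2-jets of series in the maximal ideal fall into finitely many orbits: that of \<open>x\<^sub>1\<close>, and those of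
  \<open>Q\<^sub>r = x\<^sub>1 x\<^sub>2 + \<dots>\<close> with \<open>r \<le> n\<close> variables, closed by a square \<open>x\<^sub>r\<^sup>2\<close> if \<open>r\<close> is odd. They form a
  Rosenlicht stratification with finite quotients. For even \<open>n\<close>, Morse's lemma makes
  \<open>Q\<^sub>n\<close> 2-determined, so the value \<open>k = 2\<close> is sufficiently large and the modality is \<open>0\<close>.

  Any other \<open>f\<close> in the square of the maximal ideal is equivalent to \<open>Q\<^sub>r\<close> plus terms of order three,
  with \<open>r < n\<close> or \<open>n\<close> odd. It lies on a line of series whose general member has a polar form with
  radical of dimension \<open>1\<close> or \<open>2\<close>. Squares are additive in characteristic two, so on the radical
  the quadratic part is the square of a linear form, and a comparison of it with the cubic part gives a
  non-constant rational function on the line which is invariant under right equivalence. If \<open>x\<close> is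
  the coordinate on a one-dimensional radical and the restriction is \<open>q x\<^sup>2 + c x\<^sup>3 + \<dots>\<close>, it is
  \<open>c\<^sup>2 / q\<^sup>3\<close>. So the image of the line in the quotient of a stratum has positive dimension.
\<close>

section \<open>The ring of power series\<close>

text \<open>The polar form is alternating in characteristic two, so its rank is even, and the
  largest even rank below \<open>n\<close> leaves a radical of dimension one or two. A general
  member of the line attains this rank whatever the rank of the degenerate \<open>f\<close>, so one
  invariant serves all cases. The danger for any invariant is the nonlinear part of a coordinate
  change. On a one-dimensional radical \<open>q x^2\<close> becomes
  \<open>q (A x + B x^2 + ...)^2\<close>, whose cubic coefficient \<open>2 q A B\<close> is zero
  here; hence \<open>q\<close> and \<open>c\<close> are merely multiplied by \<open>A^2\<close> and
  \<open>A^3\<close>. On a two-dimensional radical the form is \<open>q y^2\<close> in suitable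
  coordinates. Its zero line is preserved, which makes the linear part triangular, and
  \<open>c\<close> is replaced by a quotient: the square root of the discriminant of the binary
  cubic by the value of the cubic on that line. Right modality is an infimum over jet orders,
  neighbourhoods and stratifications. One choice of each proves simplicity; the converse has to
  treat all of them, also the jet orders up to two, where the cubic part is invisible and which are
  shown not to be sufficiently large.\<close>

text \<open>
  A copy of the type of series, to make the type class algebra of commutative rings available;
  infinitely many variables do no harm here.
\<close>

datatype 'a mps = Mps (cf: "'a series")

lemma mps_eqI: "(\<And>m. cf f m = cf g m) \<Longrightarrow> f = g"
  by (cases f; cases g) auto

definition mons :: "nat set \<Rightarrow> nat \<Rightarrow> monom set" where
  "mons V N = {m. set_mset m \<subseteq> V \<and> size m \<le> N}"

lemma mons_iff: "m \<in> mons V N \<longleftrightarrow> set_mset m \<subseteq> V \<and> size m \<le> N"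
  by (simp add: mons_def)

lemma finite_mons [simp]: "finite V \<Longrightarrow> finite (mons V N)"
proof -
  assume "finite V"
  then have "finite (mset ` {xs. set xs \<subseteq> V \<and> length xs \<le> N})"
    by (intro finite_imageI finite_lists_length_le)
  moreover have "mons V N \<subseteq> mset ` {xs. set xs \<subseteq> V \<and> length xs \<le> N}"
  proof
    fix m assume m: "m \<in> mons V N"
    obtain xs where "mset xs = m" using ex_mset by blast
    with m show "m \<in> mset ` {xs. set xs \<subseteq> V \<and> length xs \<le> N}"
      by (auto simp: mons_def)
  qed
  ultimately show ?thesis by (rule finite_subset[rotated])
qed

text \<open>Summing the Cauchy product over pairs rather than over submultisets makes commutativity
  and associativity plain reindexings.\<close>

definition splits :: "monom \<Rightarrow> (monom \<times> monom) set" where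
  "splits m = {(a, b). a + b = m}"

lemma mem_splits [simp]: "(a, b) \<in> splits m \<longleftrightarrow> a + b = m"
  by (simp add: splits_def)

lemma splits_eq: "splits m = (\<lambda>a. (a, m - a)) ` {a. a \<subseteq># m}"
  by (auto simp: splits_def image_iff subset_mset.le_iff_add)

lemma finite_splits [simp]: "finite (splits m)"
proof -
  have "{a. a \<subseteq># m} \<subseteq> mons (set_mset m) (size m)"
    by (auto simp: mons_def dest: mset_subset_eqD size_mset_mono)
  then have "finite {a. a \<subseteq># m}"
    by (rule finite_subset) simp
  then show ?thesis by (simp add: splits_eq)
qed

instantiation mps :: (field) comm_ring_1
begin

definition "0 = Mps (\<lambda>m. 0)"
definition "1 = Mps (\<lambda>m. if m = {#} then 1 else 0)"
definition "f + g = Mps (\<lambda>m. cf f m + cf g m)" for f g :: "'a mps"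
definition "f - g = Mps (\<lambda>m. cf f m - cf g m)" for f g :: "'a mps"
definition "- f = Mps (\<lambda>m. - cf f m)" for f :: "'a mps"
definition "f * g = Mps (\<lambda>m. \<Sum>(a, b)\<in>splits m. cf f a * cf g b)" for f g :: "'a mps"

instance
proof
  fix f g h :: "'a mps"
  show "f + g + h = f + (g + h)" "f + g = g + f" "0 + f = f" "- f + f = 0" "f - g = f + - g"
    by (simp_all add: plus_mps_def minus_mps_def uminus_mps_def zero_mps_def algebra_simps)
  show "(0 :: 'a mps) \<noteq> 1"
    by (auto simp: zero_mps_def one_mps_def dest: fun_cong[of _ _ "{#}"])
  show "(f + g) * h = f * h + g * h"
    by (simp add: plus_mps_def times_mps_def algebra_simps sum.distrib case_prod_unfold)
  show "f * g = g * f"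
  proof (rule mps_eqI)
    fix m
    have "(\<Sum>(a, b)\<in>splits m. cf f a * cf g b) = (\<Sum>(a, b)\<in>splits m. cf g a * cf f b)"
      by (rule sum.reindex_bij_witness[of _ prod.swap prod.swap])
        (auto simp: splits_def ac_simps)
    then show "cf (f * g) m = cf (g * f) m"
      by (simp add: times_mps_def)
  qed
  show "1 * f = f"
  proof (rule mps_eqI)
    fix m
    have "(\<Sum>(a, b)\<in>splits m. (if a = {#} then 1 else 0) * cf f b)
      = (\<Sum>(a, b)\<in>{({#} :: monom, m)}. (if a = {#} then 1 else 0) * cf f b)"
      by (rule sum.mono_neutral_right) (auto split: if_splits)
    then show "cf (1 * f) m = cf f m"
      by (simp add: times_mps_def one_mps_def)
  qed
  show "f * g * h = f * (g * h)"
  proof (rule mps_eqI)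
    fix m
    have "(\<Sum>(u, c)\<in>splits m. (\<Sum>(a, b)\<in>splits u. cf f a * cf g b) * cf h c)
      = (\<Sum>p\<in>splits m. \<Sum>q\<in>splits (fst p). cf f (fst q) * cf g (snd q) * cf h (snd p))"
      by (simp add: sum_distrib_right case_prod_unfold)
    also have "\<dots> = (\<Sum>(p, q)\<in>Sigma (splits m) (\<lambda>p. splits (fst p)).
        cf f (fst q) * cf g (snd q) * cf h (snd p))"
      by (rule sum.Sigma) auto
    also have "\<dots> = (\<Sum>(p, q)\<in>Sigma (splits m) (\<lambda>p. splits (snd p)).
        cf f (fst p) * (cf g (fst q) * cf h (snd q)))"
      by (rule sum.reindex_bij_witness[of _ "\<lambda>((a, v), (b, c)). ((a + b, c), (a, b))"
            "\<lambda>((u, c), (a, b)). ((a, b + c), (b, c))"])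
        (auto simp: ac_simps)
    also have "\<dots> = (\<Sum>p\<in>splits m. \<Sum>q\<in>splits (snd p). cf f (fst p) * (cf g (fst q) * cf h (snd q)))"
      by (rule sum.Sigma[symmetric]) auto
    also have "\<dots> = (\<Sum>(a, v)\<in>splits m. cf f a * (\<Sum>(b, c)\<in>splits v. cf g b * cf h c))"
      by (simp add: sum_distrib_left case_prod_unfold)
    finally show "cf (f * g * h) m = cf (f * (g * h)) m"
      by (simp add: times_mps_def)
  qed
qed

end

lemma cf_simps [simp]:
  fixes f g :: "'a::field mps"
  shows "cf 0 m = (0 :: 'a)" "cf (f + g) m = cf f m + cf g m" "cf (f - g) m = cf f m - cf g m"
    "cf (- f) m = - cf f m"
  by (simp_all add: plus_mps_def minus_mps_def uminus_mps_def zero_mps_def)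

lemma cf_mult: "cf (f * g) m = (\<Sum>(a, b)\<in>splits m. cf f a * cf g b)"
  by (simp add: times_mps_def)

lemma cf_sum [simp]: "cf (sum F A) m = (\<Sum>i\<in>A. cf (F i) m)" for F :: "'i \<Rightarrow> 'a::field mps"
  by (induction A rule: infinite_finite_induct) auto

definition Con :: "'a::field \<Rightarrow> 'a mps" where
  "Con c = Mps (const c)"

definition X :: "nat \<Rightarrow> 'a::field mps" where
  "X i = Mps (var i)"

lemma cf_Con: "cf (Con c) m = (if m = {#} then c else 0)"
  by (simp add: Con_def const_def)

lemma cf_X: "cf (X i) m = (if m = {#i#} then 1 else 0)"
  by (simp add: X_def var_def)

lemma cf_one: "cf 1 m = (if m = {#} then 1 else 0)"
  by (simp add: one_mps_def)

lemma cf_Con_mult [simp]: "cf (Con c * f) m = c * cf f m"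
proof -
  have "cf (Con c * f) m = (\<Sum>(a, b)\<in>{({#}, m)}. cf (Con c) a * cf f b)"
    unfolding cf_mult by (rule sum.mono_neutral_right) (auto simp: cf_Con split: if_splits)
  then show ?thesis by (simp add: cf_Con)
qed

lemma cf_X_mult: "cf (X i * f) m = (if i \<in># m then cf f (m - {#i#}) else 0)"
proof (cases "i \<in># m")
  case True
  have "cf (X i * f) m = (\<Sum>(a, b)\<in>{({#i#}, m - {#i#})}. cf (X i) a * cf f b)"
    unfolding cf_mult using True by (intro sum.mono_neutral_right) (auto simp: cf_X split: if_splits)
  then show ?thesis using True by (simp add: cf_X)
next
  case False
  have "cf (X i * f) m = 0"
    unfolding cf_mult using False by (intro sum.neutral) (auto simp: cf_X split: if_splits)
  then show ?thesis using False by simp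
qed

lemma cf_X_mult_add [simp]: "cf (X i * f) (add_mset i m) = cf f m"
  by (simp add: cf_X_mult)

lemma Con_simps:
  "Con (a + b) = Con a + Con b" "Con (a - b) = Con a - Con b" "Con (a * b) = Con a * Con b"
  "Con 0 = 0" "Con 1 = 1" "Con (- a) = - Con a"
  by (auto intro!: mps_eqI simp: cf_Con cf_one)

lemma char2_add_self:
  assumes "CHAR('a::field) = 2"
  shows "(x :: 'a) + x = 0"
proof -
  have "(of_nat 2 :: 'a) = 0"
    using assms of_nat_CHAR[where 'a = 'a] by simp
  then have "(1 + 1 :: 'a) = 0" by simp
  then have "x * (1 + 1) = 0" by simp
  then show ?thesis by (simp only: distrib_left mult_1_right)
qed

lemma char2_mps_add_self:
  assumes "CHAR('a::field) = 2"
  shows "(f :: 'a mps) + f = 0"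
  by (rule mps_eqI) (simp only: cf_simps char2_add_self[OF assms])

lemma char2_uminus:
  assumes "CHAR('a::field) = 2"
  shows "- (x :: 'a) = x" "- (f :: 'a mps) = f"
  using char2_add_self[OF assms, of x] char2_mps_add_self[OF assms, of f]
  by (simp_all add: minus_unique)

section \<open>Orders and homogeneous parts\<close>

text \<open>For finite \<open>V\<close> this is the \<open>k\<close>-th power of the maximal ideal
  of the power series ring in the variables \<open>V\<close>. The description by coefficients allows
  \<open>V\<close> to shrink and grow when variables are split off.\<close>

definition mpow :: "nat set \<Rightarrow> nat \<Rightarrow> 'a::field mps set" where
  "mpow V k = {f. \<forall>m. cf f m \<noteq> 0 \<longrightarrow> set_mset m \<subseteq> V \<and> k \<le> size m}"

definition homog :: "nat set \<Rightarrow> nat \<Rightarrow> 'a::field mps set" where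
  "homog V k = {f. \<forall>m. cf f m \<noteq> 0 \<longrightarrow> set_mset m \<subseteq> V \<and> size m = k}"

abbreviation ser :: "nat set \<Rightarrow> 'a::field mps set" where
  "ser V \<equiv> mpow V 0"

lemma mpowI: "(\<And>m. cf f m \<noteq> 0 \<Longrightarrow> set_mset m \<subseteq> V \<and> k \<le> size m) \<Longrightarrow> f \<in> mpow V k"
  by (auto simp: mpow_def)

lemma mpowD: "f \<in> mpow V k \<Longrightarrow> size m < k \<Longrightarrow> cf f m = 0"
  unfolding mpow_def by (auto simp: not_less[symmetric])

lemma mpow_zero [simp]: "0 \<in> mpow V k" by (simp add: mpow_def)
lemma homog_zero [simp]: "0 \<in> homog V k" by (simp add: homog_def)

lemma mpow_add: "f \<in> mpow V k \<Longrightarrow> g \<in> mpow V k \<Longrightarrow> f + g \<in> mpow V k"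
  unfolding mpow_def by (auto, (metis add_0 subset_iff, metis add_0)?)

lemma mpow_uminus: "f \<in> mpow V k \<Longrightarrow> - f \<in> mpow V k"
  by (auto simp: mpow_def)

lemma mpow_diff: "f \<in> mpow V k \<Longrightarrow> g \<in> mpow V k \<Longrightarrow> f - g \<in> mpow V k"
  using mpow_add[of f V k "- g"] mpow_uminus by fastforce

lemma mpow_sum: "(\<And>i. i \<in> A \<Longrightarrow> F i \<in> mpow V k) \<Longrightarrow> sum F A \<in> mpow V k"
  by (induction A rule: infinite_finite_induct) (auto intro: mpow_add)

lemma mpow_mono: "f \<in> mpow V k \<Longrightarrow> l \<le> k \<Longrightarrow> V \<subseteq> W \<Longrightarrow> f \<in> mpow W l"
  unfolding mpow_def by force

lemma mpow_mult: "f \<in> mpow V j \<Longrightarrow> g \<in> mpow V k \<Longrightarrow> f * g \<in> mpow V (j + k)"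
proof (rule mpowI)
  fix m assume fg: "f \<in> mpow V j" "g \<in> mpow V k" and "cf (f * g) m \<noteq> 0"
  then obtain a b where "a + b = m" "cf f a * cf g b \<noteq> 0"
    unfolding cf_mult splits_def by (auto elim: sum.not_neutral_contains_not_neutral)
  then have "set_mset a \<subseteq> V \<and> j \<le> size a" "set_mset b \<subseteq> V \<and> k \<le> size b" "m = a + b"
    using fg unfolding mpow_def by auto
  then show "set_mset m \<subseteq> V \<and> j + k \<le> size m"
    by auto
qed

lemma mpow_Con [simp]: "Con c \<in> ser V"
  by (auto simp: mpow_def cf_Con)

lemma mpow_one [simp]: "1 \<in> ser V"
  by (auto simp: mpow_def cf_one)

lemma mpow_X: "i \<in> V \<Longrightarrow> X i \<in> mpow V (Suc 0)"
  by (auto simp: mpow_def cf_X)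

lemma mpow_Con_mult: "f \<in> mpow V k \<Longrightarrow> Con c * f \<in> mpow V k"
  using mpow_mult[of "Con c" V 0 f k] by simp

lemma mpow_ser: "f \<in> mpow V k \<Longrightarrow> f \<in> ser V"
  by (erule mpow_mono) auto

lemma mpow_mult_left: "f \<in> ser V \<Longrightarrow> g \<in> mpow V k \<Longrightarrow> f * g \<in> mpow V k"
  using mpow_mult[of f V 0 g k] by simp

lemma mpow_mult_right: "f \<in> mpow V k \<Longrightarrow> g \<in> ser V \<Longrightarrow> f * g \<in> mpow V k"
  using mpow_mult[of f V k g 0] by simp

text \<open>Precision is measured relative to the order: if both factors are known up to
  \<open>d\<close> orders beyond their own, so is the product. Inductions on the order rest on
  this.\<close>

lemma mpow_diff_cong:
  assumes "f \<in> mpow V j" "g' \<in> mpow V k" "f - f' \<in> mpow V (j + d)" "g - g' \<in> mpow V (k + d)"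
  shows "f * g - f' * g' \<in> mpow V (j + k + d)"
proof -
  have "f * g - f' * g' = f * (g - g') + (f - f') * g'" by (simp add: algebra_simps)
  moreover have "f * (g - g') \<in> mpow V (j + k + d)"
    using mpow_mult[OF assms(1,4)] by (simp add: add.assoc)
  moreover have "(f - f') * g' \<in> mpow V (j + k + d)"
    using mpow_mult[OF assms(3,2)] by (simp add: ac_simps)
  ultimately show ?thesis by (simp add: mpow_add)
qed

lemma mpow_eq_zero: "(\<And>k. f \<in> mpow V k) \<Longrightarrow> f = 0"
  by (rule mps_eqI, unfold mpow_def) (metis (mono_tags, lifting) cf_simps(1) mem_Collect_eq not_less_eq_eq)

lemma homogD: "f \<in> homog V k \<Longrightarrow> f \<in> mpow V k"
  by (auto simp: homog_def mpow_def)

lemma homog_add: "f \<in> homog V k \<Longrightarrow> g \<in> homog V k \<Longrightarrow> f + g \<in> homog V k"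
  unfolding homog_def by (auto, (metis add_0 subset_iff, metis add_0)?)

lemma homog_uminus: "f \<in> homog V k \<Longrightarrow> - f \<in> homog V k"
  by (auto simp: homog_def)

lemma homog_diff: "f \<in> homog V k \<Longrightarrow> g \<in> homog V k \<Longrightarrow> f - g \<in> homog V k"
  using homog_add[of f V k "- g"] homog_uminus by fastforce

lemma homog_sum: "(\<And>i. i \<in> A \<Longrightarrow> F i \<in> homog V k) \<Longrightarrow> sum F A \<in> homog V k"
  by (induction A rule: infinite_finite_induct) (auto intro: homog_add)

lemma homog_mono: "f \<in> homog V k \<Longrightarrow> V \<subseteq> W \<Longrightarrow> f \<in> homog W k"
  unfolding homog_def by force

lemma homog_mult: "f \<in> homog V j \<Longrightarrow> g \<in> homog V k \<Longrightarrow> f * g \<in> homog V (j + k)"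
proof -
  assume fg: "f \<in> homog V j" "g \<in> homog V k"
  { fix m assume "cf (f * g) m \<noteq> 0"
    then obtain a b where "a + b = m" "cf f a * cf g b \<noteq> 0"
      unfolding cf_mult splits_def by (auto elim: sum.not_neutral_contains_not_neutral)
    then have "set_mset a \<subseteq> V \<and> size a = j" "set_mset b \<subseteq> V \<and> size b = k" "m = a + b"
      using fg unfolding homog_def by auto
    then have "set_mset m \<subseteq> V \<and> size m = j + k"
      by auto }
  then show ?thesis unfolding homog_def by blast
qed

lemma homog_Con [simp]: "Con c \<in> homog V 0"
  by (auto simp: homog_def cf_Con)

lemma homog_X: "i \<in> V \<Longrightarrow> X i \<in> homog V (Suc 0)"
  by (auto simp: homog_def cf_X)

lemma homog_Con_mult: "f \<in> homog V k \<Longrightarrow> Con c * f \<in> homog V k"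
  using homog_mult[of "Con c" V 0 f k] by simp

lemma homog_split:
  assumes "f \<in> homog V (Suc k)"
  obtains A R where "A \<in> homog V k" "R \<in> homog (V - {x}) (Suc k)" "f = X x * A + R"
    "\<And>m. cf A m = cf f (add_mset x m)"
proof
  let ?A = "Mps (\<lambda>m. cf f (add_mset x m))" and ?R = "Mps (\<lambda>m. if x \<in># m then 0 else cf f m)"
  show "?A \<in> homog V k" "?R \<in> homog (V - {x}) (Suc k)" "\<And>m. cf ?A m = cf f (add_mset x m)"
    using assms unfolding homog_def by (auto simp: subset_iff split: if_splits)
  show "f = X x * ?A + ?R"
    by (rule mps_eqI) (auto simp: cf_X_mult)
qed

lemma homog_1_split:
  assumes "f \<in> homog V (Suc 0)"
  obtains R where "R \<in> homog (V - {x}) (Suc 0)" "f = Con (cf f {#x#}) * X x + R"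
proof (rule homog_split[OF assms, of x])
  fix A R
  assume *: "A \<in> homog V 0" "R \<in> homog (V - {x}) (Suc 0)" "f = X x * A + R"
    "\<And>m. cf A m = cf f (add_mset x m)"
  have "A = Con (cf f {#x#})"
  proof (rule mps_eqI)
    fix m
    have "cf A m \<noteq> 0 \<Longrightarrow> m = {#}" using *(1) unfolding homog_def by force
    then show "cf A m = cf (Con (cf f {#x#})) m" using *(4)[of "{#}"] by (auto simp only: cf_Con split: if_splits)
  qed
  then have "f = Con (cf f {#x#}) * X x + R"
    using *(3) by (metis mult.commute)
  with *(2) that[of R] show thesis by simp
qed

text \<open>
  The monomials of \<open>f\<close> meeting \<open>W\<close> are distributed over the terms \<open>X i * quot_var W i f\<close> according
  to their least variable \<open>i \<in> W\<close>.
\<close>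

definition quot_var :: "nat set \<Rightarrow> nat \<Rightarrow> 'a::field mps \<Rightarrow> 'a mps" where
  "quot_var W i f = Mps (\<lambda>m. if \<forall>j\<in>W. j < i \<longrightarrow> j \<notin># m then cf f (add_mset i m) else 0)"

definition restrict_vars :: "nat set \<Rightarrow> 'a::field mps \<Rightarrow> 'a mps" where
  "restrict_vars R f = Mps (\<lambda>m. if set_mset m \<subseteq> R then cf f m else 0)"

lemma quot_var_mpow: "f \<in> mpow V k \<Longrightarrow> quot_var W i f \<in> mpow V (k - 1)"
  unfolding mpow_def quot_var_def by (auto split: if_splits) (metis Suc_le_mono Suc_pred insert_subset le_zero_eq nat_le_linear not_gr0 set_mset_add_mset_insert size_add_mset subset_iff)+

lemma quot_var_diff: "quot_var W i (f - g) = quot_var W i f - quot_var W i g"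
  by (rule mps_eqI) (auto simp: quot_var_def)

lemma quot_var_sum:
  assumes "finite W"
  shows "(\<Sum>i\<in>W. X i * quot_var W i f) = f - restrict_vars (- W) f"
proof (rule mps_eqI)
  fix m
  have *: "cf (X i * quot_var W i f) m
      = (if i \<in># m \<and> (\<forall>j\<in>W. j < i \<longrightarrow> j \<notin># m) then cf f m else 0)" if "i \<in> W" for i
    using that by (auto simp: cf_X_mult quot_var_def in_diff_count)
  show "cf (\<Sum>i\<in>W. X i * quot_var W i f) m = cf (f - restrict_vars (- W) f) m"
  proof (cases "set_mset m \<subseteq> - W")
    case True
    then have "cf (\<Sum>i\<in>W. X i * quot_var W i f) m = 0"
      by (auto simp: * intro!: sum.neutral)
    then show ?thesis using True by (simp add: restrict_vars_def)
  next
    case False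
    define i where "i = Min (set_mset m \<inter> W)"
    have i: "i \<in># m" "i \<in> W" and min: "\<And>j. j \<in># m \<Longrightarrow> j \<in> W \<Longrightarrow> i \<le> j"
      using False Min_in[of "set_mset m \<inter> W"] unfolding i_def by (auto intro: Min_le)
    have "cf (\<Sum>i\<in>W. X i * quot_var W i f) m
        = (\<Sum>k\<in>W. if k \<in># m \<and> (\<forall>j\<in>W. j < k \<longrightarrow> j \<notin># m) then cf f m else 0)"
      unfolding cf_sum by (rule sum.cong) (auto simp: *)
    also have "\<dots> = (\<Sum>k\<in>W. if k = i then cf f m else 0)"
    proof (rule sum.cong[OF refl])
      fix k assume "k \<in> W"
      then have "k \<in># m \<and> (\<forall>j\<in>W. j < k \<longrightarrow> j \<notin># m) \<longleftrightarrow> k = i"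
        using i min[of k] by (auto simp: not_less dest: min)
      then show "(if k \<in># m \<and> (\<forall>j\<in>W. j < k \<longrightarrow> j \<notin># m) then cf f m else 0) = (if k = i then cf f m else 0)"
        by simp
    qed
    also have "\<dots> = cf f m" using i assms by simp
    finally show ?thesis using False by (simp add: restrict_vars_def)
  qed
qed

lemma restrict_vars_mpow: "f \<in> mpow V k \<Longrightarrow> restrict_vars R f \<in> mpow (V \<inter> R) k"
  unfolding mpow_def restrict_vars_def by (auto split: if_splits)

lemma restrict_vars_compl:
  assumes "f \<in> ser V"
  shows "restrict_vars (- V) f = Con (cf f {#})"
proof (rule mps_eqI)
  fix m
  show "cf (restrict_vars (- V) f) m = cf (Con (cf f {#})) m"
    using assms unfolding restrict_vars_def mpow_def
    by (cases "m = {#}") (force simp: cf_Con)+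
qed

lemma ser_decompose:
  assumes "finite V" "f \<in> ser V"
  shows "f = Con (cf f {#}) + (\<Sum>i\<in>V. X i * quot_var V i f)"
  using quot_var_sum[OF assms(1), of f] restrict_vars_compl[OF assms(2)] by simp

lemma mpow_decompose:
  assumes "finite V" "f \<in> mpow V (Suc k)"
  shows "f = (\<Sum>i\<in>V. X i * quot_var V i f)"
proof -
  have "cf f {#} = 0" using assms(2) by (auto simp: mpow_def)
  then show ?thesis
    using ser_decompose[OF assms(1), of f] mpow_ser[OF assms(2)] by (simp add: Con_simps)
qed

lemma ser_iff: "f \<in> ser V \<longleftrightarrow> (\<forall>m. \<not> set_mset m \<subseteq> V \<longrightarrow> cf f m = 0)"
  by (auto simp: mpow_def)

lemma mpow_diffI:
  assumes "f \<in> ser V" "g \<in> ser V" "\<And>m. size m < k \<Longrightarrow> cf f m = cf g m"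
  shows "f - g \<in> mpow V k"
proof (rule mpowI)
  fix m assume "cf (f - g) m \<noteq> 0"
  then have "cf f m \<noteq> cf g m" by simp
  then show "set_mset m \<subseteq> V \<and> k \<le> size m"
    using assms by (metis ser_iff not_le)
qed

lemma mpow_diffD:
  assumes "f - g \<in> mpow V k" "size m < k"
  shows "cf f m = cf g m"
proof (rule ccontr)
  assume "cf f m \<noteq> cf g m"
  then have "cf (f - g) m \<noteq> 0" by simp
  with assms show False unfolding mpow_def by fastforce
qed

text \<open>Banach's fixed point theorem for the topology given by the powers of the maximal ideal.\<close>

lemma contraction_fixpoint:
  fixes T :: "('i \<Rightarrow> 'a::field mps) \<Rightarrow> 'i \<Rightarrow> 'a mps" and ok :: "monom \<Rightarrow> bool"
  defines "adm \<equiv> \<lambda>F. \<forall>i m. \<not> ok m \<longrightarrow> cf (F i) m = 0"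
  assumes closed: "\<And>F. adm F \<Longrightarrow> adm (T F)"
    and contr: "\<And>F G k. adm F \<Longrightarrow> adm G \<Longrightarrow> (\<And>i m. size m < k \<Longrightarrow> cf (F i) m = cf (G i) m)
      \<Longrightarrow> (\<And>i m. size m < Suc k \<Longrightarrow> cf (T F i) m = cf (T G i) m)"
  shows "\<exists>F. adm F \<and> T F = F"
proof -
  define Z where "Z k = (T ^^ k) (\<lambda>_. 0)" for k
  have admZ: "adm (Z k)" for k
    by (induction k) (auto simp: Z_def intro: closed, simp add: adm_def)
  have step: "cf (Z k i) m = cf (Z (k + d) i) m" if "size m < k" for k d i m
    using that
  proof (induction k arbitrary: i m)
    case (Suc k)
    show ?case
      using contr[OF admZ admZ, of k k "k + d" m i] Suc by (auto simp: Z_def)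
  qed simp
  \<comment> \<open>The coefficient at \<open>m\<close> is stationary from iteration
    \<open>Suc (size m)\<close> on, which defines the limit.\<close>
  define F where "F i = Mps (\<lambda>m. cf (Z (Suc (size m)) i) m)" for i
  have FZ: "cf (F i) m = cf (Z k i) m" if "size m < k" for i m k
    using step[of m "Suc (size m)" i "k - Suc (size m)"] that by (simp add: F_def)
  have admF: "adm F"
    using admZ by (auto simp: adm_def F_def)
  have "T F i = F i" for i
  proof (rule mps_eqI)
    fix m
    have "cf (T F i) m = cf (T (Z (size m)) i) m"
      by (rule contr[OF admF admZ, of "size m"]) (auto simp: FZ)
    also have "\<dots> = cf (F i) m"
      by (simp add: F_def Z_def)
    finally show "cf (T F i) m = cf (F i) m" .
  qed
  with admF show ?thesis by (intro exI[of _ F]) auto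
qed

section \<open>Substitution and automorphisms\<close>

definition alg_endo :: "nat set \<Rightarrow> ('a::field mps \<Rightarrow> 'a mps) \<Rightarrow> bool" where
  "alg_endo V F \<longleftrightarrow> F ` ser V \<subseteq> ser V \<and> (\<forall>c. F (Con c) = Con c) \<and>
    (\<forall>f\<in>ser V. \<forall>g\<in>ser V. F (f + g) = F f + F g \<and> F (f * g) = F f * F g)"

definition alg_auto :: "nat set \<Rightarrow> ('a::field mps \<Rightarrow> 'a mps) \<Rightarrow> bool" where
  "alg_auto V F \<longleftrightarrow> alg_endo V F \<and> bij_betw F (ser V) (ser V)"

text \<open>With the variables going to the maximal ideal, the endomorphism is continuous for the
  topology of its powers, and so determined by the images of the variables.\<close>

definition local_endo :: "nat set \<Rightarrow> ('a::field mps \<Rightarrow> 'a mps) \<Rightarrow> bool" where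
  "local_endo V F \<longleftrightarrow> alg_endo V F \<and> (\<forall>i\<in>V. F (X i) \<in> mpow V (Suc 0))"

lemma alg_endoD:
  assumes "alg_endo V F"
  shows "f \<in> ser V \<Longrightarrow> F f \<in> ser V" "F (Con c) = Con c"
    "f \<in> ser V \<Longrightarrow> g \<in> ser V \<Longrightarrow> F (f + g) = F f + F g"
    "f \<in> ser V \<Longrightarrow> g \<in> ser V \<Longrightarrow> F (f * g) = F f * F g"
  using assms by (auto simp: alg_endo_def)

lemma alg_endo_simps:
  assumes "alg_endo V F"
  shows "F 0 = 0" "F 1 = 1" "f \<in> ser V \<Longrightarrow> F (Con c * f) = Con c * F f"
    "f \<in> ser V \<Longrightarrow> F (- f) = - F f"
    "f \<in> ser V \<Longrightarrow> g \<in> ser V \<Longrightarrow> F (f - g) = F f - F g"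
proof -
  show "F 0 = 0" "F 1 = 1"
    using alg_endoD(2)[OF assms, of 0] alg_endoD(2)[OF assms, of 1] by (simp_all add: Con_simps)
  show *: "f \<in> ser V \<Longrightarrow> F (Con c * f) = Con c * F f" for f c
    using alg_endoD(2,4)[OF assms] by simp
  show **: "f \<in> ser V \<Longrightarrow> F (- f) = - F f" for f
    using *[of f "- 1"] by (simp add: Con_simps)
  show "f \<in> ser V \<Longrightarrow> g \<in> ser V \<Longrightarrow> F (f - g) = F f - F g"
    using alg_endoD(3)[OF assms, of f "- g"] **[of g] mpow_uminus[of g V 0] by simp
qed

lemma alg_endo_sum:
  assumes "alg_endo V F" "\<And>i. i \<in> A \<Longrightarrow> G i \<in> ser V"
  shows "F (sum G A) = (\<Sum>i\<in>A. F (G i))"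
  using assms(2)
proof (induction A rule: infinite_finite_induct)
  case (insert x A)
  then show ?case
    using alg_endoD(3)[OF assms(1), of "G x" "sum G A"] by (simp add: mpow_sum)
qed (simp_all add: alg_endo_simps(1)[OF assms(1)])

lemma alg_endo_comp: "alg_endo V F \<Longrightarrow> alg_endo V G \<Longrightarrow> alg_endo V (F \<circ> G)"
  by (auto simp: alg_endo_def image_subset_iff)

lemma local_endo_alg: "local_endo V F \<Longrightarrow> alg_endo V F"
  by (simp add: local_endo_def)

text \<open>This replaces infinite sums, about which a bare ring homomorphism says nothing: peeling
  off one variable reduces a claim on \<open>F f\<close> to quotients of order one lower, and
  induction on the order does the rest.\<close>

lemma alg_endo_decompose:
  assumes "finite V" "alg_endo V F" "f \<in> ser V"
  shows "F f = Con (cf f {#}) + (\<Sum>i\<in>V. F (X i) * F (quot_var V i f))"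
proof -
  have q: "quot_var V i f \<in> ser V" for i
    using quot_var_mpow[OF assms(3)] by simp
  have X: "X i \<in> ser V" if "i \<in> V" for i
    using mpow_X[OF that] by (rule mpow_ser)
  have Xq: "X i * quot_var V i f \<in> ser V" if "i \<in> V" for i
    by (rule mpow_mult_left[OF X[OF that] q])
  have "F f = F (Con (cf f {#}) + (\<Sum>i\<in>V. X i * quot_var V i f))"
    using ser_decompose[OF assms(1,3)] by simp
  also have "\<dots> = F (Con (cf f {#})) + F (\<Sum>i\<in>V. X i * quot_var V i f)"
    using Xq by (intro alg_endoD(3)[OF assms(2)]) (auto intro: mpow_sum)
  also have "F (\<Sum>i\<in>V. X i * quot_var V i f) = (\<Sum>i\<in>V. F (X i * quot_var V i f))"
    using Xq by (rule alg_endo_sum[OF assms(2)])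
  also have "(\<Sum>i\<in>V. F (X i * quot_var V i f)) = (\<Sum>i\<in>V. F (X i) * F (quot_var V i f))"
    using q X by (intro sum.cong refl alg_endoD(4)[OF assms(2)])
  finally show ?thesis
    by (simp add: alg_endoD(2)[OF assms(2)])
qed

lemma local_endo_mpow:
  assumes "finite V" "local_endo V F" "f \<in> mpow V k"
  shows "F f \<in> mpow V k"
  using assms(3)
proof (induction k arbitrary: f)
  case 0
  then show ?case using alg_endoD(1) local_endo_alg assms(2) by blast
next
  case (Suc k)
  have *: "cf f {#} = 0" using Suc.prems by (auto simp: mpow_def)
  have "F f = (\<Sum>i\<in>V. F (X i) * F (quot_var V i f))"
    using alg_endo_decompose[OF assms(1) local_endo_alg[OF assms(2)] mpow_ser[OF Suc.prems]] *
    by (simp add: Con_simps)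
  moreover have "F (X i) * F (quot_var V i f) \<in> mpow V (Suc 0 + k)" if "i \<in> V" for i
    using that assms(2) Suc.IH quot_var_mpow[OF Suc.prems] by (intro mpow_mult) (auto simp: local_endo_def)
  ultimately show ?case by (simp add: mpow_sum)
qed

text \<open>Each variable peeled off maps into the maximal ideal and thus raises by one the order up
  to which the two images are known to agree, until the bound \<open>k\<close> from the variables
  themselves is reached.\<close>

lemma local_endo_cong:
  assumes "finite V" "local_endo V F" "local_endo V G"
    and "\<And>i. i \<in> V \<Longrightarrow> F (X i) - G (X i) \<in> mpow V k" and f: "f \<in> ser V"
  shows "F f - G f \<in> mpow V k"
proof -
  note F = local_endo_alg[OF assms(2)] and G = local_endo_alg[OF assms(3)]
  have "f \<in> ser V \<Longrightarrow> j \<le> k \<Longrightarrow> F f - G f \<in> mpow V j" for j f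
  proof (induction j arbitrary: f)
    case 0
    then show ?case using alg_endoD(1)[OF F] alg_endoD(1)[OF G] by (simp add: mpow_diff)
  next
    case (Suc j)
    let ?q = "\<lambda>i. quot_var V i f"
    have q: "?q i \<in> ser V" for i
      using quot_var_mpow[OF Suc.prems(1)] by simp
    have "F f - G f = (\<Sum>i\<in>V. F (X i) * F (?q i) - G (X i) * G (?q i))"
      using alg_endo_decompose[OF assms(1) F] alg_endo_decompose[OF assms(1) G] Suc.prems(1)
      by (simp add: sum_subtractf)
    also have "\<dots> \<in> mpow V (Suc j)"
    proof (rule mpow_sum)
      fix i assume i: "i \<in> V"
      have "F (X i) * (F (?q i) - G (?q i)) \<in> mpow V (Suc 0 + j)"
        using i assms(2) Suc q by (intro mpow_mult Suc.IH) (auto simp: local_endo_def)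
      moreover have "(F (X i) - G (X i)) * G (?q i) \<in> mpow V (Suc j)"
        using assms(4)[OF i] q Suc.prems(2) alg_endoD(1)[OF G]
        by (intro mpow_mult_right) (auto intro: mpow_mono)
      ultimately have "F (X i) * (F (?q i) - G (?q i)) + (F (X i) - G (X i)) * G (?q i) \<in> mpow V (Suc j)"
        by (simp add: mpow_add)
      then show "F (X i) * F (?q i) - G (X i) * G (?q i) \<in> mpow V (Suc j)"
        by (simp add: algebra_simps)
    qed
    finally show ?case .
  qed
  with f show ?thesis by blast
qed

lemma local_endo_eqI:
  assumes "finite V" "local_endo V F" "local_endo V G"
    and "\<And>i. i \<in> V \<Longrightarrow> F (X i) = G (X i)" and "f \<in> ser V"
  shows "F f = G f"
proof -
  have "F f - G f \<in> mpow V k" for k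
    by (rule local_endo_cong[OF assms(1,2,3) _ assms(5)]) (simp add: assms(4))
  then have "F f - G f = 0" by (rule mpow_eq_zero)
  then show ?thesis by simp
qed

lemma local_endo_comp:
  assumes "finite V" "local_endo V F" "local_endo V G"
  shows "local_endo V (F \<circ> G)"
  using assms local_endo_mpow[OF assms(1,2)] alg_endo_comp by (auto simp: local_endo_def)

lemma local_endo_id: "local_endo V id"
  by (auto simp: local_endo_def alg_endo_def intro: mpow_X)

lemma mpow_1_iff: "f \<in> mpow V (Suc 0) \<longleftrightarrow> f \<in> ser V \<and> cf f {#} = 0"
  unfolding mpow_def by (auto simp: Suc_le_eq) (metis size_empty gr0I size_eq_0_iff_empty)+

text \<open>\<open>quot_var V i f\<close> differs from its constant term, the coefficient of
  \<open>X i\<close>, by an element of the maximal ideal, so replacing one by the other costs only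
  terms of order two.\<close>

lemma local_endo_linear:
  assumes "finite V" "local_endo V F" "f \<in> mpow V (Suc 0)"
  shows "F f - (\<Sum>i\<in>V. Con (cf f {#i#}) * F (X i)) \<in> mpow V 2"
proof -
  note F = local_endo_alg[OF assms(2)]
  let ?q = "\<lambda>i. quot_var V i f"
  have q: "?q i \<in> ser V" for i
    using quot_var_mpow[OF assms(3)] by simp
  have "cf f {#} = 0" using assms(3) by (auto simp: mpow_def)
  then have "F f = (\<Sum>i\<in>V. F (X i) * F (?q i))"
    using alg_endo_decompose[OF assms(1) F mpow_ser[OF assms(3)]] by (simp add: Con_simps)
  moreover have "F (?q i - Con (cf f {#i#})) = F (?q i) - Con (cf f {#i#})" for i
    using alg_endo_simps(5)[OF F q mpow_Con] alg_endoD(2)[OF F] by metis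
  ultimately have "F f - (\<Sum>i\<in>V. Con (cf f {#i#}) * F (X i)) = (\<Sum>i\<in>V. F (X i) * F (?q i - Con (cf f {#i#})))"
    by (simp add: sum_subtractf right_diff_distrib mult.commute)
  also have "\<dots> \<in> mpow V (Suc 0 + Suc 0)"
  proof (rule mpow_sum)
    fix i assume "i \<in> V"
    then have "F (X i) \<in> mpow V (Suc 0)" using assms(2) by (simp add: local_endo_def)
    moreover have "?q i - Con (cf f {#i#}) \<in> mpow V (Suc 0)"
      using q by (auto simp: mpow_1_iff quot_var_def cf_Con intro: mpow_diff)
    ultimately show "F (X i) * F (?q i - Con (cf f {#i#})) \<in> mpow V (Suc 0 + Suc 0)"
      by (intro mpow_mult[OF _ local_endo_mpow[OF assms(1,2)]])
  qed
  finally show ?thesis by (simp add: numeral_2_eq_2)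
qed

text \<open>Geometric series: after division by the constant term, \<open>f\<close> is
  \<open>1 - h\<close> with \<open>h\<close> in the maximal ideal, and its inverse is the fixed
  point of \<open>F = 1 + h * F\<close>.\<close>

lemma unit_series:
  fixes f :: "'a::field mps"
  assumes "f \<in> ser V" "cf f {#} \<noteq> 0"
  shows "\<exists>g\<in>ser V. f * g = 1"
proof -
  let ?c = "cf f {#}"
  define h where "h = 1 - Con (1 / ?c) * f"
  have h: "h \<in> mpow V (Suc 0)"
    using assms by (auto simp: mpow_1_iff h_def cf_one intro!: mpow_diff mpow_Con_mult)
  let ?T = "\<lambda>F (i::unit). 1 + h * F i"
  have "\<exists>F. (\<forall>i m. \<not> set_mset m \<subseteq> V \<longrightarrow> cf (F i) m = 0) \<and> ?T F = F"
  proof (rule contraction_fixpoint)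
    fix F :: "unit \<Rightarrow> 'a mps" assume F: "\<forall>i m. \<not> set_mset m \<subseteq> V \<longrightarrow> cf (F i) m = 0"
    then have "F i \<in> ser V" for i by (auto simp: mpow_def)
    then have "1 + h * F i \<in> ser V" for i
      using h by (auto intro!: mpow_add mpow_mult_left mpow_ser[of h])
    then show "\<forall>i m. \<not> set_mset m \<subseteq> V \<longrightarrow> cf (?T F i) m = 0" by (auto simp: mpow_def)
  next
    fix F G :: "unit \<Rightarrow> 'a mps" and k i and m :: monom
    assume "\<forall>i m. \<not> set_mset m \<subseteq> V \<longrightarrow> cf (F i) m = 0" "\<forall>i m. \<not> set_mset m \<subseteq> V \<longrightarrow> cf (G i) m = 0"
      and "\<And>i m. size m < k \<Longrightarrow> cf (F i) m = cf (G i) m" and m: "size m < Suc k"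
    then have "F i - G i \<in> mpow V k"
      by (intro mpow_diffI) (auto simp: ser_iff)
    from mpow_mult[OF h this] have "h * F i - h * G i \<in> mpow V (Suc k)"
      by (simp add: algebra_simps)
    then show "cf (?T F i) m = cf (?T G i) m"
      using mpow_diffD[OF _ m] by fastforce
  qed
  then obtain F where F: "\<And>i m. \<not> set_mset m \<subseteq> V \<Longrightarrow> cf (F i) m = 0" "\<And>i::unit. 1 + h * F i = F i"
    by metis
  let ?g = "Con (1 / ?c) * F ()"
  have "F () \<in> ser V" using F(1) by (auto simp: mpow_def)
  then have "?g \<in> ser V" by (rule mpow_Con_mult)
  moreover have "f * ?g = 1"
    using F(2)[of "()"] by (simp add: h_def algebra_simps)
  ultimately show ?thesis by blast
qed

lemma cf_mult_const: "cf (f * g) {#} = cf f {#} * cf g {#}"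
proof -
  have "splits {#} = {({#}, {#})}" by (auto simp: splits_def)
  then show ?thesis by (simp add: cf_mult)
qed

lemma alg_auto_inv:
  fixes F :: "'a::field mps \<Rightarrow> 'a mps"
  assumes "alg_auto V F"
  obtains G where "alg_auto V G" "\<And>f. f \<in> ser V \<Longrightarrow> F (G f) = f" "\<And>f. f \<in> ser V \<Longrightarrow> G (F f) = f"
proof -
  from assms have F: "alg_endo V F" and bij: "bij_betw F (ser V) (ser V)"
    by (auto simp: alg_auto_def)
  define G where "G = the_inv_into (ser V) F"
  have inj: "inj_on F (ser V)" and im: "F ` ser V = ser V" using bij by (auto simp: bij_betw_def)
  have G: "G f \<in> ser V" "F (G f) = f" if "f \<in> ser V" for f
    using that inj im by (auto simp: G_def f_the_inv_into_f the_inv_into_into)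
  have GF: "G (F f) = f" if "f \<in> ser V" for f
    using that inj by (simp add: G_def the_inv_into_f_f)
  have "alg_auto V G"
    unfolding alg_auto_def alg_endo_def
  proof (intro conjI ballI allI)
    show "bij_betw G (ser V) (ser V)" unfolding G_def by (rule bij_betw_the_inv_into[OF bij])
    show "G ` ser V \<subseteq> ser V" using G by auto
    show "G (Con c) = Con c" for c using GF[of "Con c"] alg_endoD(2)[OF F] by simp
    fix f g :: "'a mps" assume fg: "f \<in> ser V" "g \<in> ser V"
    have "f + g = F (G f + G g)" "f * g = F (G f * G g)"
      using fg G by (simp_all add: alg_endoD[OF F])
    then show "G (f + g) = G f + G g" "G (f * g) = G f * G g"
      using fg G GF by (simp_all add: mpow_add mpow_mult_left)
  qed
  with G GF that show ?thesis by blast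
qed

text \<open>Automorphisms are local since the maximal ideal consists of the non-units.\<close>

lemma alg_auto_local:
  assumes "alg_auto V F"
  shows "local_endo V F"
proof -
  from assms have F: "alg_endo V F" by (simp add: alg_auto_def)
  obtain G where G: "alg_auto V G" "\<And>f. f \<in> ser V \<Longrightarrow> F (G f) = f" "\<And>f. f \<in> ser V \<Longrightarrow> G (F f) = f"
    using alg_auto_inv[OF assms] by blast
  from G(1) have G': "alg_endo V G" by (simp add: alg_auto_def)
  have "F (X i) \<in> mpow V (Suc 0)" if "i \<in> V" for i
  proof (rule ccontr)
    assume *: "F (X i) \<notin> mpow V (Suc 0)"
    have X: "X i \<in> ser V" using mpow_X[OF that] mpow_ser by blast
    then have FX: "F (X i) \<in> ser V" by (rule alg_endoD(1)[OF F])
    with * have "cf (F (X i)) {#} \<noteq> 0" by (simp add: mpow_1_iff[of "F (X i)"])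
    then obtain g where "g \<in> ser V" "F (X i) * g = 1" using unit_series[OF FX] by blast
    then have "X i * G g = 1"
      using alg_endoD(4)[OF G' FX] G(3)[OF X] alg_endo_simps(2)[OF G'] by metis
    then show False using cf_mult_const[of "X i" "G g"] by (simp add: cf_one cf_X)
  qed
  with F show ?thesis by (simp add: local_endo_def)
qed

lemma alg_auto_endo: "alg_auto V F \<Longrightarrow> alg_endo V F"
  by (simp add: alg_auto_def)

lemma alg_auto_mpow: "finite V \<Longrightarrow> alg_auto V F \<Longrightarrow> f \<in> mpow V k \<Longrightarrow> F f \<in> mpow V k"
  using alg_auto_local local_endo_mpow by blast

lemma alg_auto_comp:
  assumes "alg_auto V F" "alg_auto V G"
  shows "alg_auto V (F \<circ> G)"
  using assms alg_endo_comp bij_betw_trans[of G "ser V" "ser V" F "ser V"] by (auto simp: alg_auto_def)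

lemma alg_auto_id: "alg_auto V id"
  using local_endo_id by (auto simp: alg_auto_def local_endo_def)

lemma alg_autoI:
  assumes "finite V" "local_endo V F" "local_endo V G"
    and "\<And>i. i \<in> V \<Longrightarrow> F (G (X i)) = X i" "\<And>i. i \<in> V \<Longrightarrow> G (F (X i)) = X i"
  shows "alg_auto V F"
proof -
  note F = local_endo_alg[OF assms(2)] and G = local_endo_alg[OF assms(3)]
  have FG: "F (G f) = f" if "f \<in> ser V" for f
    using local_endo_eqI[OF assms(1) local_endo_comp[OF assms(1,2,3)] local_endo_id _ that] assms(4)
    by simp
  have GF: "G (F f) = f" if "f \<in> ser V" for f
    using local_endo_eqI[OF assms(1) local_endo_comp[OF assms(1,3,2)] local_endo_id _ that] assms(5)
    by simp
  have "bij_betw F (ser V) (ser V)"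
    by (rule bij_betw_byWitness[of _ G]) (auto simp: FG GF alg_endoD(1)[OF F] alg_endoD(1)[OF G])
  with F show ?thesis by (simp add: alg_auto_def)
qed

text \<open>\<open>F - id\<close> raises the order of every series by one. Hence the kernel lies in
  all powers of the maximal ideal, and a preimage of \<open>g\<close> is the fixed point of the
  contraction sending \<open>f\<close> to \<open>g + (f - F f)\<close>.\<close>

lemma alg_auto_unipotent:
  fixes F :: "'a::field mps \<Rightarrow> 'a mps"
  assumes V: "finite V" and F: "local_endo V F" and "\<And>i. i \<in> V \<Longrightarrow> F (X i) - X i \<in> mpow V 2"
  shows "alg_auto V F"
proof -
  note u = assms(3)[unfolded numeral_2_eq_2]
  note E = local_endo_alg[OF F]
  have shift: "F f - f \<in> mpow V (Suc k)" if "f \<in> mpow V k" for f k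
    using that
  proof (induction k arbitrary: f)
    case 0
    have "F f - id f \<in> mpow V (Suc 0)"
      using u by (intro local_endo_cong[OF V F local_endo_id _ 0])
        (auto intro: mpow_mono[where k = "Suc (Suc 0)"])
    then show ?case by simp
  next
    case (Suc k)
    let ?q = "\<lambda>i. quot_var V i f"
    have q: "?q i \<in> mpow V k" for i
      using quot_var_mpow[OF Suc.prems] by simp
    have *: "cf f {#} = 0" using Suc.prems by (auto simp: mpow_def)
    have f: "f = (\<Sum>i\<in>V. X i * ?q i)"
      by (rule mpow_decompose[OF V Suc.prems])
    have Ff: "F f = (\<Sum>i\<in>V. F (X i) * F (?q i))"
      using alg_endo_decompose[OF V E mpow_ser[OF Suc.prems]] * by (simp add: Con_simps)
    have "F f - f = (\<Sum>i\<in>V. F (X i) * F (?q i) - X i * ?q i)"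
      by (simp only: sum_subtractf f[symmetric] Ff)
    also have "\<dots> \<in> mpow V (Suc (Suc k))"
    proof (rule mpow_sum)
      fix i assume i: "i \<in> V"
      have "F (X i) * F (?q i) - X i * ?q i \<in> mpow V (Suc 0 + k + 1)"
        using i F u[OF i] Suc.IH[OF q, of i] q
        by (intro mpow_diff_cong) (auto simp: local_endo_def)
      then show "F (X i) * F (?q i) - X i * ?q i \<in> mpow V (Suc (Suc k))" by simp
    qed
    finally show ?case .
  qed
  have "inj_on F (ser V)"
  proof (rule inj_onI)
    fix f g assume fg: "f \<in> ser V" "g \<in> ser V" "F f = F g"
    have "f - g \<in> mpow V k" for k
    proof (induction k)
      case 0 show ?case using fg by (simp add: mpow_diff)
    next
      case (Suc k)
      have "F (f - g) = 0" using fg alg_endo_simps(5)[OF E] by simp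
      with shift[OF Suc] mpow_uminus show ?case by fastforce
    qed
    then have "f - g = 0" by (rule mpow_eq_zero)
    then show "f = g" by simp
  qed
  moreover have "\<exists>f\<in>ser V. F f = g" if g: "g \<in> ser V" for g
  proof -
    let ?T = "\<lambda>f (i::unit). g + (f i - F (f i))"
    have "\<exists>f. (\<forall>i m. \<not> set_mset m \<subseteq> V \<longrightarrow> cf (f i) m = 0) \<and> ?T f = f"
    proof (rule contraction_fixpoint)
      fix f :: "unit \<Rightarrow> 'a mps" assume "\<forall>i m. \<not> set_mset m \<subseteq> V \<longrightarrow> cf (f i) m = 0"
      then have "f i \<in> ser V" for i by (auto simp: mpow_def)
      then have "?T f i \<in> ser V" for i
        using g alg_endoD(1)[OF E] by (intro mpow_add mpow_diff) auto
      then show "\<forall>i m. \<not> set_mset m \<subseteq> V \<longrightarrow> cf (?T f i) m = 0" by (auto simp: mpow_def)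
    next
      fix f h :: "unit \<Rightarrow> 'a mps" and k i and m :: monom
      assume fh: "\<forall>i m. \<not> set_mset m \<subseteq> V \<longrightarrow> cf (f i) m = 0" "\<forall>i m. \<not> set_mset m \<subseteq> V \<longrightarrow> cf (h i) m = 0"
        and "\<And>i m. size m < k \<Longrightarrow> cf (f i) m = cf (h i) m" and m: "size m < Suc k"
      then have "f i - h i \<in> mpow V k"
        by (intro mpow_diffI) (auto simp: ser_iff)
      note shift[OF this]
      moreover have "F (f i - h i) = F (f i) - F (h i)"
        using fh by (intro alg_endo_simps(5)[OF E]) (simp_all add: ser_iff)
      ultimately have "(F (f i) - F (h i)) - (f i - h i) \<in> mpow V (Suc k)" by simp
      from mpowD[OF this m] show "cf (?T f i) m = cf (?T h i) m"
        by (simp add: algebra_simps)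
    qed
    then obtain f where f: "\<And>i m. \<not> set_mset m \<subseteq> V \<Longrightarrow> cf (f i) m = 0"
        "\<And>i::unit. g + (f i - F (f i)) = f i"
      by metis
    have "f () \<in> ser V" using f(1) by (auto simp: mpow_def)
    moreover have "F (f ()) = g" using f(2)[of "()"] by (simp add: algebra_simps)
    ultimately show ?thesis by blast
  qed
  ultimately have "bij_betw F (ser V) (ser V)"
    using alg_endoD(1)[OF E] unfolding bij_betw_def by blast
  with E show ?thesis by (simp add: alg_auto_def)
qed

section \<open>Substitution of series without constant term\<close>

definition mon_subst :: "(nat \<Rightarrow> 'a::field mps) \<Rightarrow> monom \<Rightarrow> 'a mps" where
  "mon_subst a m = (\<Prod>i\<in>#m. a i)"

text \<open>If the substituted series have no constant term, monomials of degree above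
  \<open>size w\<close> do not reach the coefficient of \<open>w\<close>. The cut-off keeps the sum
  finite, and any larger one gives the same value.\<close>

definition subst_series :: "nat set \<Rightarrow> (nat \<Rightarrow> 'a::field mps) \<Rightarrow> 'a mps \<Rightarrow> 'a mps" where
  "subst_series V a f = Mps (\<lambda>w. \<Sum>m\<in>mons V (size w). cf f m * cf (mon_subst a m) w)"

lemma mon_subst_add: "mon_subst a (m + m') = mon_subst a m * mon_subst a m'"
  by (simp add: mon_subst_def)

lemma mon_subst_mpow:
  assumes "\<And>i. i \<in> V \<Longrightarrow> a i \<in> mpow W (Suc 0)" "set_mset m \<subseteq> V"
  shows "mon_subst a m \<in> mpow W (size m)"
  using assms(2)
proof (induction m)
  case (add i m)
  then have "a i * mon_subst a m \<in> mpow W (Suc 0 + size m)"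
    by (intro mpow_mult assms) auto
  then show ?case by (simp add: mon_subst_def)
qed (simp add: mon_subst_def)

lemma subst_series_coeff:
  assumes "finite V" "\<And>i. i \<in> V \<Longrightarrow> a i \<in> mpow W (Suc 0)" "size w \<le> N"
  shows "cf (subst_series V a f) w = (\<Sum>m\<in>mons V N. cf f m * cf (mon_subst a m) w)"
proof -
  have "(\<Sum>m\<in>mons V N. cf f m * cf (mon_subst a m) w)
      = (\<Sum>m\<in>mons V (size w). cf f m * cf (mon_subst a m) w)"
  proof (rule sum.mono_neutral_right)
    show "\<forall>m\<in>mons V N - mons V (size w). cf f m * cf (mon_subst a m) w = 0"
      using mpowD[OF mon_subst_mpow[of V a W, OF assms(2)]] by (auto simp: mons_iff)
  qed (use assms in \<open>auto simp: mons_iff\<close>)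
  then show ?thesis by (simp add: subst_series_def)
qed

lemma subst_series_mult:
  fixes f g :: "'a::field mps"
  assumes "finite V" "\<And>i. i \<in> V \<Longrightarrow> a i \<in> mpow W (Suc 0)"
  shows "subst_series V a (f * g) = subst_series V a f * subst_series V a g"
proof (rule mps_eqI)
  fix w :: monom
  let ?N = "size w" and ?a = "mon_subst a"
  note coeff = subst_series_coeff[of V a W, OF assms(1,2)]
  have "cf (subst_series V a (f * g)) w
      = (\<Sum>m\<in>mons V ?N. \<Sum>p\<in>splits m. cf f (fst p) * cf g (snd p) * cf (?a m) w)"
    by (simp add: coeff[of w ?N] cf_mult sum_distrib_right case_prod_unfold)
  also have "\<dots> = (\<Sum>(m, p)\<in>Sigma (mons V ?N) splits. cf f (fst p) * cf g (snd p) * cf (?a m) w)"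
    using assms(1) by (intro sum.Sigma) auto
  also have "\<dots> = (\<Sum>(c, d)\<in>{(c, d). c + d \<in> mons V ?N}. cf f c * cf g d * cf (?a (c + d)) w)"
    by (rule sum.reindex_bij_witness[of _ "\<lambda>(c, d). (c + d, (c, d))" snd]) auto
  \<comment> \<open>Pairs of total degree above \<open>size w\<close> contribute zero, so the index
    set may be enlarged to a rectangle, on which the double sum factors.\<close>
  also have "\<dots> = (\<Sum>(c, d)\<in>mons V ?N \<times> mons V ?N. cf f c * cf g d * cf (?a (c + d)) w)"
  proof (rule sum.mono_neutral_left)
    show "{(c, d). c + d \<in> mons V ?N} \<subseteq> mons V ?N \<times> mons V ?N" by (auto simp: mons_iff)
    show "\<forall>p\<in>mons V ?N \<times> mons V ?N - {(c, d). c + d \<in> mons V ?N}.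
        (case p of (c, d) \<Rightarrow> cf f c * cf g d * cf (?a (c + d)) w) = 0"
    proof
      fix p assume p: "p \<in> mons V ?N \<times> mons V ?N - {(c, d). c + d \<in> mons V ?N}"
      obtain c d where cd: "p = (c, d)" by (cases p)
      have "set_mset (c + d) \<subseteq> V" "size w < size (c + d)" using p cd by (auto simp: mons_iff)
      then have "cf (?a (c + d)) w = 0"
        using mpowD[OF mon_subst_mpow[of V a W, OF assms(2)]] by blast
      then show "(case p of (c, d) \<Rightarrow> cf f c * cf g d * cf (?a (c + d)) w) = 0" by (simp add: cd)
    qed
  qed (use assms in auto)
  also have "\<dots> = (\<Sum>c\<in>mons V ?N. \<Sum>d\<in>mons V ?N. \<Sum>p\<in>splits w.
      cf f c * cf (?a c) (fst p) * (cf g d * cf (?a d) (snd p)))"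
    unfolding sum.cartesian_product[symmetric]
    by (simp add: mon_subst_add cf_mult sum_distrib_left case_prod_unfold algebra_simps)
  also have "\<dots> = (\<Sum>c\<in>mons V ?N. \<Sum>p\<in>splits w. \<Sum>d\<in>mons V ?N.
      cf f c * cf (?a c) (fst p) * (cf g d * cf (?a d) (snd p)))"
    by (intro sum.cong sum.swap refl)
  also have "\<dots> = (\<Sum>p\<in>splits w. \<Sum>c\<in>mons V ?N. \<Sum>d\<in>mons V ?N.
      cf f c * cf (?a c) (fst p) * (cf g d * cf (?a d) (snd p)))"
    by (rule sum.swap)
  also have "\<dots> = (\<Sum>p\<in>splits w. cf (subst_series V a f) (fst p) * cf (subst_series V a g) (snd p))"
  proof (rule sum.cong[OF refl])
    fix p assume "p \<in> splits w"
    then have "size (fst p) \<le> ?N" "size (snd p) \<le> ?N" by (auto simp: splits_def)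
    then show "(\<Sum>c\<in>mons V ?N. \<Sum>d\<in>mons V ?N. cf f c * cf (?a c) (fst p) * (cf g d * cf (?a d) (snd p)))
        = cf (subst_series V a f) (fst p) * cf (subst_series V a g) (snd p)"
      by (simp add: coeff[of _ ?N] sum_product)
  qed
  finally show "cf (subst_series V a (f * g)) w = cf (subst_series V a f * subst_series V a g) w"
    by (simp add: cf_mult case_prod_unfold)
qed

lemma subst_series_add: "subst_series V a (f + g) = subst_series V a f + subst_series V a g"
  by (rule mps_eqI) (simp add: subst_series_def distrib_right sum.distrib)

lemma subst_series_Con:
  assumes "finite V"
  shows "subst_series V a (Con c) = Con c"
proof (rule mps_eqI)
  fix w
  have "cf (subst_series V a (Con c)) w = (\<Sum>m\<in>{{#}}. cf (Con c) m * cf (mon_subst a m) w)"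
    unfolding subst_series_def mps.sel using assms
    by (intro sum.mono_neutral_right) (auto simp: cf_Con mons_iff)
  then show "cf (subst_series V a (Con c)) w = cf (Con c) w"
    by (simp add: cf_Con mon_subst_def cf_one)
qed

lemma subst_series_sum: "subst_series V a (sum f A) = (\<Sum>i\<in>A. subst_series V a (f i))"
proof (induction A rule: infinite_finite_induct)
  case empty
  show ?case by (rule mps_eqI) (simp add: subst_series_def)
next
  case (infinite A)
  then show ?case by (intro mps_eqI) (simp add: subst_series_def)
qed (simp add: subst_series_add)

lemma subst_series_X:
  assumes "finite V" "\<And>i. i \<in> V \<Longrightarrow> a i \<in> mpow W (Suc 0)" "i \<in> V"
  shows "subst_series V a (X i) = a i"
proof (rule mps_eqI)
  fix w
  have "cf (subst_series V a (X i)) w = (\<Sum>m\<in>mons V (Suc (size w)). cf (X i) m * cf (mon_subst a m) w)"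
    by (rule subst_series_coeff[of V a W, OF assms(1,2)]) auto
  also have "\<dots> = (\<Sum>m\<in>{{#i#}}. cf (X i) m * cf (mon_subst a m) w)"
    using assms by (intro sum.mono_neutral_right) (auto simp: cf_X mons_iff)
  finally show "cf (subst_series V a (X i)) w = cf (a i) w"
    by (simp add: cf_X mon_subst_def)
qed

lemma subst_series_ser:
  assumes "\<And>i. i \<in> V \<Longrightarrow> a i \<in> mpow W (Suc 0)"
  shows "subst_series V a f \<in> ser W"
proof (rule mpowI)
  fix w assume "cf (subst_series V a f) w \<noteq> 0"
  then obtain m where "m \<in> mons V (size w)" "cf f m * cf (mon_subst a m) w \<noteq> 0"
    unfolding subst_series_def mps.sel by (rule sum.not_neutral_contains_not_neutral)
  with mon_subst_mpow[of V a W, OF assms] show "set_mset w \<subseteq> W \<and> 0 \<le> size w"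
    by (auto simp: mons_iff mpow_def)
qed

lemma local_endo_subst:
  assumes "finite V" "\<And>i. i \<in> V \<Longrightarrow> a i \<in> mpow V (Suc 0)"
  shows "local_endo V (subst_series V a)"
  unfolding local_endo_def alg_endo_def
  using subst_series_ser[of V a V, OF assms(2)] subst_series_X[of V a V, OF assms] assms
  by (auto simp: subst_series_Con subst_series_add subst_series_mult[of V a V])

section \<open>Right equivalence and normal forms\<close>

definition req :: "nat set \<Rightarrow> 'a::field mps \<Rightarrow> 'a mps \<Rightarrow> bool" where
  "req V f g \<longleftrightarrow> f \<in> ser V \<and> (\<exists>F. alg_auto V F \<and> g = F f)"

lemma req_ser: "req V f g \<Longrightarrow> f \<in> ser V" "req V f g \<Longrightarrow> g \<in> ser V"
  by (auto simp: req_def alg_auto_def dest: alg_endoD(1))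

lemma req_refl: "f \<in> ser V \<Longrightarrow> req V f f"
  using alg_auto_id by (force simp: req_def)

lemma req_sym: "req V f g \<Longrightarrow> req V g f"
proof -
  assume *: "req V f g"
  then obtain F where F: "f \<in> ser V" "alg_auto V F" "g = F f" by (auto simp: req_def)
  from alg_auto_inv[OF F(2)] obtain G where "alg_auto V G" "\<And>f. f \<in> ser V \<Longrightarrow> G (F f) = f"
    by metis
  with F req_ser(2)[OF *] show ?thesis by (auto simp: req_def)
qed

lemma req_trans: "req V f g \<Longrightarrow> req V g h \<Longrightarrow> req V f h"
  unfolding req_def using alg_auto_comp by (metis comp_apply)

lemma reqI: "alg_auto V F \<Longrightarrow> f \<in> ser V \<Longrightarrow> F f = g \<Longrightarrow> req V f g"
  by (auto simp: req_def)

lemma X_ser: "i \<in> V \<Longrightarrow> X i \<in> ser V"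
  using mpow_X mpow_ser by blast

section \<open>Changes of a single variable and permutations of variables\<close>

definition change_var :: "nat set \<Rightarrow> nat \<Rightarrow> 'a::field mps \<Rightarrow> 'a mps \<Rightarrow> 'a mps" where
  "change_var V y A = subst_series V (X(y := A))"

lemma change_var_local:
  assumes "finite V" "A \<in> mpow V (Suc 0)"
  shows "local_endo V (change_var V y A)"
  unfolding change_var_def using assms by (intro local_endo_subst) (auto intro: mpow_X)

lemma change_var_X:
  assumes "finite V" "A \<in> mpow V (Suc 0)" "i \<in> V"
  shows "change_var V y A (X i) = (if i = y then A else X i)"
  unfolding change_var_def using assms
  by (subst subst_series_X[of V _ V]) (auto intro: mpow_X)

lemma change_var_hom:
  assumes "finite V" "A \<in> mpow V (Suc 0)"
  shows "change_var V y A (f + g) = change_var V y A f + change_var V y A g"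
    "change_var V y A (f * g) = change_var V y A f * change_var V y A g"
    "change_var V y A (Con c) = Con c"
proof -
  have "\<And>i. i \<in> V \<Longrightarrow> (X(y := A)) i \<in> mpow V (Suc 0)"
    using assms(2) by (auto intro: mpow_X)
  then show "change_var V y A (f * g) = change_var V y A f * change_var V y A g"
    unfolding change_var_def by (intro subst_series_mult[of V _ V] assms(1))
qed (simp_all add: change_var_def subst_series_add subst_series_Con assms(1))

text \<open>Setting \<open>X y\<close> to zero fixes such an \<open>f\<close>, and applying the
  change of variable afterwards does not alter the images of the variables; so the composite agrees
  with setting \<open>X y\<close> to zero on all series.\<close>

lemma change_var_fixes:
  fixes f :: "'a::field mps"
  assumes "finite V" "A \<in> mpow V (Suc 0)" "f \<in> ser (V - {y})"
  shows "change_var V y A f = f"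
proof -
  note L = change_var_local[OF assms(1,2), of y]
  let ?r = "subst_series V (X(y := 0)) :: 'a mps \<Rightarrow> 'a mps"
  have r: "local_endo V ?r"
    using assms by (intro local_endo_subst) (auto intro: mpow_X)
  have rf: "?r f = f" if f: "f \<in> ser (V - {y})" for f
  proof -
    have eq: "mon_subst (X(y := 0)) m = mon_subst (X :: nat \<Rightarrow> 'a mps) m" if "set_mset m \<subseteq> V - {y}" for m
      using that unfolding mon_subst_def by (intro arg_cong[where f = prod_mset] image_mset_cong) auto
    have X1: "\<And>i. i \<in> V \<Longrightarrow> (X(y := 0)) i \<in> mpow V (Suc 0)" and X2: "\<And>i. i \<in> V \<Longrightarrow> X i \<in> mpow V (Suc 0)"
      by (auto intro: mpow_X)
    have idX: "local_endo V (subst_series V X)"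
      by (rule local_endo_subst[OF assms(1) X2])
    have "subst_series V (X(y := 0)) f = subst_series V X f"
    proof (rule mps_eqI)
      fix w
      show "cf (subst_series V (X(y := 0)) f) w = cf (subst_series V X f) w"
        unfolding subst_series_def mps.sel
      proof (rule sum.cong[OF refl])
        fix m
        show "cf f m * cf (mon_subst (X(y := 0)) m) w = cf f m * cf (mon_subst X m) w"
          using f eq[of m] by (cases "set_mset m \<subseteq> V - {y}") (auto simp: ser_iff)
      qed
    qed
    also have "\<dots> = id f"
    proof (rule local_endo_eqI[OF assms(1) idX local_endo_id])
      show "subst_series V X (X i) = id (X i)" if "i \<in> V" for i
        using subst_series_X[OF assms(1) X2 that] by simp
      show "f \<in> ser V" using f by (rule mpow_mono) auto
    qed
    finally show ?thesis by simp
  qed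
  have fV: "f \<in> ser V" using assms(3) by (rule mpow_mono) auto
  have "change_var V y A f = (change_var V y A \<circ> ?r) f"
    by (simp add: rf[OF assms(3)])
  also have "\<dots> = ?r f"
  proof (rule local_endo_eqI[OF assms(1) local_endo_comp[OF assms(1) L r] r _ fV])
    fix i assume i: "i \<in> V"
    have "?r (X i) = (X(y := 0)) i"
      using i assms(1) by (intro subst_series_X[of V _ V]) (auto intro: mpow_X)
    then show "(change_var V y A \<circ> ?r) (X i) = ?r (X i)"
      using change_var_X[OF assms(1,2) i, of y] alg_endo_simps(1)[OF local_endo_alg[OF L]]
      by (cases "i = y") simp_all
  qed
  finally show ?thesis by (simp add: rf[OF assms(3)])
qed

text \<open>As \<open>L\<close> does not involve \<open>X y\<close>, the substitution is affine in
  \<open>X y\<close> and is inverted by solving for it.\<close>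

lemma change_var_inverse:
  fixes L :: "'a::field mps"
  assumes V: "finite V" "y \<in> V" and c: "c \<noteq> 0" and L: "L \<in> mpow (V - {y}) (Suc 0)"
  shows "alg_auto V (change_var V y (Con c * X y + L))"
    and "f \<in> ser V \<Longrightarrow>
      change_var V y (Con c * X y + L) (change_var V y (Con (1 / c) * (X y - L)) f) = f"
proof -
  let ?A = "Con c * X y + L" and ?B = "Con (1 / c) * (X y - L)"
  have LV: "L \<in> mpow V (Suc 0)" "L \<in> ser (V - {y})"
    using mpow_mono[OF L, of "Suc 0" V] mpow_ser[OF L] by auto
  have A: "?A \<in> mpow V (Suc 0)" and B: "?B \<in> mpow V (Suc 0)"
    using V LV by (auto intro!: mpow_add mpow_Con_mult mpow_diff mpow_X)
  have inv: "Con c * Con (1 / c) = 1" "Con (1 / c) * Con c = 1"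
    using c by (simp_all add: Con_simps[symmetric])
  note lA = change_var_local[OF V(1) A, of y] and lB = change_var_local[OF V(1) B, of y]
  note eA = local_endo_alg[OF lA] and eB = local_endo_alg[OF lB]
  have Xy: "X y \<in> ser V" and Ls: "L \<in> ser V"
    using X_ser[OF V(2)] mpow_ser[OF LV(1)] by auto
  have 1: "change_var V y ?A ?B = X y"
  proof -
    have "change_var V y ?A ?B = Con (1 / c) * (change_var V y ?A (X y) - change_var V y ?A L)"
      using alg_endo_simps(3)[OF eA mpow_diff[OF Xy Ls]] alg_endo_simps(5)[OF eA Xy Ls] by simp
    also have "\<dots> = Con (1 / c) * (?A - L)"
      using change_var_X[OF V(1) A V(2), of y] change_var_fixes[OF V(1) A LV(2)] by simp
    also have "\<dots> = X y"
      using inv(2) by (simp flip: mult.assoc)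
    finally show ?thesis .
  qed
  have 2: "change_var V y ?B ?A = X y"
  proof -
    have "change_var V y ?B ?A = Con c * change_var V y ?B (X y) + change_var V y ?B L"
      using alg_endoD(3)[OF eB mpow_Con_mult[OF Xy] Ls] alg_endo_simps(3)[OF eB Xy] by simp
    also have "\<dots> = Con c * ?B + L"
      using change_var_X[OF V(1) B V(2), of y] change_var_fixes[OF V(1) B LV(2)] by simp
    also have "\<dots> = X y"
      using inv(1) by (simp flip: mult.assoc)
    finally show ?thesis .
  qed
  have AB: "change_var V y ?A (change_var V y ?B (X i)) = X i" if i: "i \<in> V" for i
    using 1 change_var_X[OF V(1) A i, of y] change_var_X[OF V(1) B i, of y] by (cases "i = y") simp_all
  have BA: "change_var V y ?B (change_var V y ?A (X i)) = X i" if i: "i \<in> V" for i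
    using 2 change_var_X[OF V(1) A i, of y] change_var_X[OF V(1) B i, of y] by (cases "i = y") simp_all
  show "alg_auto V (change_var V y ?A)"
    by (rule alg_autoI[OF V(1) lA lB AB BA])
  show "change_var V y ?A (change_var V y ?B f) = f" if "f \<in> ser V"
    using local_endo_eqI[OF V(1) local_endo_comp[OF V(1) lA lB] local_endo_id _ that] AB by simp
qed

lemma change_var_homog_auto:
  assumes V: "finite V" "y \<in> V" and A: "A \<in> homog V (Suc 0)" "cf A {#y#} \<noteq> 0"
  shows "alg_auto V (change_var V y A)"
proof -
  obtain R where "R \<in> homog (V - {y}) (Suc 0)" "A = Con (cf A {#y#}) * X y + R"
    using homog_1_split[OF A(1)] by blast
  then show ?thesis using change_var_inverse(1)[OF V A(2) homogD] by metis
qed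

definition perm_vars :: "nat set \<Rightarrow> (nat \<Rightarrow> nat) \<Rightarrow> 'a::field mps \<Rightarrow> 'a mps" where
  "perm_vars V p = subst_series V (\<lambda>i. X (p i))"

lemma perm_vars_X:
  assumes "finite V" "p ` V \<subseteq> V" "i \<in> V"
  shows "perm_vars V p (X i) = X (p i)"
  unfolding perm_vars_def using assms by (intro subst_series_X[of V _ V]) (auto intro: mpow_X)

lemma perm_vars_auto:
  assumes "finite V" "bij_betw p V V"
  shows "alg_auto V (perm_vars V p)"
proof -
  let ?q = "the_inv_into V p"
  have q: "bij_betw ?q V V" by (rule bij_betw_the_inv_into[OF assms(2)])
  have p: "p ` V \<subseteq> V" and q': "?q ` V \<subseteq> V" and inj: "inj_on p V"
    using assms(2) q by (auto simp: bij_betw_def)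
  have pq: "p (?q i) = i" "?q (p i) = i" if "i \<in> V" for i
    using that inj assms(2) by (auto simp: f_the_inv_into_f the_inv_into_f_f bij_betw_def)
  have "local_endo V (perm_vars V p)" "local_endo V (perm_vars V ?q)"
    unfolding perm_vars_def using p q' assms(1) by (auto intro!: local_endo_subst mpow_X)
  then show ?thesis
    using p q' pq by (intro alg_autoI[OF assms(1), of _ "perm_vars V ?q"])
      (auto simp: perm_vars_X[OF assms(1)] image_subset_iff)
qed

lemma mon_subst_homog:
  assumes "\<And>i. i \<in> V \<Longrightarrow> a i \<in> homog W (Suc 0)" "set_mset m \<subseteq> V"
  shows "mon_subst a m \<in> homog W (size m)"
  using assms(2)
proof (induction m)
  case empty
  then show ?case using homog_Con[of 1 W] by (simp add: mon_subst_def Con_simps)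
next
  case (add i m)
  then have "a i * mon_subst a m \<in> homog W (Suc 0 + size m)"
    by (intro homog_mult assms) auto
  then show ?case by (simp add: mon_subst_def)
qed

lemma subst_series_homog:
  assumes "\<And>i. i \<in> V' \<Longrightarrow> a i \<in> homog W (Suc 0)" "f \<in> homog V' k"
  shows "subst_series V a f \<in> homog W k"
proof -
  { fix w assume "cf (subst_series V a f) w \<noteq> 0"
    then obtain m where m: "cf f m * cf (mon_subst a m) w \<noteq> 0"
      unfolding subst_series_def mps.sel by (rule sum.not_neutral_contains_not_neutral)
    then have *: "set_mset m \<subseteq> V'" "size m = k" using assms(2) unfolding homog_def by auto
    then have "mon_subst a m \<in> homog W k" using mon_subst_homog[of V' a W m, OF assms(1)] by simp
    with m have "set_mset w \<subseteq> W \<and> size w = k" unfolding homog_def by auto }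
  then show ?thesis unfolding homog_def by blast
qed

section \<open>Quadratic forms in characteristic two\<close>

declare One_nat_def [simp del]

definition hyp :: "nat \<Rightarrow> 'a::field mps" where
  "hyp m = (\<Sum>i\<in>{1..m}. X (2 * i - 1) * X (2 * i))"

lemma hyp_Suc: "hyp (Suc m) = hyp m + X (2 * m + 1) * X (2 * m + 2)"
  by (simp add: hyp_def One_nat_def)

lemma hyp_homog: "2 * m \<le> n \<Longrightarrow> hyp m \<in> homog {1..n} 2"
proof -
  assume "2 * m \<le> n"
  then have "X (2 * i - 1) * X (2 * i) \<in> homog {1..n} (Suc 0 + Suc 0)" if "i \<in> {1..m}" for i
    using that by (intro homog_mult homog_X[simplified]) auto
  then show ?thesis unfolding hyp_def by (intro homog_sum) (simp add: numeral_2_eq_2)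
qed

lemma hyp_ser: "2 * m \<le> n \<Longrightarrow> hyp m \<in> ser {1..n}"
  using hyp_homog homogD mpow_ser by blast

text \<open>Representatives, for \<open>r \<le> n + 1\<close>, of the orbits of the group of 2-jets on the 2-jets of series without constant term.\<close>

definition nform :: "nat \<Rightarrow> nat \<Rightarrow> 'a::field mps" where
  "nform n r = (if r \<le> n then hyp (r div 2) + (if odd r then X r * X r else 0) else X 1)"

lemma alg_auto_add_fix:
  assumes "alg_auto V F" "h \<in> ser V" "q \<in> ser V" "F h = h"
  shows "req V (h + q) (h + F q)"
  using assms by (intro reqI[of V F]) (auto intro: mpow_add simp: alg_endoD(3)[OF alg_auto_endo])

text \<open>Splits off a hyperbolic plane in three substitutions: a root of the binary form in
  \<open>X x\<close> and \<open>X y\<close> removes the square of \<open>X x\<close>; the cofactor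
  of \<open>X x\<close> becomes the variable \<open>X y\<close>; what is still divisible by
  \<open>X y\<close> is absorbed into \<open>X x\<close>. The part \<open>h\<close> split off
  earlier lives in other variables and stays fixed.\<close>

lemma split_pair:
  fixes q h :: "'a::alg_closed_field mps"
  assumes char: "CHAR('a) = 2" and V: "finite V" "W \<subseteq> V" and xy: "x \<in> W" "y \<in> W" "x \<noteq> y"
    and q: "q \<in> homog W 2" "cf q {#x, y#} \<noteq> 0" and h: "h \<in> ser (V - {x, y})"
  shows "\<exists>R\<in>homog (W - {x, y}) 2. req V (h + q) (h + (X x * X y + R))"
proof -
  have q2: "q \<in> homog W (Suc (Suc 0))" using q(1) by (simp add: numeral_2_eq_2)
  obtain A R where AR: "A \<in> homog W (Suc 0)" "R \<in> homog (W - {x}) (Suc (Suc 0))" "q = X x * A + R"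
      and cfA: "\<And>m. cf A m = cf q (add_mset x m)"
    using homog_split[OF q2, of x] by metis
  define \<alpha> where "\<alpha> = cf A {#x#}"
  obtain A1 where A1: "A1 \<in> homog (W - {x}) (Suc 0)" "A = Con \<alpha> * X x + A1"
    using homog_1_split[OF AR(1), of x] \<alpha>_def by metis
  define b where "b = cf A1 {#y#}"
  have b: "b \<noteq> 0"
    using q(2) xy cfA[of "{#y#}"] by (simp add: b_def A1(2) cf_X)
  obtain L1 where L1: "L1 \<in> homog (W - {x} - {y}) (Suc 0)" "A1 = Con b * X y + L1"
    using homog_1_split[OF A1(1), of y] b_def by metis
  obtain C R' where CR: "C \<in> homog (W - {x}) (Suc 0)" "R' \<in> homog (W - {x} - {y}) (Suc (Suc 0))"
      "R = X y * C + R'"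
    using homog_split[OF AR(2), of y] by metis
  define \<beta> where "\<beta> = cf C {#y#}"
  obtain L2 where L2: "L2 \<in> homog (W - {x} - {y}) (Suc 0)" "C = Con \<beta> * X y + L2"
    using homog_1_split[OF CR(1), of y] \<beta>_def by metis
  \<comment> \<open>Adding \<open>\<rho>\<close> times \<open>X x\<close> to \<open>X y\<close>
    gives \<open>X x * X x\<close> the coefficient
    \<open>\<alpha> + b * \<rho> + \<beta> * \<rho>^2\<close>.\<close>
  have "degree [:\<alpha>, b, \<beta>:] > 0" using b by (simp add: degree_pCons_eq_if)
  then obtain \<rho> where \<rho>: "poly [:\<alpha>, b, \<beta>:] \<rho> = 0"
    using alg_closed_imp_poly_has_root by blast
  then have "\<alpha> = - (\<rho> * (b + \<rho> * \<beta>))" by (simp add: eq_neg_iff_add_eq_0)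
  then have C\<alpha>: "Con \<alpha> = - (Con \<rho> * (Con b + Con \<rho> * Con \<beta>))"
    by (simp only: Con_simps)
  have V': "x \<in> V" "y \<in> V" using V xy by auto
  have sub: "homog (W - {x} - {y}) k \<subseteq> homog (V - {y}) k" "homog (W - {x} - {y}) k \<subseteq> homog (V - {x}) k"
    "homog (W - {x}) k \<subseteq> homog (V - {x}) k" "homog (W - {x} - {y}) k \<subseteq> homog (W - {x}) k"
    "homog W k \<subseteq> homog V k" "homog (W - {x}) k \<subseteq> homog V k" for k
    using V(2) by - (rule subsetI, erule homog_mono, blast)+
  have serD: "f \<in> homog U k \<Longrightarrow> f \<in> ser U" for f :: "'a mps" and U k
    using homogD mpow_ser by blast
  have hV: "h \<in> ser V" "h \<in> ser (V - {x})" "h \<in> ser (V - {y})"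
    using h by (auto intro: mpow_mono)
  have Xs: "X x \<in> ser V" "X y \<in> ser V" "X x \<in> ser (V - {y})" "X y \<in> ser (V - {x})"
    using V' xy(3) by (auto intro: X_ser)

  let ?Y = "Con 1 * X y + Con \<rho> * X x" and ?T = "change_var V y (Con 1 * X y + Con \<rho> * X x)"
  have Y0: "Con \<rho> * X x \<in> mpow (V - {y}) (Suc 0)"
    using V' xy(3) by (intro mpow_Con_mult) (auto intro!: mpow_X)
  have T: "alg_auto V ?T"
    by (rule change_var_inverse(1)[OF V(1) V'(2) _ Y0]) simp
  have Y: "?Y \<in> mpow V (Suc 0)"
    using V' by (auto intro!: mpow_add mpow_Con_mult mpow_X)
  define L where "L = L1 + Con \<rho> * L2"
  have L: "L \<in> homog (W - {x} - {y}) (Suc 0)"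
    using L1 L2 by (auto simp: L_def intro!: homog_add homog_Con_mult)
  define A2 where "A2 = Con b * X y + L"
  have T_fix: "?T f = f" if "f \<in> ser (V - {y})" for f
    by (rule change_var_fixes[OF V(1) Y that])
  have Tx: "?T (X x) = X x" and Ty: "?T (X y) = ?Y"
    using change_var_X[OF V(1) Y] V' xy(3) by auto
  have TL: "?T L1 = L1" "?T L2 = L2" "?T R' = R'" "?T h = h"
    using sub(1) L1 L2 CR hV by (auto intro!: T_fix intro: serD)
  have "?T q = X x * (Con \<alpha> * X x + (Con b * ?Y + L1)) + (?Y * (Con \<beta> * ?Y + L2) + R')"
    unfolding AR(3) A1(2) CR(3) unfolding L1(2) L2(2)
    by (simp only: change_var_hom[OF V(1) Y] Tx Ty TL)
  \<comment> \<open>The choice of \<open>\<rho>\<close> has cancelled \<open>X x * X x\<close>. The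
    mixed term in \<open>X x\<close> and \<open>X y\<close> gains \<open>\<beta> * \<rho>\<close>
    twice, which is zero, so that \<open>b\<close> survives.\<close>
  also have "\<dots> = X x * A2 + (X y * C + R') + (Con \<beta> * Con \<rho> * X x * X y + Con \<beta> * Con \<rho> * X x * X y)"
    by (simp add: C\<alpha> A2_def L_def L2(2) Con_simps(5) algebra_simps)
  finally have "?T q = X x * A2 + (X y * C + R') + (Con \<beta> * Con \<rho> * X x * X y + Con \<beta> * Con \<rho> * X x * X y)" .
  then have Tq: "?T q = X x * A2 + (X y * C + R')"
    by (simp only: char2_mps_add_self[OF char] add_0_right)
  have 1: "req V (h + q) (h + (X x * A2 + (X y * C + R')))"
    using alg_auto_add_fix[OF T hV(1) _ TL(4), of q] Tq serD[OF subsetD[OF sub(5) q(1)]] by simp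

  \<comment> \<open>\<open>?F\<close> sends \<open>X y\<close> to the cofactor \<open>A2\<close> of
    \<open>X x\<close>; the remaining terms are pulled back by its inverse to \<open>R1\<close>,
    which still does not involve \<open>X x\<close>.\<close>
  let ?F = "change_var V y A2" and ?G = "change_var V y (Con (1 / b) * (X y - L))"
  have LV: "L \<in> mpow (V - {y}) (Suc 0)"
    using L sub(1) homogD by blast
  have A2: "A2 \<in> mpow V (Suc 0)"
    using V' LV unfolding A2_def by (intro mpow_add mpow_Con_mult) (auto intro: mpow_X mpow_mono)
  have F: "alg_auto V ?F" and FG: "f \<in> ser V \<Longrightarrow> ?F (?G f) = f" for f
    using change_var_inverse[OF V(1) V'(2) b LV] by (simp_all add: A2_def)
  define R1 where "R1 = ?G (X y * C + R')"
  have XC: "X y * C + R' \<in> homog (W - {x}) 2"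
  proof (rule homog_add)
    have "X y * C \<in> homog (W - {x}) (Suc 0 + Suc 0)"
      using xy CR(1) by (intro homog_mult) (auto intro!: homog_X)
    then show "X y * C \<in> homog (W - {x}) 2" by (simp add: numeral_2_eq_2)
    show "R' \<in> homog (W - {x}) 2" using CR(2) sub(4) by (auto simp: numeral_2_eq_2)
  qed
  have R1: "R1 \<in> homog (W - {x}) 2"
    unfolding R1_def change_var_def
  proof (rule subst_series_homog[OF _ XC])
    fix i assume "i \<in> W - {x}"
    then show "(X(y := Con (1 / b) * (X y - L))) i \<in> homog (W - {x}) (Suc 0)"
      using xy L sub(4) by (auto intro!: homog_Con_mult homog_diff homog_X)
  qed
  have FR1: "?F R1 = X y * C + R'"
    unfolding R1_def using XC sub(6) by (intro FG serD) auto
  have Fx: "?F (X x) = X x" and Fy: "?F (X y) = A2"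
    using change_var_X[OF V(1) A2] V' xy(3) by auto
  have "?F (X x * X y + R1) = X x * A2 + (X y * C + R')"
    by (simp add: change_var_hom[OF V(1) A2] Fx Fy FR1)
  moreover have "X x * X y + R1 \<in> ser V"
    using Xs R1 sub(6) by (intro mpow_add mpow_mult_left) (auto intro: serD)
  ultimately have 2: "req V (h + (X x * X y + R1)) (h + (X x * A2 + (X y * C + R')))"
    using alg_auto_add_fix[OF F hV(1), of "X x * X y + R1"] change_var_fixes[OF V(1) A2 hV(3)] by simp

  \<comment> \<open>Only the multiples of \<open>X y\<close> in \<open>R1\<close> are left to
    remove: shifting \<open>X x\<close> by \<open>C2\<close> produces exactly these.\<close>
  have R12: "R1 \<in> homog (W - {x}) (Suc (Suc 0))" using R1 by (simp add: numeral_2_eq_2)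
  obtain C2 R2 where C2: "C2 \<in> homog (W - {x}) (Suc 0)" "R2 \<in> homog (W - {x} - {y}) (Suc (Suc 0))"
      "R1 = X y * C2 + R2"
    using homog_split[OF R12, of y] by metis
  let ?P = "change_var V x (Con 1 * X x + C2)"
  have C2': "C2 \<in> mpow (V - {x}) (Suc 0)"
    using C2(1) sub(3) homogD by blast
  have P: "alg_auto V ?P"
    by (rule change_var_inverse(1)[OF V(1) V'(1) _ C2']) simp
  have XC2: "Con 1 * X x + C2 \<in> mpow V (Suc 0)"
    using V' C2' by (intro mpow_add mpow_Con_mult) (auto intro: mpow_X mpow_mono)
  have Px: "?P (X x) = Con 1 * X x + C2" and Py: "?P (X y) = X y"
    using change_var_X[OF V(1) XC2] V' xy(3) by auto
  have PR: "?P R2 = R2" "?P h = h"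
    using C2(2) sub(2) hV(2) by (auto intro!: change_var_fixes[OF V(1) XC2] intro: serD)
  have "?P (X x * X y + R2) = X x * X y + R1"
    unfolding change_var_hom[OF V(1) XC2] Px Py PR C2(3) by (simp add: Con_simps algebra_simps)
  moreover have "X x * X y + R2 \<in> ser V"
    using Xs serD[OF subsetD[OF sub(6) subsetD[OF sub(4) C2(2)]]] by (intro mpow_add mpow_mult_left)
  ultimately have 3: "req V (h + (X x * X y + R2)) (h + (X x * X y + R1))"
    using alg_auto_add_fix[OF P hV(1) _ PR(2), of "X x * X y + R2"] by simp
  have "W - {x} - {y} = W - {x, y}" by auto
  then have "R2 \<in> homog (W - {x, y}) 2" using C2(2) by (simp add: numeral_2_eq_2)
  with req_trans[OF 1 req_trans[OF req_sym[OF 2] req_sym[OF 3]]] show ?thesis by blast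
qed


lemma sum_square_char2:
  fixes f :: "'i \<Rightarrow> 'a::field mps"
  assumes "CHAR('a) = 2"
  shows "(\<Sum>i\<in>A. f i) * (\<Sum>i\<in>A. f i) = (\<Sum>i\<in>A. f i * f i)"
proof (induction A rule: infinite_finite_induct)
  case (insert x A)
  let ?s = "\<Sum>i\<in>A. f i"
  have "(f x + ?s) * (f x + ?s) = f x * f x + ?s * ?s + (f x * ?s + f x * ?s)"
    by (simp add: algebra_simps)
  then show ?case
    using insert by (simp add: char2_mps_add_self[OF assms])
qed auto

lemma size_2_mset:
  assumes "size m = 2"
  shows "\<exists>i j. m = {#i, j#}"
proof -
  have "size m = Suc (Suc 0)" using assms by simp
  then obtain i m' where "m = {#i#} + m'" "size m' = Suc 0" by (rule size_mset_SucE)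
  then show ?thesis using size_1_singleton_mset[of m'] by auto
qed

text \<open>Square roots of the diagonal coefficients exist, and since squares are additive the sum
  of the squares is the square of one linear form.\<close>

lemma diagonal_form_square:
  fixes q :: "'a::alg_closed_field mps"
  assumes char: "CHAR('a) = 2" and W: "finite W" and q: "q \<in> homog W 2"
    and diag: "\<And>i j. i \<noteq> j \<Longrightarrow> cf q {#i, j#} = 0"
  obtains l where "l \<in> homog W (Suc 0)" "q = l * l"
proof -
  have "\<exists>y. y ^ 2 = cf q {#i, i#}" for i
    by (rule nth_root_exists) simp
  then obtain s where s: "\<And>i. s i ^ 2 = cf q {#i, i#}" by metis
  let ?l = "\<Sum>i\<in>W. Con (s i) * X i"
  have l: "?l \<in> homog W (Suc 0)"
    by (intro homog_sum homog_Con_mult) (auto intro!: homog_X[simplified])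
  have sq: "cf (Con (s i) * X i * (Con (s i) * X i)) m = (if m = {#i, i#} then cf q {#i, i#} else 0)" for i m
  proof -
    have "Con (s i) * X i * (Con (s i) * X i) = Con (cf q {#i, i#}) * (X i * X i)"
      unfolding s[symmetric] by (simp add: power2_eq_square Con_simps algebra_simps)
    moreover have "cf (X i * X i :: 'a mps) m = (if m = {#i, i#} then 1 else 0)"
      by (auto simp: cf_X_mult cf_X dest: multi_member_split)
    ultimately show ?thesis by (simp del: cf_Con_mult add: cf_Con_mult[of "cf q {#i, i#}"])
  qed
  have "?l * ?l = (\<Sum>i\<in>W. Con (s i) * X i * (Con (s i) * X i))"
    by (rule sum_square_char2[OF char])
  also have "\<dots> = q"
  proof (rule mps_eqI)
    fix m
    have "cf (\<Sum>i\<in>W. Con (s i) * X i * (Con (s i) * X i)) m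
        = (\<Sum>i\<in>W. if m = {#i, i#} then cf q {#i, i#} else 0)"
      by (simp only: cf_sum sq)
    also have "\<dots> = cf q m"
    proof (cases "\<exists>k\<in>W. m = {#k, k#}")
      case True
      then obtain k where k: "k \<in> W" "m = {#k, k#}" by blast
      then have "(\<Sum>i\<in>W. if m = {#i, i#} then cf q {#i, i#} else 0) = (\<Sum>i\<in>W. if i = k then cf q m else 0)"
        by (intro sum.cong) (auto simp: add_mset_eq_single add_eq_conv_ex)
      then show ?thesis using k W by simp
    next
      case False
      have "cf q m = 0"
      proof (rule ccontr)
        assume "cf q m \<noteq> 0"
        then have m: "size m = 2" "set_mset m \<subseteq> W" using q unfolding homog_def by blast+
        then obtain i j where "m = {#i, j#}" using size_2_mset by blast
        with False m diag[of i j] \<open>cf q m \<noteq> 0\<close> show False by auto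
      qed
      with False show ?thesis by (auto intro: sum.neutral)
    qed
    finally show "cf (\<Sum>i\<in>W. Con (s i) * X i * (Con (s i) * X i)) m = cf q m" .
  qed
  finally show thesis using that[OF l] by simp
qed

lemma perm_vars_hom:
  assumes "finite V" "p ` V \<subseteq> V"
  shows "perm_vars V p (f + g) = perm_vars V p f + perm_vars V p g"
    "perm_vars V p (f * g) = perm_vars V p f * perm_vars V p g"
    "perm_vars V p (sum h A) = (\<Sum>i\<in>A. perm_vars V p (h i))"
proof -
  have "\<And>i. i \<in> V \<Longrightarrow> X (p i) \<in> mpow V (Suc 0)"
    using assms(2) by (auto intro: mpow_X)
  then show "perm_vars V p (f * g) = perm_vars V p f * perm_vars V p g"
    unfolding perm_vars_def by (intro subst_series_mult[of V _ V] assms(1))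
qed (simp_all add: perm_vars_def subst_series_add subst_series_sum)

lemma perm_vars_hyp:
  assumes "2 * m \<le> n" "p ` {1..n} \<subseteq> {1..n}" "\<And>i. i \<in> {1..2 * m} \<Longrightarrow> p i = i"
  shows "perm_vars {1..n} p (hyp m) = (hyp m :: 'a::field mps)"
proof -
  have "perm_vars {1..n} p (X (2 * i - 1) * X (2 * i)) = (X (2 * i - 1) * X (2 * i) :: 'a mps)"
    if "i \<in> {1..m}" for i
  proof -
    have *: "2 * i - 1 \<in> {1..2 * m}" "2 * i \<in> {1..2 * m}" using that by auto
    have "perm_vars {1..n} p (X k) = (X k :: 'a mps)" if "k \<in> {1..2 * m}" for k
      using that assms by (subst perm_vars_X) auto
    from this[OF *(1)] this[OF *(2)] show ?thesis
      by (simp only: perm_vars_hom[OF finite_atLeastAtMost assms(2)])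
  qed
  then show ?thesis
    unfolding hyp_def perm_vars_hom(3)[OF finite_atLeastAtMost assms(2)] by (rule sum.cong[OF refl])
qed

lemma nform_even: "2 * m \<le> n \<Longrightarrow> nform n (2 * m) = hyp m"
  by (simp add: nform_def)

lemma nform_odd: "2 * m + 1 \<le> n \<Longrightarrow> nform n (2 * m + 1) = hyp m + X (2 * m + 1) * X (2 * m + 1)"
  by (simp add: nform_def)

lemma bij_betw_transpose_on: "a \<in> V \<Longrightarrow> b \<in> V \<Longrightarrow> bij_betw (transpose a b) V V"
  by (auto simp: bij_betw_def inj_on_def transpose_eq_iff image_iff transpose_def split: if_splits)

text \<open>Either a mixed coefficient survives, and a hyperbolic pair is split off and moved to the
  next two positions, or the remaining form is the square of a linear form, which is zero or can
  serve as the next variable.\<close>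

lemma quad_classification:
  fixes q :: "'a::alg_closed_field mps"
  assumes char: "CHAR('a) = 2" and "2 * j \<le> n" and "q \<in> homog {2 * j + 1..n} 2"
  shows "\<exists>r\<le>n. req {1..n} (hyp j + q) (nform n r)"
  using assms(2,3)
proof (induction "n - 2 * j" arbitrary: j q rule: less_induct)
  case less
  let ?V = "{1..n}" and ?W = "{2 * j + 1..n}"
  note j = less.prems(1) and q = less.prems(2)
  have hyp: "hyp j \<in> ser ?V" by (rule hyp_ser[OF j])
  have hypW: "hyp j \<in> ser (?V - A)" if "A \<subseteq> ?W" for A
    using hyp_ser[of j "2 * j"] by (rule mpow_mono) (use that j in auto)
  show ?case
  proof (cases "\<forall>p p'. p \<noteq> p' \<longrightarrow> cf q {#p, p'#} = 0")
    case True
    then obtain l where l: "l \<in> homog ?W (Suc 0)" "q = l * l"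
      using diagonal_form_square[OF char _ q] by (metis finite_atLeastAtMost)
    show ?thesis
    proof (cases "l = 0")
      case True
      then show ?thesis using req_refl[OF hyp] l(2) j by (intro exI[of _ "2 * j"]) (simp add: nform_even)
    next
      case False
      have "\<exists>m. cf l m \<noteq> 0" using False by (metis cf_simps(1) mps_eqI)
      then obtain m where m: "cf l m \<noteq> 0" by blast
      with l(1) have "size m = 1" "set_mset m \<subseteq> ?W" unfolding homog_def by auto
      then obtain p where p: "cf l {#p#} \<noteq> 0" "p \<in> ?W"
        using m by (metis size_1_singleton_mset set_mset_single insert_subset set_mset_add_mset_insert add_mset_eq_single)
      have pV: "p \<in> ?V" using p by auto
      have lV: "l \<in> homog ?V (Suc 0)" using l(1) by (rule homog_mono) auto
      then have lm: "l \<in> mpow ?V (Suc 0)" by (rule homogD)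
      have F: "alg_auto ?V (change_var ?V p l)"
        by (rule change_var_homog_auto[OF _ pV lV p(1)]) simp
      have "change_var ?V p l (hyp j + X p * X p) = hyp j + q"
        using change_var_X[OF _ lm pV, of p] change_var_fixes[OF _ lm hypW[of "{p}"]] p(2)
        by (simp add: change_var_hom[OF finite_atLeastAtMost lm] l(2))
      then have 1: "req ?V (hyp j + X p * X p) (hyp j + q)"
        using hyp X_ser[OF pV] by (intro reqI[OF F]) (auto intro!: mpow_add mpow_mult_left)
      let ?t = "transpose (2 * j + 1) p"
      have t: "bij_betw ?t ?V ?V" using p by (intro bij_betw_transpose_on) auto
      then have t': "?t ` ?V \<subseteq> ?V" by (auto simp: bij_betw_def)
      have "perm_vars ?V ?t (hyp j + X (2 * j + 1) * X (2 * j + 1)) = (hyp j + X p * X p :: 'a mps)"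
      proof -
        have "?t i = i" if "i \<in> {1..2 * j}" for i
          using that p by (auto simp: transpose_def)
        from perm_vars_hyp[OF j t' this, where 'a = 'a] show ?thesis
          using p perm_vars_X[OF _ t', of "2 * j + 1", where 'a = 'a] by (simp add: perm_vars_hom[OF _ t'])
      qed
      then have 2: "req ?V (hyp j + X (2 * j + 1) * X (2 * j + 1)) (hyp j + X p * X p :: 'a mps)"
        using hyp X_ser[of "2 * j + 1" ?V] p
        by (intro reqI[OF perm_vars_auto[OF _ t]]) (auto intro!: mpow_add mpow_mult_left)
      show ?thesis
        using req_sym[OF req_trans[OF 2 1]] p by (intro exI[of _ "2 * j + 1"]) (auto simp: nform_odd[simplified])
    qed
  next
    case False
    then obtain p p' where pp: "p \<noteq> p'" "cf q {#p, p'#} \<noteq> 0" by blast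
    then have W: "p \<in> ?W" "p' \<in> ?W" using q unfolding homog_def by fastforce+
    have "h \<in> ser (?V - {p, p'})" if "h = hyp j" for h :: "'a mps"
      using hypW[of "{p, p'}"] W that by auto
    then obtain R where R: "R \<in> homog (?W - {p, p'}) 2" "req ?V (hyp j + q) (hyp j + (X p * X p' + R))"
      using split_pair[OF char _ _ W pp(1) q pp(2), of ?V "hyp j"] by auto
    \<comment> \<open>\<open>z\<close> is where the first transposition takes \<open>p'\<close>;
      passing through it makes \<open>s\<close> correct also if \<open>p'\<close> is
      \<open>2 * j + 1\<close>.\<close>
    define z where "z = transpose (2 * j + 1) p p'"
    define s where "s = transpose (2 * j + 2) z \<circ> transpose (2 * j + 1) p"
    have j1: "2 * j + 2 \<le> n" using W pp(1) by auto
    have z: "z \<noteq> 2 * j + 1" "z \<in> ?W"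
      using pp(1) W unfolding z_def transpose_def by (auto split: if_splits)
    have sW: "bij_betw s ?W ?W" and sV: "bij_betw s ?V ?V"
      unfolding s_def using W z j1 by (auto intro!: bij_betw_trans bij_betw_transpose_on)
    have sp: "s p = 2 * j + 1" "s p' = 2 * j + 2"
      using z(1) by (simp_all add: s_def z_def[symmetric])
    have sfix: "s i = i" if "i \<in> {1..2 * j}" for i
      using that W z by (auto simp: s_def transpose_def)
    have sV': "s ` ?V \<subseteq> ?V" using sV by (auto simp: bij_betw_def)
    define R' where "R' = perm_vars ?V s R"
    have R': "R' \<in> homog {2 * (j + 1) + 1..n} 2"
      unfolding R'_def perm_vars_def
    proof (rule subst_series_homog[OF _ R(1)])
      fix i assume i: "i \<in> ?W - {p, p'}"
      then have "s i \<in> ?W" "s i \<noteq> s p" "s i \<noteq> s p'"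
        using sW W by (auto simp: bij_betw_def inj_on_def)
      then have "s i \<in> {2 * (j + 1) + 1..n}" using sp by auto
      then show "X (s i) \<in> homog {2 * (j + 1) + 1..n} (Suc 0)" by (rule homog_X[simplified])
    qed
    have pV: "p \<in> ?V" "p' \<in> ?V" using W by auto
    have "perm_vars ?V s (hyp j + (X p * X p' + R)) = hyp (j + 1) + R'"
      using perm_vars_X[OF _ sV' pV(1), where 'a = 'a] perm_vars_X[OF _ sV' pV(2), where 'a = 'a]
        perm_vars_hyp[OF j sV' sfix, where 'a = 'a]
      by (simp add: perm_vars_hom[OF _ sV'] R'_def sp hyp_Suc[unfolded Suc_eq_plus1] add.assoc)
    moreover have "hyp j + (X p * X p' + R) \<in> ser ?V" using R(2) by (rule req_ser)
    ultimately have "req ?V (hyp j + (X p * X p' + R)) (hyp (j + 1) + R')"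
      by (intro reqI[OF perm_vars_auto[OF _ sV]]) auto
    moreover have "\<exists>r\<le>n. req ?V (hyp (j + 1) + R') (nform n r)"
      using j1 by (intro less.hyps R') auto
    ultimately show ?thesis using R(2) req_trans by blast
  qed
qed

section \<open>Series with a linear term, and Morse's lemma\<close>

lemma mpow_linear_part:
  assumes "finite V" "f \<in> mpow V (Suc 0)"
  shows "f - (\<Sum>i\<in>V. Con (cf f {#i#}) * X i) \<in> mpow V 2"
  using local_endo_linear[OF assms(1) local_endo_id assms(2)] by simp

lemma cf_linear_sum:
  assumes "finite V"
  shows "cf (\<Sum>i\<in>V. Con (c i) * X i) {#p#} = (if p \<in> V then c p else 0)"
proof -
  have "cf (\<Sum>i\<in>V. Con (c i) * X i) {#p#} = (\<Sum>i\<in>V. if i = p then c p else 0)"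
    unfolding cf_sum by (rule sum.cong) (auto simp: cf_X)
  then show ?thesis using assms by simp
qed

lemma req_X:
  assumes "finite V" "i \<in> V" "j \<in> V"
  shows "req V (X i) (X j)"
  using assms perm_vars_X[of V "transpose i j" i] bij_betw_transpose_on[of i V j]
  by (intro reqI[OF perm_vars_auto[of V "transpose i j"]]) (auto simp: X_ser bij_betw_def)

text \<open>Inverse function theorem for one function: once the linear part is straightened to
  \<open>X p\<close>, the series differs from \<open>X p\<close> by terms of order two, and putting
  it in place of \<open>X p\<close> is a unipotent substitution.\<close>

lemma submersion_req:
  assumes V: "finite V" "p \<in> V" and f: "f \<in> mpow V (Suc 0)" "cf f {#p#} \<noteq> 0"
  shows "req V f (X p)"
proof -
  define l where "l = (\<Sum>i\<in>V. Con (cf f {#i#}) * X i)"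
  have l: "l \<in> homog V (Suc 0)"
    unfolding l_def by (intro homog_sum homog_Con_mult) (rule homog_X[unfolded One_nat_def])
  have "cf l {#p#} \<noteq> 0" using f V unfolding l_def cf_linear_sum[OF V(1)] by simp
  then have F: "alg_auto V (change_var V p l)"
    by (rule change_var_homog_auto[OF V l])
  obtain G where G: "alg_auto V G" "\<And>f. f \<in> ser V \<Longrightarrow> G (change_var V p l f) = f"
    using alg_auto_inv[OF F] by metis
  have "G l = X p"
    using G(2)[OF X_ser[OF V(2)]] change_var_X[OF V(1) homogD[OF l] V(2), of p] by simp
  moreover have "G (f - l) = G f - G l"
    using mpow_ser[OF f(1)] mpow_ser[OF homogD[OF l]] by (intro alg_endo_simps(5)[OF alg_auto_endo[OF G(1)]])
  moreover have "G (f - l) \<in> mpow V 2"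
    unfolding l_def by (rule alg_auto_mpow[OF V(1) G(1) mpow_linear_part[OF V(1) f(1)]])
  ultimately have Gf: "G f - X p \<in> mpow V 2" by simp
  have Gf1: "G f \<in> mpow V (Suc 0)"
    by (rule alg_auto_mpow[OF V(1) G(1) f(1)])
  have "alg_auto V (change_var V p (G f))"
    using change_var_X[OF V(1) Gf1, of _ p] Gf
    by (intro alg_auto_unipotent[OF V(1) change_var_local[OF V(1) Gf1]]) auto
  then have "req V (X p) (G f)"
    using change_var_X[OF V(1) Gf1 V(2), of p] X_ser[OF V(2)] by (auto intro: reqI)
  moreover have "req V f (G f)"
    using G(1) mpow_ser[OF f(1)] by (auto intro: reqI)
  ultimately show ?thesis using req_sym req_trans by blast
qed

lemma sum_pairs: "(\<Sum>k\<in>{1..m}. g (2 * k - 1) + g (2 * k)) = (\<Sum>i\<in>{1..2 * m}. g i)"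
  for g :: "nat \<Rightarrow> 'b::comm_monoid_add"
  by (induction m) (auto simp: ac_simps One_nat_def)

text \<open>
  Morse's lemma: \<open>X i \<mapsto> X i + \<phi> i\<close> takes the hyperbolic form to \<open>f\<close> if and only if \<open>\<phi>\<close> solves a
  fixed point equation, in which every pair of variables divides its share of the remainder.
\<close>

lemma morse_lemma:
  fixes f :: "'a::field mps"
  assumes n: "even n" and f: "f \<in> ser {1..n}" "f - hyp (n div 2) \<in> mpow {1..n} 3"
  shows "req {1..n} f (hyp (n div 2))"
proof -
  let ?V = "{1..n}" and ?m = "n div 2"
  define h where "h = f - hyp ?m"
  have h: "h \<in> mpow ?V 3" using f(2) by (simp add: h_def)
  \<comment> \<open>\<open>pt\<close> exchanges the partners \<open>2 * k - 1\<close> and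
    \<open>2 * k\<close>.\<close>
  define pt :: "nat \<Rightarrow> nat" where "pt i = (if odd i then i + 1 else i - 1)" for i
  define S :: "(nat \<Rightarrow> 'a mps) \<Rightarrow> 'a mps" where "S \<phi> = (\<Sum>k\<in>{1..?m}. \<phi> (2 * k - 1) * \<phi> (2 * k))" for \<phi>
  \<comment> \<open>When the products of shifted partners are expanded, the terms linear in
    \<open>\<phi>\<close> have to add up to \<open>h - S \<phi>\<close>. The share of this series
    divided by one variable is therefore assigned to the correction at its partner.\<close>
  define T where "T \<phi> i = (if i \<in> ?V then quot_var ?V (pt i) (h - S \<phi>) else 0)" for \<phi> i
  define ok where "ok m \<longleftrightarrow> set_mset m \<subseteq> ?V \<and> 2 \<le> size m" for m :: monom
  have adm: "(\<forall>i m. \<not> ok m \<longrightarrow> cf (\<phi> i) m = 0) \<longleftrightarrow> (\<forall>i. \<phi> i \<in> mpow ?V 2)" for \<phi> :: "nat \<Rightarrow> 'a mps"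
    unfolding ok_def mpow_def by blast
  have S3: "S \<phi> \<in> mpow ?V 3" if "\<And>i. \<phi> i \<in> mpow ?V 2" for \<phi>
    unfolding S_def
    by (intro mpow_sum mpow_mono[OF mpow_mult[OF that that]]) auto
  have "\<exists>\<phi>. (\<forall>i m. \<not> ok m \<longrightarrow> cf (\<phi> i) m = 0) \<and> T \<phi> = \<phi>"
  proof (rule contraction_fixpoint, goal_cases)
    case (1 \<phi>)
    then have "\<And>i. \<phi> i \<in> mpow ?V 2" by (simp add: adm)
    then have "h - S \<phi> \<in> mpow ?V 3" using mpow_diff[OF h S3] by blast
    from quot_var_mpow[OF this] have "T \<phi> i \<in> mpow ?V 2" for i
      by (simp add: T_def)
    then show ?case by (simp add: adm)
  next
    case (2 \<phi> \<psi> k i m)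
    then have \<phi>: "\<And>i. \<phi> i \<in> mpow ?V 2" and \<psi>: "\<And>i. \<psi> i \<in> mpow ?V 2" by (simp_all add: adm)
    have d: "\<phi> i - \<psi> i \<in> mpow ?V k" for i
      using mpow_ser[OF \<phi>] mpow_ser[OF \<psi>] 2(3) by (intro mpow_diffI) auto
    \<comment> \<open>The corrections have order two, so a product of two of them gains two orders
      of precision, of which \<open>quot_var\<close> loses only one; this makes \<open>T\<close> a
      contraction.\<close>
    have "\<phi> a * \<phi> b - \<psi> a * \<psi> b \<in> mpow ?V (2 + k)" for a b
    proof -
      have "\<phi> a * \<phi> b - \<psi> a * \<psi> b = \<phi> a * (\<phi> b - \<psi> b) + \<psi> b * (\<phi> a - \<psi> a)"
        by (simp add: algebra_simps)
      then show ?thesis using mpow_add[OF mpow_mult[OF \<phi> d] mpow_mult[OF \<psi> d]] by simp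
    qed
    then have "S \<phi> - S \<psi> \<in> mpow ?V (2 + k)"
      unfolding S_def sum_subtractf[symmetric] by (rule mpow_sum)
    then have "quot_var ?V (pt i) ((h - S \<psi>) - (h - S \<phi>)) \<in> mpow ?V (2 + k - 1)"
      by (intro quot_var_mpow) simp
    then have "T \<psi> i - T \<phi> i \<in> mpow ?V (Suc k)"
      by (simp add: T_def quot_var_diff[symmetric])
    from mpow_diffD[OF this 2(4)] show ?case by simp
  qed
  then obtain \<phi> where \<phi>: "\<And>i. \<phi> i \<in> mpow ?V 2" "\<And>i. T \<phi> i = \<phi> i"
    by (auto simp: adm fun_eq_iff)
  define g where "g = h - S \<phi>"
  have g: "g \<in> mpow ?V 3" unfolding g_def using h S3[OF \<phi>(1)] by (rule mpow_diff)
  have \<phi>g: "\<phi> i = quot_var ?V (pt i) g" if "i \<in> ?V" for i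
    using \<phi>(2)[of i] that by (simp add: T_def g_def)
  have cross: "(\<Sum>k\<in>{1..?m}. X (2 * k - 1) * \<phi> (2 * k) + X (2 * k) * \<phi> (2 * k - 1)) = g"
  proof -
    have "(\<Sum>k\<in>{1..?m}. X (2 * k - 1) * \<phi> (2 * k) + X (2 * k) * \<phi> (2 * k - 1))
      = (\<Sum>k\<in>{1..?m}. X (2 * k - 1) * quot_var ?V (2 * k - 1) g + X (2 * k) * quot_var ?V (2 * k) g)"
    proof (rule sum.cong[OF refl])
      fix k assume "k \<in> {1..?m}"
      then have *: "2 * k - 1 \<in> ?V" "2 * k \<in> ?V" "pt (2 * k) = 2 * k - 1" "pt (2 * k - 1) = 2 * k"
        using n by (auto simp: pt_def)
      then show "X (2 * k - 1) * \<phi> (2 * k) + X (2 * k) * \<phi> (2 * k - 1)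
          = X (2 * k - 1) * quot_var ?V (2 * k - 1) g + X (2 * k) * quot_var ?V (2 * k) g"
        by (simp only: \<phi>g[OF *(1)] \<phi>g[OF *(2)])
    qed
    also have "\<dots> = (\<Sum>i\<in>{1..2 * ?m}. X i * quot_var ?V i g)"
      by (rule sum_pairs)
    also have "\<dots> = g"
      using n mpow_decompose[OF _ mpow_mono[OF g, of "Suc 0" ?V]] by (simp add: One_nat_def)
    finally show ?thesis .
  qed
  let ?F = "subst_series ?V (\<lambda>i. X i + \<phi> i)"
  have a: "X i + \<phi> i \<in> mpow ?V (Suc 0)" if "i \<in> ?V" for i
    using that \<phi>(1)[of i] by (intro mpow_add) (auto intro: mpow_X mpow_mono)
  have FX: "?F (X i) = X i + \<phi> i" if "i \<in> ?V" for i
    using subst_series_X[of ?V _ ?V, OF _ a that] by simp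
  have "alg_auto ?V ?F"
    using \<phi>(1) by (intro alg_auto_unipotent local_endo_subst a) (auto simp: FX)
  moreover have "?F (hyp ?m) = f"
  proof -
    have "?F (hyp ?m) = (\<Sum>k\<in>{1..?m}. (X (2 * k - 1) + \<phi> (2 * k - 1)) * (X (2 * k) + \<phi> (2 * k)))"
      unfolding hyp_def subst_series_sum
    proof (rule sum.cong[OF refl])
      fix k assume "k \<in> {1..?m}"
      then have "2 * k - 1 \<in> ?V" "2 * k \<in> ?V" using n by auto
      then show "?F (X (2 * k - 1) * X (2 * k)) = (X (2 * k - 1) + \<phi> (2 * k - 1)) * (X (2 * k) + \<phi> (2 * k))"
        by (simp only: subst_series_mult[of ?V _ ?V, OF finite_atLeastAtMost a] FX)
    qed
    also have "\<dots> = hyp ?m + (\<Sum>k\<in>{1..?m}. X (2 * k - 1) * \<phi> (2 * k) + X (2 * k) * \<phi> (2 * k - 1)) + S \<phi>"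
      unfolding hyp_def S_def sum.distrib[symmetric]
      by (rule sum.cong) (auto simp: algebra_simps)
    also have "\<dots> = f" unfolding cross by (simp add: g_def h_def)
    finally show ?thesis .
  qed
  ultimately have "req ?V (hyp ?m) f"
    using hyp_ser[of ?m n] by (auto intro: reqI)
  then show ?thesis by (rule req_sym)
qed

section \<open>Jets\<close>

abbreviation vars :: "nat \<Rightarrow> nat set" where
  "vars n \<equiv> {1..n}"

definition jetm :: "nat \<Rightarrow> 'a::field mps \<Rightarrow> 'a mps" where
  "jetm k f = Mps (jet k (cf f))"

lemma cf_jetm: "cf (jetm k f) m = (if size m \<le> k then cf f m else 0)"
  by (simp add: jetm_def jet_def)

lemma jetm_eq_iff: "f \<in> ser V \<Longrightarrow> g \<in> ser V \<Longrightarrow> jetm k f = jetm k g \<longleftrightarrow> f - g \<in> mpow V (Suc k)"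
proof
  assume fg: "f \<in> ser V" "g \<in> ser V"
  { assume "jetm k f = jetm k g"
    then have "cf (jetm k f) m = cf (jetm k g) m" for m by simp
    then have "cf f m = cf g m" if "size m < Suc k" for m
      using that by (metis cf_jetm less_Suc_eq_le)
    then show "f - g \<in> mpow V (Suc k)" by (rule mpow_diffI[OF fg]) }
  assume "f - g \<in> mpow V (Suc k)"
  then show "jetm k f = jetm k g"
    by (intro mps_eqI) (simp add: cf_jetm mpow_diffD[of f g V "Suc k"])
qed

lemma jetm_ser: "f \<in> ser V \<Longrightarrow> jetm k f \<in> ser V"
  by (auto simp: ser_iff cf_jetm)

lemma jetm_mpow: "f \<in> mpow V l \<Longrightarrow> jetm k f \<in> mpow V l"
  by (auto simp: mpow_def cf_jetm)

lemma jetm_diff: "f \<in> ser V \<Longrightarrow> f - jetm k f \<in> mpow V (Suc k)"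
  by (rule mpow_diffI) (auto simp: cf_jetm jetm_ser)

lemma jetm_auto:
  assumes "finite V" "alg_auto V F" "f \<in> ser V" "g \<in> ser V" "jetm k f = jetm k g"
  shows "jetm k (F f) = jetm k (F g)"
proof -
  note E = alg_auto_endo[OF assms(2)]
  have "f - g \<in> mpow V (Suc k)"
    using jetm_eq_iff[OF assms(3,4)] assms(5) by simp
  from alg_auto_mpow[OF assms(1,2) this] have "F f - F g \<in> mpow V (Suc k)"
    by (simp only: alg_endo_simps(5)[OF E assms(3,4)])
  then show ?thesis
    using jetm_eq_iff[OF alg_endoD(1)[OF E assms(3)] alg_endoD(1)[OF E assms(4)]] by simp
qed

section \<open>Passage between the ring \<open>power_series n\<close> and the type of series\<close>

lemma carrier_power_series: "f \<in> carrier (power_series n) \<longleftrightarrow> Mps f \<in> ser (vars n)"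
  by (simp add: power_series_def mpow_def)

lemma power_series_ops:
  "f \<otimes>\<^bsub>power_series n\<^esub> g = cf (Mps f * Mps g)" "f \<oplus>\<^bsub>power_series n\<^esub> g = cf (Mps f + Mps g)"
  "\<one>\<^bsub>power_series n\<^esub> = cf 1" "\<zero>\<^bsub>power_series n\<^esub> = cf 0"
proof -
  have "(\<Sum>a | a \<subseteq># m. f a * g (m - a)) = (\<Sum>(a, b)\<in>splits m. f a * g b)" for m
    unfolding splits_eq by (subst sum.reindex) (auto simp: inj_on_def)
  then show "f \<otimes>\<^bsub>power_series n\<^esub> g = cf (Mps f * Mps g)"
    by (auto simp: power_series_def cf_mult)
qed (auto simp: power_series_def cf_one fun_eq_iff)

lemma const_eq: "const c = cf (Con c)" and var_eq: "var i = cf (X i)"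
  by (simp_all add: Con_def X_def)

lemma right_group_alg_auto:
  assumes "\<Phi> \<in> right_group n"
  shows "alg_auto (vars n) (\<lambda>f. Mps (\<Phi> (cf f)))"
proof -
  have iso: "\<Phi> \<in> Ring.ring_hom (power_series n) (power_series n)"
      "bij_betw \<Phi> (carrier (power_series n)) (carrier (power_series n))"
    and c: "\<And>c. \<Phi> (const c) = const c"
    using assms by (auto simp: right_group_def ring_iso_def)
  have im: "\<Phi> f \<in> carrier (power_series n)" if "f \<in> carrier (power_series n)" for f
    using iso(1) that by (rule ring_hom_closed)
  have "bij_betw (\<lambda>f. Mps (\<Phi> (cf f))) (ser (vars n)) (ser (vars n))"
  proof -
    have "bij_betw cf (ser (vars n)) (carrier (power_series n))"
      by (rule bij_betw_byWitness[of _ Mps]) (auto simp: carrier_power_series)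
    moreover have "bij_betw Mps (carrier (power_series n)) (ser (vars n))"
      by (rule bij_betw_byWitness[of _ cf]) (auto simp: carrier_power_series)
    ultimately have "bij_betw (Mps \<circ> (\<Phi> \<circ> cf)) (ser (vars n)) (ser (vars n))"
      using iso(2) by (meson bij_betw_trans)
    then show ?thesis by (simp add: comp_def)
  qed
  moreover have "alg_endo (vars n) (\<lambda>f. Mps (\<Phi> (cf f)))"
    unfolding alg_endo_def
  proof (intro conjI ballI allI)
    show "(\<lambda>f. Mps (\<Phi> (cf f))) ` ser (vars n) \<subseteq> ser (vars n)"
      using im by (auto simp: carrier_power_series)
    show "Mps (\<Phi> (cf (Con c))) = Con c" for c
      using c[of c] by (simp add: const_eq)
    fix f g :: "'a mps" assume "f \<in> ser (vars n)" "g \<in> ser (vars n)"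
    then have "cf f \<in> carrier (power_series n)" "cf g \<in> carrier (power_series n)"
      by (simp_all add: carrier_power_series)
    from ring_hom_add[OF iso(1) this] ring_hom_mult[OF iso(1) this]
    show "Mps (\<Phi> (cf (f + g))) = Mps (\<Phi> (cf f)) + Mps (\<Phi> (cf g))"
      "Mps (\<Phi> (cf (f * g))) = Mps (\<Phi> (cf f)) * Mps (\<Phi> (cf g))"
      by (simp_all add: power_series_ops del: cf_simps)
  qed
  ultimately show ?thesis by (simp add: alg_auto_def)
qed

lemma alg_auto_right_group:
  fixes F :: "'a::field mps \<Rightarrow> 'a mps"
  assumes "alg_auto (vars n) F"
  shows "(\<lambda>s. cf (F (Mps s))) \<in> right_group n"
proof -
  note E = alg_auto_endo[OF assms]
  have "bij_betw (\<lambda>s. cf (F (Mps s))) (carrier (power_series n)) (carrier (power_series n))"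
  proof -
    have "bij_betw cf (ser (vars n)) (carrier (power_series n))"
      by (rule bij_betw_byWitness[of _ Mps]) (auto simp: carrier_power_series)
    moreover have "bij_betw Mps (carrier (power_series n)) (ser (vars n))"
      by (rule bij_betw_byWitness[of _ cf]) (auto simp: carrier_power_series)
    ultimately have "bij_betw (cf \<circ> (F \<circ> Mps)) (carrier (power_series n)) (carrier (power_series n))"
      using assms unfolding alg_auto_def by (meson bij_betw_trans)
    then show ?thesis by (simp add: comp_def)
  qed
  moreover have "(\<lambda>s. cf (F (Mps s))) \<in> Ring.ring_hom (power_series n) (power_series n)"
  proof (rule ring_hom_memI)
    fix x y :: "'a series" assume x: "x \<in> carrier (power_series n)"
    then show "cf (F (Mps x)) \<in> carrier (power_series n)"
      using alg_endoD(1)[OF E] by (simp add: carrier_power_series)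
    assume "y \<in> carrier (power_series n)"
    with x have xy: "Mps x \<in> ser (vars n)" "Mps y \<in> ser (vars n)" by (simp_all add: carrier_power_series)
    from alg_endoD(3)[OF E xy] alg_endoD(4)[OF E xy]
    show "cf (F (Mps (x \<oplus>\<^bsub>power_series n\<^esub> y))) = cf (F (Mps x)) \<oplus>\<^bsub>power_series n\<^esub> cf (F (Mps y))"
      "cf (F (Mps (x \<otimes>\<^bsub>power_series n\<^esub> y))) = cf (F (Mps x)) \<otimes>\<^bsub>power_series n\<^esub> cf (F (Mps y))"
      by (simp_all add: power_series_ops del: cf_simps)
  next
    show "cf (F (Mps \<one>\<^bsub>power_series n\<^esub>)) = \<one>\<^bsub>power_series n\<^esub>"
      using alg_endo_simps(2)[OF E] by (simp add: power_series_ops)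
  qed
  moreover have "cf (F (Mps (const c))) = const c" for c
    using alg_endoD(2)[OF E] by (simp add: const_eq)
  ultimately show ?thesis by (simp add: right_group_def ring_iso_def)
qed

lemma right_equivalent_iff:
  assumes "Mps f \<in> ser (vars n)"
  shows "right_equivalent n f g \<longleftrightarrow> req (vars n) (Mps f) (Mps g)"
proof
  assume "right_equivalent n f g"
  then obtain \<Phi> where "\<Phi> \<in> right_group n" "g = \<Phi> f" by (auto simp: right_equivalent_def)
  with right_group_alg_auto assms show "req (vars n) (Mps f) (Mps g)"
    by (auto intro!: reqI[of _ "\<lambda>f. Mps (\<Phi> (cf f))"])
next
  assume "req (vars n) (Mps f) (Mps g)"
  then obtain F where "alg_auto (vars n) F" "Mps g = F (Mps f)" by (auto simp: req_def)
  then show "right_equivalent n f g"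
    using alg_auto_right_group[of n F] unfolding right_equivalent_def by (metis mps.sel)
qed

lemma max_ideal_iff: "f \<in> max_ideal n \<longleftrightarrow> Mps f \<in> mpow (vars n) (Suc 0)"
  by (auto simp: max_ideal_def carrier_power_series mpow_1_iff)

lemma max_ideal_squared_mpow:
  assumes "f \<in> max_ideal_squared n"
  shows "Mps f \<in> mpow (vars n) 2"
  using assms unfolding max_ideal_squared_def
proof (induction rule: ideal_prod.induct)
  case (prod i j)
  then have "Mps i * Mps j \<in> mpow (vars n) (Suc 0 + Suc 0)"
    by (intro mpow_mult) (simp_all add: max_ideal_iff)
  then show ?case by (simp add: power_series_ops numeral_2_eq_2)
next
  case (sum f g)
  then show ?case by (simp add: power_series_ops mpow_add del: cf_simps)
qed

lemma A1_series_eq: "Mps (A1_series n) = (hyp (n div 2) :: 'a::field mps)"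
proof -
  interpret abelian_monoid "power_series n :: 'a series ring"
  proof (rule abelian_monoidI)
    fix x y z :: "'a series"
    show "x \<oplus>\<^bsub>power_series n\<^esub> y \<oplus>\<^bsub>power_series n\<^esub> z = x \<oplus>\<^bsub>power_series n\<^esub> (y \<oplus>\<^bsub>power_series n\<^esub> z)"
      by (simp add: power_series_ops add.assoc del: cf_simps)
    show "x \<oplus>\<^bsub>power_series n\<^esub> y = y \<oplus>\<^bsub>power_series n\<^esub> x"
      by (simp add: power_series_ops add.commute del: cf_simps)
  qed (auto simp: power_series_ops carrier_power_series mpow_add simp del: cf_simps)
  have "Mps (finsum (power_series n) g A) = (\<Sum>i\<in>A. Mps (g i))"
    if "finite A" "\<And>i. i \<in> A \<Longrightarrow> Mps (g i) \<in> ser (vars n)" for g :: "nat \<Rightarrow> 'a series" and A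
    using that
  proof (induction A rule: finite_induct)
    case empty
    then show ?case by (simp add: power_series_ops zero_mps_def)
  next
    case (insert x A)
    then show ?case
      by (subst finsum_insert) (auto simp: carrier_power_series power_series_ops simp del: cf_simps)
  qed
  note finsum = this
  have "Mps (var (2 * i - 1) \<otimes>\<^bsub>power_series n\<^esub> var (2 * i)) \<in> (ser (vars n) :: 'a mps set)" if "i \<in> {1..n div 2}" for i
    using that by (auto simp: power_series_ops var_eq intro!: mpow_mult_left X_ser)
  from finsum[OF _ this, of "vars (n div 2)"] show ?thesis
    unfolding A1_series_def hyp_def by (simp add: power_series_ops var_eq)
qed

section \<open>The Zariski topology\<close>

lemma topspace_affine [simp]:
  "topspace (zariski (affine_space I)) = (affine_points I :: ('i \<Rightarrow> 'k::field) set)"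
proof -
  let ?B = "{{a \<in> affine_points I. p a \<noteq> 0} | p :: ('i \<Rightarrow> 'k) \<Rightarrow> 'k. p \<in> polyfun I}"
  have "{a \<in> affine_points I. (\<lambda>_. 1 :: 'k) a \<noteq> 0} \<in> ?B"
    by (intro CollectI exI[of _ "\<lambda>_. 1 :: 'k"] conjI refl polyfun.const)
  then have "affine_points I \<subseteq> \<Union>?B" by auto
  moreover have "\<Union>?B \<subseteq> affine_points I" by auto
  ultimately show ?thesis by (simp add: affine_space_def)
qed

lemma openin_basic: "p \<in> polyfun I \<Longrightarrow> openin (zariski (affine_space I)) {a \<in> affine_points I. p a \<noteq> 0}"
  by (auto simp: affine_space_def intro!: topology_generated_by_Basis)

text \<open>The generating sets form a base and not only a subbase, since the intersection of two of
  them is defined by the product of the polynomials.\<close>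

lemma openin_affine_iff:
  "openin (zariski (affine_space I)) U \<longleftrightarrow> U \<subseteq> affine_points I \<and>
    (\<forall>a\<in>U. \<exists>p\<in>polyfun I. p a \<noteq> 0 \<and> {b \<in> affine_points I. p b \<noteq> 0} \<subseteq> U)"
  (is "_ \<longleftrightarrow> ?R U")
proof
  assume "openin (zariski (affine_space I)) U"
  then have "generate_topology_on {{a \<in> affine_points I. p a \<noteq> 0} | p. p \<in> polyfun I} U"
    by (simp add: affine_space_def openin_topology_generated_by_iff)
  then show "?R U"
  proof (induction rule: generate_topology_on.induct)
    case (Int A B)
    show ?case
    proof (intro conjI ballI)
      fix x assume "x \<in> A \<inter> B"
      then have x: "x \<in> A" "x \<in> B" by auto
      obtain p where p: "p \<in> polyfun I" "p x \<noteq> 0" "{b \<in> affine_points I. p b \<noteq> 0} \<subseteq> A"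
        using Int.IH(1) x(1) by blast
      obtain q where q: "q \<in> polyfun I" "q x \<noteq> 0" "{b \<in> affine_points I. q b \<noteq> 0} \<subseteq> B"
        using Int.IH(2) x(2) by blast
      show "\<exists>p\<in>polyfun I. p x \<noteq> 0 \<and> {b \<in> affine_points I. p b \<noteq> 0} \<subseteq> A \<inter> B"
        using p q
        by (intro bexI[of _ "\<lambda>a. p a * q a"]) (auto intro: polyfun.mult)
    qed (use Int in auto)
  next
    case (UN K)
    show ?case
    proof (intro conjI ballI)
      fix x assume "x \<in> \<Union>K"
      then obtain A where A: "A \<in> K" "x \<in> A" by blast
      obtain p where "p \<in> polyfun I" "p x \<noteq> 0" "{b \<in> affine_points I. p b \<noteq> 0} \<subseteq> A"
        using UN.IH[OF A(1)] A(2) by blast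
      with A(1) show "\<exists>p\<in>polyfun I. p x \<noteq> 0 \<and> {b \<in> affine_points I. p b \<noteq> 0} \<subseteq> \<Union>K"
        by (intro bexI[of _ p]) auto
    qed (use UN in blast)
  qed auto
next
  assume R: "?R U"
  define \<P> where "\<P> = {{b \<in> affine_points I. p b \<noteq> 0} | p. p \<in> polyfun I \<and> {b \<in> affine_points I. p b \<noteq> 0} \<subseteq> U}"
  have "U = \<Union>\<P>"
  proof
    show "\<Union>\<P> \<subseteq> U" unfolding \<P>_def by blast
    show "U \<subseteq> \<Union>\<P>"
    proof
      fix x assume x: "x \<in> U"
      then obtain p where p: "p \<in> polyfun I" "p x \<noteq> 0" "{b \<in> affine_points I. p b \<noteq> 0} \<subseteq> U"
        using R by blast
      then have "{b \<in> affine_points I. p b \<noteq> 0} \<in> \<P>" unfolding \<P>_def by blast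
      moreover have "x \<in> {b \<in> affine_points I. p b \<noteq> 0}" using R x p by blast
      ultimately show "x \<in> \<Union>\<P>" by blast
    qed
  qed
  moreover have "openin (zariski (affine_space I)) (\<Union>\<P>)"
    unfolding \<P>_def by (intro openin_Union) (auto intro: openin_basic)
  ultimately show "openin (zariski (affine_space I)) U" by simp
qed

lemma polyfun_sum: "(\<And>i. i \<in> A \<Longrightarrow> (\<lambda>a. p i a) \<in> polyfun I) \<Longrightarrow> (\<lambda>a. \<Sum>i\<in>A. p i a) \<in> polyfun I"
  by (induction A rule: infinite_finite_induct) (auto intro: polyfun.intros)

lemma polyfun_prod: "(\<And>i. i \<in> A \<Longrightarrow> (\<lambda>a. p i a) \<in> polyfun I) \<Longrightarrow> (\<lambda>a. \<Prod>i\<in>A. p i a) \<in> polyfun I"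
  by (induction A rule: infinite_finite_induct) (auto intro: polyfun.intros)

lemma polyfun_prod_mset:
  "(\<And>i. i \<in># m \<Longrightarrow> (\<lambda>a. p i a) \<in> polyfun I) \<Longrightarrow> (\<lambda>a. \<Prod>i\<in>#m. p i a) \<in> polyfun I"
  by (induction m) (auto intro: polyfun.intros)

lemma polyfun_compose:
  assumes "p \<in> polyfun I" "\<And>i. i \<in> I \<Longrightarrow> (\<lambda>a. L a i) \<in> polyfun I'"
  shows "(\<lambda>a. p (L a)) \<in> polyfun I'"
  using assms(1) by induction (auto intro: polyfun.intros assms(2))

lemma polyfun_cong_affine:
  assumes "p \<in> polyfun I" "\<And>i. i \<in> I \<Longrightarrow> a i = b i"
  shows "p a = p b"
  using assms(1) by induction (auto simp: assms(2))

lemma polyfun_line: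
  assumes "p \<in> polyfun I"
  shows "\<exists>Q. \<forall>t. p (\<lambda>i. a i + t * b i) = poly Q t"
  using assms
proof induction
  case (const c)
  show ?case by (intro exI[of _ "[:c:]"]) simp
next
  case (coord i)
  show ?case by (intro exI[of _ "[:a i, b i:]"]) simp
next
  case (add p q)
  then show ?case by (metis poly_add)
next
  case (mult p q)
  then show ?case by (metis poly_mult)
qed

text \<open>Along a line a polynomial becomes a polynomial in one variable, which has finitely many
  zeros. Density of orbits and irreducibility of images of lines are both derived from this, in
  place of any general dimension theory.\<close>

lemma open_line_cofinite:
  fixes a b :: "'i \<Rightarrow> 'k::field"
  assumes "openin (zariski (affine_space I)) U" and pts: "a \<in> affine_points I" "b \<in> affine_points I"
    and t: "(\<lambda>i. a i + t * b i) \<in> U"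
  shows "finite {t. (\<lambda>i. a i + t * b i) \<notin> U}"
proof -
  obtain p where p: "p \<in> polyfun I" "p (\<lambda>i. a i + t * b i) \<noteq> 0" "{c \<in> affine_points I. p c \<noteq> 0} \<subseteq> U"
    using assms(1) t unfolding openin_affine_iff by blast
  obtain Q where Q: "\<And>t. p (\<lambda>i. a i + t * b i) = poly Q t"
    using polyfun_line[OF p(1)] by metis
  have "Q \<noteq> 0" using p(2) Q by auto
  have "(\<lambda>i. a i + t * b i) \<in> affine_points I" for t
    using pts by (auto simp: affine_points_def)
  then have "p (\<lambda>i. a i + t * b i) = 0" if "(\<lambda>i. a i + t * b i) \<notin> U" for t
    using p(3) that by blast
  then have "{t. (\<lambda>i. a i + t * b i) \<notin> U} \<subseteq> {t. poly Q t = 0}"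
    by (auto simp flip: Q)
  then show ?thesis
    using poly_roots_finite[OF \<open>Q \<noteq> 0\<close>] finite_subset by blast
qed

text \<open>In a finite field, one plus the product of all linear factors has no root.\<close>

lemma infinite_alg_closed: "infinite (UNIV :: 'a::alg_closed_field set)"
proof
  assume fin: "finite (UNIV :: 'a set)"
  define p where "p = (\<Prod>a\<in>(UNIV :: 'a set). [:- a, 1:]) + 1"
  have "degree (\<Prod>a\<in>(UNIV :: 'a set). [:- a, 1:]) = card (UNIV :: 'a set)"
    by (subst degree_prod_eq_sum_degree) (auto simp: fin)
  moreover have "card (UNIV :: 'a set) > 0" using fin by (simp add: card_gt_0_iff)
  ultimately have "degree p > 0"
    unfolding p_def by (subst degree_add_eq_left) auto
  then obtain x where x: "poly p x = 0" using alg_closed_imp_poly_has_root by blast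
  have "poly (\<Prod>a\<in>(UNIV :: 'a set). [:- a, 1:]) x = 0"
    by (auto simp: poly_prod fin intro!: bexI[of _ x])
  with x show False by (simp add: p_def)
qed

section \<open>Actions with finitely many orbits\<close>

text \<open>The quotient of a single orbit. Points of quotients have to be sets of points of the
  space; the empty set is an arbitrary choice of such a point.\<close>

definition point_space :: "('p set, 'k) kspace" where
  "point_space = \<lparr>zariski = discrete_topology {{}}, regular = \<lambda>V. UNIV\<rparr>"

lemma const_regular: "(\<lambda>_. c) \<in> regular (affine_space I) U"
proof -
  have "\<exists>p\<in>polyfun I. \<exists>q\<in>polyfun I. q a \<noteq> 0 \<and> (\<forall>b\<in>U. q b \<noteq> 0 \<longrightarrow> c = p b / q b)" for a
    by (rule bexI[OF _ polyfun.const[of c]], rule bexI[OF _ polyfun.const[of 1]]) simp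
  then show ?thesis by (simp add: affine_space_def)
qed

lemma variety_point: "variety (point_space :: ('p set, 'k::field) kspace)"
proof -
  let ?Y = "point_space :: ('p set, 'k) kspace"
  \<comment> \<open>The affine model of the point is the affine space without coordinates, whose
    only element is the zero function.\<close>
  let ?Z = "affine_space {..<0::nat} :: (nat \<Rightarrow> 'k, 'k) kspace"
  let ?\<phi> = "\<lambda>_ :: 'p set. (\<lambda>_ :: nat. 0 :: 'k)"
  have pts: "affine_points ({} :: nat set) = {\<lambda>_. 0 :: 'k}"
    by (auto simp: affine_points_def)
  have reg: "regular (induced ?Y {{}}) V = UNIV" if "openin (discrete_topology {{}}) V" for V
    using that by (auto simp: induced_def point_space_def intro!: exI[of _ "{{}}"])
  have "affine_variety (induced ?Y {{}})"
    unfolding affine_variety_def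
  proof (intro exI conjI)
    show "closedin (zariski ?Z) {\<lambda>_. 0}"
      using closedin_topspace[of "zariski ?Z"] by (simp add: pts)
    show "kspace_iso (induced ?Y {{}}) (induced ?Z {\<lambda>_. 0}) ?\<phi>"
      unfolding kspace_iso_def
    proof (intro conjI allI impI)
      have *: "openin (subtopology (zariski ?Z) {\<lambda>_. 0}) U \<longleftrightarrow> U = {} \<or> U = {\<lambda>_. 0}" for U
      proof
        assume "openin (subtopology (zariski ?Z) {\<lambda>_. 0}) U"
        then show "U = {} \<or> U = {\<lambda>_. 0}" using openin_subset by fastforce
      next
        assume "U = {} \<or> U = {\<lambda>_. 0}"
        then show "openin (subtopology (zariski ?Z) {\<lambda>_. 0}) U"
          using openin_topspace[of "subtopology (zariski ?Z) {\<lambda>_. 0}"] by (auto simp: pts)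
      qed
      show "homeomorphic_map (zariski (induced ?Y {{}})) (zariski (induced ?Z {\<lambda>_. 0})) ?\<phi>"
        unfolding homeomorphic_map_def quotient_map_def
        by (auto simp: induced_def point_space_def pts *[unfolded lessThan_0] subtopology_discrete_topology subset_singleton_iff)
      fix V and g :: "(nat \<Rightarrow> 'k) \<Rightarrow> 'k"
      assume "openin (zariski (induced ?Z {\<lambda>_. 0})) V"
      then have V: "V = {} \<or> V = {\<lambda>_. 0}" by (simp add: induced_def *[unfolded lessThan_0])
      have "g \<in> regular (induced ?Z {\<lambda>_. 0}) V"
        unfolding induced_def using V const_regular[of "g (\<lambda>_. 0)" "{..<0::nat}" "{\<lambda>_. 0}"]
          openin_topspace[of "zariski ?Z"]
        by (auto simp: pts intro!: exI[of _ "{\<lambda>_. 0}"] exI[of _ "\<lambda>_. g (\<lambda>_. 0)"])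
      moreover have "g \<circ> ?\<phi> \<in> regular (induced ?Y {{}}) {x \<in> topspace (zariski (induced ?Y {{}})). ?\<phi> x \<in> V}"
        by (subst reg) (auto simp: induced_def point_space_def)
      ultimately show "g \<in> regular (induced ?Z {\<lambda>_. 0}) V \<longleftrightarrow>
          g \<circ> ?\<phi> \<in> regular (induced ?Y {{}}) {x \<in> topspace (zariski (induced ?Y {{}})). ?\<phi> x \<in> V}"
        by simp
    qed
  qed
  then have "prevariety ?Y"
    unfolding prevariety_def using reg
    by (auto simp: point_space_def intro!: exI[of _ "{{{}}}"])
  moreover have "closedin (product_zariski ?Y ?Y) ((\<lambda>x. (x, x)) ` topspace (zariski ?Y))"
  proof -
    have "topspace (product_zariski ?Y ?Y) = {({}, {})}"
    proof
      show "topspace (product_zariski ?Y ?Y) \<subseteq> {({}, {})}"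
        by (auto simp: product_zariski_def point_space_def dest: subsetD)
      have "{(x, y). x \<in> {{}} \<and> y \<in> {{}} \<and> (\<Sum>i<(1::nat). (1::'k) * 1) \<noteq> 0}
          \<subseteq> topspace (product_zariski ?Y ?Y)"
        unfolding product_zariski_def topology_generated_by_topspace
        by (rule Union_upper, rule CollectI, intro exI[of _ "{{}}"] exI[of _ "1::nat"] exI[of _ "\<lambda>_ _. 1"])
          (auto simp: point_space_def)
      then show "{({}, {})} \<subseteq> topspace (product_zariski ?Y ?Y)" by auto
    qed
    then show ?thesis
      using closedin_topspace[of "product_zariski ?Y ?Y"] by (simp add: point_space_def)
  qed
  ultimately show ?thesis by (simp add: variety_def)
qed

text \<open>A function factoring through the point is constant, hence regular, and on the point
  every function is regular, so the condition on the structure sheaf has two true sides.\<close>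

lemma geometric_quotient_point:
  fixes I :: "'i set" and S :: "('i \<Rightarrow> 'k::field) set"
  assumes S: "S \<noteq> {}" "S \<subseteq> affine_points I"
    and orb: "\<And>x y. x \<in> S \<Longrightarrow> y \<in> S \<Longrightarrow> \<exists>g\<in>G. y = act g x"
  shows "geometric_quotient G act (induced (affine_space I) S)
    (\<lambda>_. {} :: ('i \<Rightarrow> 'k) set) point_space"
proof -
  let ?X = "induced (affine_space I) S"
  have top: "topspace (zariski ?X) = S" using S by (auto simp: induced_def)
  have "openin (zariski ?X) {x \<in> topspace (zariski ?X). {} \<in> U}" if "U \<subseteq> {{}}" for U :: "('i \<Rightarrow> 'k) set set"
    by (cases "{} \<in> U") auto
  then have "quotient_map (zariski ?X) (discrete_topology {{}}) (\<lambda>_. {} :: ('i \<Rightarrow> 'k) set)"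
    unfolding quotient_map_def using S top by auto
  moreover have "h \<circ> (\<lambda>_. {}) \<in> regular ?X {x \<in> topspace (zariski ?X). {} \<in> V}"
    for V and h :: "('i \<Rightarrow> 'k) set \<Rightarrow> 'k"
    unfolding induced_def using S openin_topspace[of "zariski (affine_space I)"]
    by (auto intro!: exI[of _ "affine_points I"] exI[of _ "\<lambda>_. h {}"] const_regular)
  ultimately show ?thesis
    unfolding geometric_quotient_def using orb top by (auto simp: point_space_def)
qed

lemma krull_dim_point: "krull_dim (subtopology (discrete_topology {x}) A) = 0"
proof -
  have "l = 0" if C: "\<forall>i\<le>l. irreducible_closedin (subtopology (discrete_topology {x}) A) (C i)"
      "\<forall>i<l. C i \<subset> C (Suc i)" for l :: nat and C
  proof (rule ccontr)
    assume "l \<noteq> 0"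
    then have "C 0 \<noteq> {}" "C 1 \<subseteq> {x}" "C 0 \<subset> C 1"
      using C unfolding irreducible_closedin_def
      by (auto dest!: closedin_subset simp: One_nat_def Suc_le_eq)
    then show False by auto
  qed
  then have "{enat l | l. \<exists>C. (\<forall>i\<le>l. irreducible_closedin (subtopology (discrete_topology {x}) A) (C i)) \<and>
      (\<forall>i<l. C i \<subset> C (Suc i))} \<subseteq> {0}"
    by (auto simp: zero_enat_def)
  then have "krull_dim (subtopology (discrete_topology {x}) A) \<le> 0"
    unfolding krull_dim_def by (metis (no_types, lifting) Sup_subset_mono cSup_singleton)
  then show ?thesis by simp
qed

text \<open>The orbits themselves are the strata. They are listed from the open one downwards:
  \<open>opn\<close> and \<open>dense\<close> make each open and dense in the complement of its
  predecessors. The quotients are points, of Krull dimension zero.\<close>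

lemma open_modality_finite_orbits:
  fixes S :: "nat \<Rightarrow> ('i \<Rightarrow> 'k::field) set"
  assumes cover: "(\<Union>i<N. S i) = affine_points I"
    and disj: "\<And>i j. i < j \<Longrightarrow> j < N \<Longrightarrow> S i \<inter> S j = {}"
    and ne: "\<And>i. i < N \<Longrightarrow> S i \<noteq> {}"
    and opn: "\<And>j. j \<le> N \<Longrightarrow> openin (zariski (affine_space I)) (\<Union>i<j. S i)"
    and dense: "\<And>i j U. i \<le> j \<Longrightarrow> j < N \<Longrightarrow> openin (zariski (affine_space I)) U \<Longrightarrow> U \<inter> S j \<noteq> {} \<Longrightarrow> U \<inter> S i \<noteq> {}"
    and inv: "\<And>i g x. i < N \<Longrightarrow> g \<in> G \<Longrightarrow> x \<in> S i \<Longrightarrow> act g x \<in> S i"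
    and orb: "\<And>i x y. i < N \<Longrightarrow> x \<in> S i \<Longrightarrow> y \<in> S i \<Longrightarrow> \<exists>g\<in>G. y = act g x"
  shows "open_modality G act (affine_space I) U = 0"
proof -
  let ?X = "affine_space I :: ('i \<Rightarrow> 'k, 'k) kspace"
  define st :: "nat \<Rightarrow> ('i \<Rightarrow> 'k, 'k) stratum" where "st i = (S i, \<lambda>_. {}, point_space)" for i
  define strat where "strat = map st [0..<N]"
  have un: "(\<Union>(S', p', Y')\<in>set (take i strat). S') = (\<Union>j<i. S j)" if "i \<le> N" for i
    using that by (auto simp: strat_def take_map st_def)
  have sub: "S i \<subseteq> affine_points I" if "i < N" for i using cover that by auto
  have "rosenlicht_stratification G act ?X strat"
    unfolding rosenlicht_stratification_def
  proof (intro conjI allI impI)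
    show "(\<Union>(S, p, Y)\<in>set strat. S) = topspace (zariski ?X)"
      using un[of N] cover by (simp add: strat_def)
    fix i assume "i < length strat"
    then have i: "i < N" by (simp add: strat_def)
    let ?R = "affine_points I - (\<Union>j<i. S j)"
    have SR: "S i \<subseteq> ?R" using sub[OF i] disj[of _ i] i by blast
    have Suc_un: "(\<Union>j<Suc i. S j) = (\<Union>j<i. S j) \<union> S i" by (auto simp: less_Suc_eq)
    have "openin (subtopology (zariski ?X) ?R) ((\<Union>j<Suc i. S j) \<inter> ?R)"
      using opn[of "Suc i"] i by (intro openin_subtopology_Int) auto
    moreover have eq: "(\<Union>j<Suc i. S j) \<inter> ?R = S i"
      using SR unfolding Suc_un by auto
    ultimately have op: "openin (subtopology (zariski ?X) ?R) (S i)" by simp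
    have cl: "(subtopology (zariski ?X) ?R) closure_of (S i) = ?R"
    proof
      show "(subtopology (zariski ?X) ?R) closure_of (S i) \<subseteq> ?R"
        using closure_of_subset_topspace[of "subtopology (zariski ?X) ?R" "S i"] by auto
      show "?R \<subseteq> (subtopology (zariski ?X) ?R) closure_of (S i)"
      proof
        fix x assume x: "x \<in> ?R"
        then obtain j where j: "j < N" "x \<in> S j" "i \<le> j" using cover by (auto simp: not_less[symmetric])
        show "x \<in> (subtopology (zariski ?X) ?R) closure_of (S i)"
          unfolding in_closure_of
        proof (intro conjI allI impI)
          show "x \<in> topspace (subtopology (zariski ?X) ?R)" using x by simp
          fix T assume "x \<in> T \<and> openin (subtopology (zariski ?X) ?R) T"
          then obtain T' where T': "openin (zariski ?X) T'" "T = T' \<inter> ?R" "x \<in> T'"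
            by (auto simp: openin_subtopology)
          then have "T' \<inter> S i \<noteq> {}" using j dense[of i j T'] by auto
          then show "\<exists>y. y \<in> S i \<and> y \<in> T" using SR T'(2) by auto
        qed
      qed
    qed
    have lc: "locally_closedin (zariski ?X) (S i)"
      unfolding locally_closedin_def
    proof (intro exI conjI)
      show "openin (zariski ?X) (\<Union>j<Suc i. S j)" using opn[of "Suc i"] i by simp
      show "closedin (zariski ?X) ?R" using opn[of i] i sub by (subst closedin_def) (auto simp: double_diff UN_subset_iff)
      show "S i = (\<Union>j<Suc i. S j) \<inter> ?R" using eq by simp
    qed
    have "strat ! i = (S i, \<lambda>_. {}, point_space)"
      using i by (simp add: strat_def st_def)
    then show "case strat ! i of (S, p, Y) \<Rightarrow>
      let R = topspace (zariski ?X) - (\<Union>(S', p', Y')\<in>set (take i strat). S') in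
        S \<subseteq> R \<and> openin (subtopology (zariski ?X) R) S \<and>
        (subtopology (zariski ?X) R) closure_of S = R \<and>
        locally_closedin (zariski ?X) S \<and> (\<forall>g\<in>G. act g ` S \<subseteq> S) \<and>
        variety Y \<and> geometric_quotient G act (induced ?X S) p Y"
      using SR op cl lc inv[OF i] variety_point geometric_quotient_point[OF ne[OF i] sub[OF i] orb[OF i]] un[of i] i
      by (auto simp: Let_def)
  qed
  moreover have "strat_modality strat U = 0"
  proof -
    have "krull_dim (subtopology (zariski Y) (p ` (U \<inter> S'))) = 0" if "(S', p, Y) \<in> set strat" for S' p Y
      using that by (auto simp: strat_def st_def point_space_def krull_dim_point simp del: subtopology_discrete_topology)
    then have "strat_modality strat U \<le> 0"
      unfolding strat_modality_def by (intro SUP_least) auto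
    then show ?thesis by simp
  qed
  ultimately have "open_modality G act ?X U \<le> 0"
    unfolding open_modality_def by (intro INF_lower2[of strat]) auto
  then show ?thesis by simp
qed

section \<open>The jet spaces\<close>

definition jmons :: "nat \<Rightarrow> nat \<Rightarrow> monom set" where
  "jmons n k = {m. set_mset m \<subseteq> vars n \<and> 1 \<le> size m \<and> size m \<le> k}"

lemma finite_jmons [simp]: "finite (jmons n k)"
  by (rule finite_subset[of _ "mons (vars n) k"]) (auto simp: jmons_def mons_iff)

abbreviation jpoints :: "nat \<Rightarrow> nat \<Rightarrow> 'a::field series set" where
  "jpoints n k \<equiv> affine_points (jmons n k)"

lemma jet_space_eq: "jet_space n k = affine_space (jmons n k)"
  by (simp add: jet_space_def jmons_def)

lemma jpoints_iff: "a \<in> jpoints n k \<longleftrightarrow> Mps a \<in> mpow (vars n) (Suc 0) \<and> jetm k (Mps a) = Mps a"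
proof
  assume a: "a \<in> jpoints n k"
  then have "jetm k (Mps a) = Mps a"
    by (intro mps_eqI) (auto simp: cf_jetm affine_points_def jmons_def)
  moreover have "Mps a \<in> mpow (vars n) (Suc 0)"
    using a by (auto simp: mpow_def affine_points_def jmons_def One_nat_def)
  ultimately show "Mps a \<in> mpow (vars n) (Suc 0) \<and> jetm k (Mps a) = Mps a" by simp
next
  assume a: "Mps a \<in> mpow (vars n) (Suc 0) \<and> jetm k (Mps a) = Mps a"
  have "a m = 0" if "m \<notin> jmons n k" for m
  proof (cases "size m \<le> k")
    case True
    then show ?thesis using a that by (auto simp: mpow_def jmons_def One_nat_def)
  next
    case False
    then show ?thesis using a cf_jetm[of k "Mps a" m] by simp
  qed
  then show "a \<in> jpoints n k" by (simp add: affine_points_def)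
qed

lemma jetm_jpoints: "f \<in> mpow (vars n) (Suc 0) \<Longrightarrow> cf (jetm k f) \<in> jpoints n k"
  unfolding jpoints_iff by (auto intro!: jetm_mpow mps_eqI simp: cf_jetm)

text \<open>The definite description in \<open>jet_act\<close> denotes: automorphisms with the same
  \<open>k\<close>-jet differ on every series by terms of order above \<open>k\<close>, and each
  automorphism preserves the powers of the maximal ideal.\<close>

lemma jet_act_eq:
  assumes \<Phi>: "\<Phi> \<in> right_group n" and a: "a \<in> jpoints n k"
  shows "jet_act n k (aut_jet n k \<Phi>) a = cf (jetm k (Mps (\<Phi> a)))"
  unfolding jet_act_def
proof (rule the_equality)
  have a1: "Mps a \<in> mpow (vars n) (Suc 0)" "jetm k (Mps a) = Mps a" using a by (simp_all add: jpoints_iff)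
  have "jet k a = a" using a1(2) by (simp add: jetm_def)
  then show "\<exists>\<Phi>'\<in>right_group n. \<exists>f\<in>max_ideal n. aut_jet n k \<Phi>' = aut_jet n k \<Phi> \<and> jet k f = a
      \<and> cf (jetm k (Mps (\<Phi> a))) = jet k (\<Phi>' f)"
    using \<Phi> a1(1) by (intro bexI[of _ \<Phi>] bexI[of _ a]) (auto simp: max_ideal_iff jetm_def)
  fix b assume "\<exists>\<Phi>'\<in>right_group n. \<exists>f\<in>max_ideal n. aut_jet n k \<Phi>' = aut_jet n k \<Phi> \<and> jet k f = a
      \<and> b = jet k (\<Phi>' f)"
  then obtain \<Phi>' f where \<Phi>': "\<Phi>' \<in> right_group n" and f: "f \<in> max_ideal n"
      and eq: "aut_jet n k \<Phi>' = aut_jet n k \<Phi>" and "jet k f = a" "b = jet k (\<Phi>' f)"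
    by blast
  let ?F = "\<lambda>f. Mps (\<Phi> (cf f))" and ?F' = "\<lambda>f. Mps (\<Phi>' (cf f))"
  have F: "alg_auto (vars n) ?F" "alg_auto (vars n) ?F'"
    using \<Phi> \<Phi>' by (simp_all add: right_group_alg_auto)
  note E = alg_auto_endo[OF F(1)] alg_auto_endo[OF F(2)]
  have fs: "Mps f \<in> ser (vars n)" "Mps a \<in> ser (vars n)"
    using f a1(1) mpow_ser by (auto simp: max_ideal_iff)
  have "?F' (X i) - ?F (X i) \<in> mpow (vars n) (Suc k)" if "i \<in> vars n" for i
  proof -
    have "jet k (\<Phi>' (var i)) = jet k (\<Phi> (var i))"
      using fun_cong[OF eq, of i] that by (simp add: aut_jet_def)
    then have "jetm k (?F' (X i)) = jetm k (?F (X i))"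
      by (simp add: jetm_def var_eq)
    then show ?thesis
      by (rule jetm_eq_iff[OF alg_endoD(1)[OF E(2) X_ser[OF that]] alg_endoD(1)[OF E(1) X_ser[OF that]], THEN iffD1])
  qed
  from local_endo_cong[OF finite_atLeastAtMost alg_auto_local[OF F(2)] alg_auto_local[OF F(1)] this fs(1)]
  have "?F' (Mps f) - ?F (Mps f) \<in> mpow (vars n) (Suc k)" .
  then have "jetm k (?F' (Mps f)) = jetm k (?F (Mps f))"
    by (rule jetm_eq_iff[OF alg_endoD(1)[OF E(2) fs(1)] alg_endoD(1)[OF E(1) fs(1)], THEN iffD2])
  also have "\<dots> = jetm k (?F (Mps a))"
    using \<open>jet k f = a\<close> a1(2) by (intro jetm_auto[OF finite_atLeastAtMost F(1) fs]) (simp add: jetm_def[of k "Mps f"])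
  finally show "b = cf (jetm k (Mps (\<Phi> a)))"
    using \<open>b = jet k (\<Phi>' f)\<close> by (simp add: jetm_def)
qed

text \<open>From here on orbits are handled by automorphisms of the power series ring instead of
  their jets.\<close>

lemma jet_orbit_iff:
  assumes "a \<in> jpoints n k"
  shows "(\<exists>g\<in>right_jet_group n k. b = jet_act n k g a) \<longleftrightarrow>
    (\<exists>F. alg_auto (vars n) F \<and> b = cf (jetm k (F (Mps a))))"
proof
  assume "\<exists>g\<in>right_jet_group n k. b = jet_act n k g a"
  then obtain \<Phi> where "\<Phi> \<in> right_group n" "b = jet_act n k (aut_jet n k \<Phi>) a"
    by (auto simp: right_jet_group_def)
  with jet_act_eq[OF _ assms] right_group_alg_auto
  show "\<exists>F. alg_auto (vars n) F \<and> b = cf (jetm k (F (Mps a)))"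
    by (intro exI[of _ "\<lambda>f. Mps (\<Phi> (cf f))"]) auto
next
  assume "\<exists>F. alg_auto (vars n) F \<and> b = cf (jetm k (F (Mps a)))"
  then obtain F where F: "alg_auto (vars n) F" "b = cf (jetm k (F (Mps a)))" by blast
  let ?\<Phi> = "\<lambda>s. cf (F (Mps s))"
  have "?\<Phi> \<in> right_group n" by (rule alg_auto_right_group[OF F(1)])
  with jet_act_eq[OF this assms] F(2) show "\<exists>g\<in>right_jet_group n k. b = jet_act n k g a"
    by (intro bexI[of _ "aut_jet n k ?\<Phi>"]) (auto simp: right_jet_group_def)
qed

lemma jpoint_expansion:
  assumes "a \<in> jpoints n k"
  shows "Mps a = (\<Sum>m\<in>jmons n k. Con (a m) * Mps (\<lambda>w. if w = m then 1 else 0))"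
proof (rule mps_eqI)
  fix w
  have "cf (\<Sum>m\<in>jmons n k. Con (a m) * Mps (\<lambda>w. if w = m then 1 else 0)) w
      = (\<Sum>m\<in>jmons n k. if m = w then a w else 0)"
    unfolding cf_sum by (rule sum.cong) auto
  then show "cf (Mps a) w = cf (\<Sum>m\<in>jmons n k. Con (a m) * Mps (\<lambda>w. if w = m then 1 else 0)) w"
    using assms by (auto simp: affine_points_def)
qed

text \<open>An automorphism acts on jets by a linear map, so composing with it keeps functions
  polynomial. This moves a separating polynomial from a representative to any point of its
  orbit.\<close>

lemma polyfun_auto:
  fixes p :: "'a::field series \<Rightarrow> 'a"
  assumes F: "alg_auto (vars n) F" and p: "p \<in> polyfun (jmons n k)"
  shows "\<exists>p'\<in>polyfun (jmons n k). \<forall>a\<in>jpoints n k. p' a = p (cf (jetm k (F (Mps a))))"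
proof -
  note E = alg_auto_endo[OF F]
  define e where "e m = Mps (\<lambda>w. if w = m then 1 else (0::'a))" for m :: monom
  define L where "L a w = (\<Sum>m\<in>jmons n k. a m * cf (F (e m)) w)" for a :: "'a series" and w
  have "cf (jetm k (F (Mps a))) w = L a w" if a: "a \<in> jpoints n k" and w: "w \<in> jmons n k" for a w
  proof -
    have em: "e m \<in> ser (vars n)" if "m \<in> jmons n k" for m
      using that by (auto simp: e_def jmons_def ser_iff)
    have "F (Mps a) = (\<Sum>m\<in>jmons n k. F (Con (a m) * e m))"
      unfolding jpoint_expansion[OF a] e_def[symmetric]
      by (rule alg_endo_sum[OF E]) (intro mpow_Con_mult em)
    also have "\<dots> = (\<Sum>m\<in>jmons n k. Con (a m) * F (e m))"
      by (intro sum.cong refl alg_endo_simps(3)[OF E] em)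
    finally show ?thesis using w by (simp add: cf_jetm jmons_def L_def)
  qed
  then have "p (L a) = p (cf (jetm k (F (Mps a))))" if "a \<in> jpoints n k" for a
    using that by (intro polyfun_cong_affine[OF p]) auto
  moreover have "(\<lambda>a. p (L a)) \<in> polyfun (jmons n k)"
    unfolding L_def by (intro polyfun_compose[OF p] polyfun_sum polyfun.mult polyfun.const polyfun.coord)
  ultimately show ?thesis by (intro bexI[of _ "\<lambda>a. p (L a)"]) auto
qed

section \<open>Separating the orbits of quadratic forms\<close>

lemma cf_mult_pair:
  assumes V: "finite V" "i \<in> V" "j \<in> V" and f: "f \<in> mpow V (Suc 0)" and g: "g \<in> mpow V (Suc 0)"
  shows "cf (f * g) {#i, j#} = (if i = j then cf f {#i#} * cf g {#i#}
    else cf f {#i#} * cf g {#j#} + cf f {#j#} * cf g {#i#})"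
proof -
  let ?l = "\<Sum>k\<in>V. Con (cf f {#k#}) * X k"
  have "(f - ?l) * g \<in> mpow V (2 + Suc 0)"
    by (intro mpow_mult mpow_linear_part V f g)
  then have "cf ((f - ?l) * g) {#i, j#} = 0" by (rule mpowD) simp
  then have "cf (f * g) {#i, j#} = cf (?l * g) {#i, j#}"
    by (simp add: left_diff_distrib)
  also have "\<dots> = (\<Sum>k\<in>V. cf f {#k#} * cf (X k * g) {#i, j#})"
    by (simp add: sum_distrib_right mult.assoc)
  also have "\<dots> = (\<Sum>k\<in>V. (if k = i then cf f {#i#} * cf g {#j#} else 0)
      + (if k = j \<and> i \<noteq> j then cf f {#j#} * cf g {#i#} else 0))"
    by (rule sum.cong) (auto simp: cf_X_mult add_mset_commute)
  also have "\<dots> = (\<Sum>k\<in>V. if k = i then cf f {#i#} * cf g {#j#} else 0)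
      + (\<Sum>k\<in>V. if k = j \<and> i \<noteq> j then cf f {#j#} * cf g {#i#} else 0)"
    by (rule sum.distrib)
  also have "\<dots> = (if i = j then cf f {#i#} * cf g {#i#}
    else cf f {#i#} * cf g {#j#} + cf f {#j#} * cf g {#i#})"
    using V by (cases "i = j") auto
  finally show ?thesis .
qed

section \<open>Linear part, polar form and quadratic part at a vector\<close>

definition lin_val :: "nat set \<Rightarrow> (nat \<Rightarrow> 'a) \<Rightarrow> 'a::field mps \<Rightarrow> 'a" where
  "lin_val V u f = (\<Sum>l\<in>V. cf f {#l#} * u l)"

text \<open>The polar form of the quadratic part, paired with the \<open>i\<close>-th unit vector
  and \<open>u\<close>. The term \<open>l = i\<close> is left out because the form is alternating:
  that entry would be twice the coefficient of a square.\<close>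

definition polar :: "nat set \<Rightarrow> (nat \<Rightarrow> 'a) \<Rightarrow> nat \<Rightarrow> 'a::field mps \<Rightarrow> 'a" where
  "polar V u i f = (\<Sum>l\<in>V - {i}. cf f {#i, l#} * u l)"

definition quad_val :: "nat set \<Rightarrow> (nat \<Rightarrow> 'a) \<Rightarrow> 'a::field mps \<Rightarrow> 'a" where
  "quad_val V u f = (\<Sum>m\<in>mons V 2. if size m = 2 then cf f m * (\<Prod>i\<in>#m. u i) else 0)"

lemma polar_add: "polar V u i (f + g) = polar V u i f + polar V u i g"
  by (simp add: polar_def distrib_right sum.distrib)

lemma polar_zero: "polar V u i 0 = 0"
  by (simp add: polar_def)

lemma quad_val_zero: "quad_val V u 0 = 0"
  by (simp add: quad_val_def cong: if_cong)

lemma polar_sum: "polar V u i (sum h A) = (\<Sum>k\<in>A. polar V u i (h k))"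
  by (induction A rule: infinite_finite_induct) (auto simp: polar_add polar_zero)

lemma quad_val_add: "quad_val V u (f + g) = quad_val V u f + quad_val V u g"
  unfolding quad_val_def sum.distrib[symmetric] by (rule sum.cong) (auto simp: distrib_right)

lemma quad_val_sum: "quad_val V u (sum h A) = (\<Sum>k\<in>A. quad_val V u (h k))"
  by (induction A rule: infinite_finite_induct) (auto simp: quad_val_add quad_val_zero)

text \<open>The missing term \<open>l = i\<close> would be a doubled product, that is zero, so it
  can be added to complete the two sums over all variables.\<close>

lemma polar_mult:
  fixes f g :: "'a::field mps"
  assumes char: "CHAR('a) = 2" and V: "finite V" "i \<in> V"
    and f: "f \<in> mpow V (Suc 0)" and g: "g \<in> mpow V (Suc 0)"
  shows "polar V u i (f * g) = cf f {#i#} * lin_val V u g + cf g {#i#} * lin_val V u f"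
proof -
  let ?h = "\<lambda>l. (cf f {#i#} * cf g {#l#} + cf f {#l#} * cf g {#i#}) * u l"
  have "polar V u i (f * g) = (\<Sum>l\<in>V - {i}. ?h l)"
    unfolding polar_def by (rule sum.cong) (auto simp: cf_mult_pair[OF V _ f g])
  moreover have "?h i = 0"
    using char2_add_self[OF char, of "cf f {#i#} * cf g {#i#}"] by (simp only: mult_zero_left)
  ultimately have "polar V u i (f * g) = (\<Sum>l\<in>V. ?h l)"
    using V by (simp add: sum.remove[of V i])
  also have "\<dots> = cf f {#i#} * lin_val V u g + cf g {#i#} * lin_val V u f"
    by (simp add: lin_val_def sum_distrib_left sum.distrib[symmetric] algebra_simps)
  finally show ?thesis .
qed

lemma mon_subst_line:
  "mon_subst (\<lambda>i. Con (u i) * X p) m = Con (\<Prod>i\<in>#m. u i) * mon_subst (\<lambda>_. X p) m"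
  by (induction m) (auto simp: mon_subst_def Con_simps algebra_simps)

text \<open>Substituting \<open>u i\<close> times one variable \<open>X p\<close> for every
  \<open>X i\<close> turns \<open>quad_val\<close> and \<open>lin_val\<close> into the coefficients
  of the square and the first power of \<open>X p\<close>; substitution is multiplicative.\<close>

lemma quad_val_mult:
  fixes f g :: "'a::field mps"
  assumes V: "finite V" "p \<in> V"
    and f: "f \<in> mpow V (Suc 0)" and g: "g \<in> mpow V (Suc 0)"
  shows "quad_val V u (f * g) = lin_val V u f * lin_val V u g"
proof -
  let ?a = "\<lambda>i. Con (u i) * X p" and ?S = "subst_series V (\<lambda>i. Con (u i) * X p)"
  have a: "?a i \<in> mpow V (Suc 0)" for i
    using V by (intro mpow_Con_mult mpow_X[unfolded One_nat_def]) auto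
  have S: "local_endo V ?S" by (rule local_endo_subst[OF V(1) a])
  have pp: "cf (mon_subst (\<lambda>_. X p :: 'a mps) m) {#p, p#} = (if size m = 2 then 1 else 0)" for m
  proof -
    have "mon_subst (\<lambda>_. X p :: 'a mps) m = X p ^ size m"
      by (induction m) (auto simp: mon_subst_def)
    moreover have "cf (X p ^ k :: 'a mps) w = (if w = replicate_mset k p then 1 else 0)" for k w
    proof (induction k arbitrary: w)
      case (Suc k)
      then show ?case by (auto simp: cf_X_mult) (metis insert_DiffM)+
    qed (simp add: cf_one)
    moreover have "{#p, p#} = replicate_mset k p \<longleftrightarrow> k = 2" for k
      by (metis numeral_2_eq_2 replicate_mset_0 replicate_mset_Suc size_replicate_mset)
    ultimately show ?thesis by simp
  qed
  have quad: "quad_val V u h = cf (?S h) {#p, p#}" for h :: "'a mps"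
    unfolding subst_series_def quad_val_def mps.sel
    by (rule sum.cong) (auto simp: mon_subst_line pp numeral_2_eq_2)
  have lin: "cf (?S h) {#p#} = lin_val V u h" if h: "h \<in> mpow V (Suc 0)" for h :: "'a mps"
  proof -
    have "?S h - (\<Sum>i\<in>V. Con (cf h {#i#}) * ?S (X i)) \<in> mpow V 2"
      by (rule local_endo_linear[OF V(1) S h])
    then have "cf (?S h) {#p#} = cf (\<Sum>i\<in>V. Con (cf h {#i#}) * ?S (X i)) {#p#}"
      by (rule mpow_diffD) simp
    also have "\<dots> = (\<Sum>i\<in>V. cf h {#i#} * u i)"
      unfolding cf_sum using subst_series_X[OF V(1) a] by (intro sum.cong) (auto simp: cf_X)
    finally show ?thesis by (simp add: lin_val_def)
  qed
  have "?S f \<in> mpow V (Suc 0)" "?S g \<in> mpow V (Suc 0)"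
    using local_endo_mpow[OF V(1) S] f g by auto
  then have "cf (?S f * ?S g) {#p, p#} = cf (?S f) {#p#} * cf (?S g) {#p#}"
    by (subst cf_mult_pair[OF V(1) V(2) V(2)]) auto
  then show ?thesis
    by (simp add: quad subst_series_mult[OF V(1) a] lin f g)
qed

lemma quad_val_scale:
  "quad_val V (\<lambda>i. c * u i) f = c\<^sup>2 * quad_val V u f"
proof -
  have "(\<Prod>i\<in>#m. c * u i) = c ^ size m * (\<Prod>i\<in>#m. u i)" for m
    by (induction m) (auto simp: algebra_simps)
  then show ?thesis
    unfolding quad_val_def sum_distrib_left by (intro sum.cong) (auto simp: algebra_simps)
qed

lemma quad_val_cong: "(\<And>m. size m = 2 \<Longrightarrow> cf f m = cf g m) \<Longrightarrow> quad_val V u f = quad_val V u g"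
  unfolding quad_val_def by (rule sum.cong) auto

lemma polar_cong: "(\<And>m. size m = 2 \<Longrightarrow> cf f m = cf g m) \<Longrightarrow> polar V u i f = polar V u i g"
  unfolding polar_def by (rule sum.cong) auto

section \<open>Gram matrices of the polar form and their determinants\<close>

lemma polyfun_det:
  assumes "\<And>i j. i < s \<Longrightarrow> j < s \<Longrightarrow> (\<lambda>a. E a i j) \<in> polyfun I"
  shows "(\<lambda>a. det (mat s s (\<lambda>(i, j). E a i j))) \<in> polyfun I"
proof -
  have "(\<lambda>a. \<Sum>p | p permutes {0..<s}. signof p * (\<Prod>i = 0..<s. E a i (p i))) \<in> polyfun I"
  proof (intro polyfun_sum polyfun.mult polyfun.const polyfun_prod assms)
    fix p i assume "p \<in> {p. p permutes {0..<s}}" "i \<in> {0..<s}"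
    then show "i < s" "p i < s" using permutes_in_image[of p "{0..<s}" i] by auto
  qed
  moreover have "det (mat s s (\<lambda>(i, j). E a i j))
      = (\<Sum>p | p permutes {0..<s}. signof p * (\<Prod>i = 0..<s. E a i (p i)))" for a
    unfolding det_def
    by (auto intro!: sum.cong prod.cong arg_cong2[where f = "(*)"] dest: permutes_in_image[of _ "{0..<s}"])
  ultimately show ?thesis by simp
qed

lemma polyfun_adj:
  assumes E: "\<And>i j. i < s \<Longrightarrow> j < s \<Longrightarrow> (\<lambda>a. E a i j) \<in> polyfun I" and ij: "i < s" "j < s"
  shows "(\<lambda>a. adj_mat (mat s s (\<lambda>(i, j). E a i j)) $$ (i, j)) \<in> polyfun I"
proof -
  define E' where "E' a i' j' = E a (if i' < j then i' else Suc i') (if j' < i then j' else Suc j')" for a i' j'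
  have "adj_mat (mat s s (\<lambda>(i, j). E a i j)) $$ (i, j)
      = (- 1) ^ (j + i) * det (mat (s - 1) (s - 1) (\<lambda>(i', j'). E' a i' j'))" for a
  proof -
    have "mat_delete (mat s s (\<lambda>(i, j). E a i j)) j i = mat (s - 1) (s - 1) (\<lambda>(i', j'). E' a i' j')"
      unfolding mat_delete_def E'_def by (rule eq_matI) auto
    then show ?thesis using ij by (simp add: adj_mat_def cofactor_def)
  qed
  moreover have "(\<lambda>a. (- 1) ^ (j + i) * det (mat (s - 1) (s - 1) (\<lambda>(i', j'). E' a i' j'))) \<in> polyfun I"
    unfolding E'_def using ij by (intro polyfun.mult polyfun.const polyfun_det E) auto
  ultimately show ?thesis by simp
qed

text \<open>Rows and columns are numbered from zero but variables from one, hence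
  \<open>Suc\<close>. The diagonal is zero because the form is alternating.\<close>

definition gram_entry :: "'a::field series \<Rightarrow> nat \<Rightarrow> nat \<Rightarrow> 'a" where
  "gram_entry a i j = (if i = j then 0 else a {#Suc i, Suc j#})"

definition gram :: "nat \<Rightarrow> 'a::field series \<Rightarrow> 'a mat" where
  "gram s a = mat s s (\<lambda>(i, j). gram_entry a i j)"

lemma gram_carrier [simp]: "gram s a \<in> carrier_mat s s"
  by (simp add: gram_def)

lemma polyfun_gram_entry: "s \<le> n \<Longrightarrow> i < s \<Longrightarrow> j < s \<Longrightarrow> (\<lambda>a. gram_entry a i j) \<in> polyfun (jmons n 2)"
  unfolding gram_entry_def
  by (cases "i = j") (auto intro!: polyfun.const polyfun.coord simp: jmons_def)

lemma gram_mult_vec: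
  assumes "i < s"
  shows "(gram s a *\<^sub>v vec s (\<lambda>j. u (Suc j))) $ i = (\<Sum>l\<in>{1..s} - {Suc i}. a {#Suc i, l#} * u l)"
proof -
  have "(gram s a *\<^sub>v vec s (\<lambda>j. u (Suc j))) $ i = (\<Sum>j\<in>{0..<s}. gram_entry a i j * u (Suc j))"
    using assms by (simp add: gram_def scalar_prod_def)
  also have "\<dots> = (\<Sum>j\<in>{0..<s} - {i}. a {#Suc i, Suc j#} * u (Suc j))"
    using assms by (intro sum.mono_neutral_cong_right) (auto simp: gram_entry_def)
  also have "\<dots> = (\<Sum>l\<in>{1..s} - {Suc i}. a {#Suc i, l#} * u l)"
    by (rule sum.reindex_bij_witness[of _ "\<lambda>l. l - 1" Suc]) (auto simp: One_nat_def)
  finally show ?thesis .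
qed

lemma gram_polar:
  assumes "i < s" "s \<le> n" "\<And>l. l \<notin> {1..s} \<Longrightarrow> u l = 0"
  shows "(gram s (cf f) *\<^sub>v vec s (\<lambda>j. u (Suc j))) $ i = polar (vars n) u (Suc i) f"
  unfolding gram_mult_vec[OF assms(1)] polar_def
proof (rule sum.mono_neutral_left)
  show "\<forall>l\<in>vars n - {Suc i} - ({1..s} - {Suc i}). cf f {#Suc i, l#} * u l = 0"
  proof
    fix l assume "l \<in> vars n - {Suc i} - ({1..s} - {Suc i})"
    then have "l \<notin> {1..s}" by blast
    from assms(3)[OF this] show "cf f {#Suc i, l#} * u l = 0" by simp
  qed
qed (use assms(2) in auto)

lemma lin_val_X: "finite V \<Longrightarrow> j \<in> V \<Longrightarrow> lin_val V u (X j) = u j"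
proof -
  assume V: "finite V" "j \<in> V"
  have "lin_val V u (X j) = (\<Sum>l\<in>V. if l = j then u j else 0)"
    unfolding lin_val_def by (rule sum.cong) (auto simp: cf_X)
  then show ?thesis using V by simp
qed

lemma nform_mpow:
  assumes "1 \<le> n"
  shows "nform n r \<in> mpow (vars n) (Suc 0)" "r \<le> n \<Longrightarrow> nform n r \<in> homog (vars n) 2"
proof -
  have sq: "X r * X r \<in> homog (vars n) 2" if "r \<le> n" "odd r"
    using homog_mult[of "X r" "vars n" 1 "X r" 1] homog_X[of r "vars n"] that odd_pos[of r]
    by (simp add: numeral_2_eq_2 One_nat_def)
  show *: "nform n r \<in> homog (vars n) 2" if "r \<le> n"
    using that sq hyp_homog[of "r div 2" n] by (auto simp: nform_def intro!: homog_add)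
  show "nform n r \<in> mpow (vars n) (Suc 0)"
  proof (cases "r \<le> n")
    case True
    then show ?thesis using homogD[OF *] by (auto intro: mpow_mono)
  next
    case False
    then show ?thesis using assms mpow_X[of 1 "vars n"] by (simp add: nform_def)
  qed
qed

lemma nform_ser: "1 \<le> n \<Longrightarrow> nform n r \<in> ser (vars n)"
  using nform_mpow(1) mpow_ser by blast

lemma jetm_nform:
  assumes "1 \<le> n"
  shows "jetm 2 (nform n r) = nform n r"
proof (rule mps_eqI)
  fix m
  show "cf (jetm 2 (nform n r)) m = cf (nform n r) m"
  proof (cases "r \<le> n")
    case True
    then have "cf (nform n r) m = 0 \<or> size m = 2"
      using nform_mpow(2)[OF assms True] unfolding homog_def by blast
    then show ?thesis by (auto simp: cf_jetm)
  next
    case False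
    then show ?thesis by (auto simp: nform_def cf_jetm cf_X)
  qed
qed

lemma hyp_image:
  assumes "alg_auto (vars n) F" "2 * m \<le> n"
  shows "F (hyp m) = (\<Sum>k\<in>{1..m}. F (X (2 * k - 1)) * F (X (2 * k)))"
proof -
  note E = alg_auto_endo[OF assms(1)]
  have X: "X (2 * k - 1) \<in> ser (vars n)" "X (2 * k) \<in> ser (vars n)" if "k \<in> {1..m}" for k
    using that assms(2) by (auto intro!: X_ser)
  have "F (hyp m) = (\<Sum>k\<in>{1..m}. F (X (2 * k - 1) * X (2 * k)))"
    unfolding hyp_def using X by (intro alg_endo_sum[OF E] mpow_mult_left)
  also have "\<dots> = (\<Sum>k\<in>{1..m}. F (X (2 * k - 1)) * F (X (2 * k)))"
    using X by (intro sum.cong refl alg_endoD(4)[OF E])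
  finally show ?thesis .
qed

lemma nform_image:
  assumes "alg_auto (vars n) F" "r \<le> n"
  shows "F (nform n r) = (\<Sum>k\<in>{1..r div 2}. F (X (2 * k - 1)) * F (X (2 * k)))
    + (if odd r then F (X r) * F (X r) else 0)"
proof -
  note E = alg_auto_endo[OF assms(1)]
  have "hyp (r div 2) \<in> ser (vars n)" by (rule hyp_ser) (use assms(2) in linarith)
  then have "F (nform n r) = F (hyp (r div 2)) + F (if odd r then X r * X r else 0)"
    using assms X_ser[of r "vars n"] odd_pos[of r]
    unfolding nform_def by (auto simp: alg_endo_simps[OF E] intro!: alg_endoD(3)[OF E] mpow_mult_left)
  also have "F (hyp (r div 2)) = (\<Sum>k\<in>{1..r div 2}. F (X (2 * k - 1)) * F (X (2 * k)))"
    by (rule hyp_image[OF assms(1)]) (use assms(2) in linarith)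
  also have "F (if odd r then X r * X r else 0) = (if odd r then F (X r) * F (X r) else 0)"
  proof (cases "odd r")
    case True
    then have "X r \<in> ser (vars n)" using assms(2) odd_pos[of r] by (intro X_ser) auto
    from alg_endoD(4)[OF E this this] True show ?thesis by simp
  qed (simp add: alg_endo_simps[OF E])
  finally show ?thesis .
qed

text \<open>\<open>F (nform n r)\<close> is a quadratic expression in the \<open>r\<close> series
  \<open>F (X i)\<close>. More than \<open>r\<close> coordinates leave a nonzero vector on which all
  their linear parts vanish; it is then in the radical and a zero of the quadratic form.\<close>

lemma orbit_kernel:
  fixes F :: "'a::field mps \<Rightarrow> 'a mps"
  assumes char: "CHAR('a) = 2" and F: "alg_auto (vars n) F" and r: "r < s" "s \<le> n"
  obtains u where "\<And>l. l \<notin> {1..s} \<Longrightarrow> u l = 0" "\<exists>l. u l \<noteq> 0"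
    "\<And>i. i \<in> vars n \<Longrightarrow> polar (vars n) u i (jetm 2 (F (nform n r))) = 0"
    "quad_val (vars n) u (jetm 2 (F (nform n r))) = 0"
proof -
  define A where "A i = F (X i)" for i
  have A: "A i \<in> mpow (vars n) (Suc 0)" if "i \<in> vars n" for i
    using that alg_auto_local[OF F] by (simp add: A_def local_endo_def)
  \<comment> \<open>The \<open>r\<close> equations are padded with zero rows to a square matrix,
    whose determinant is zero because \<open>r < s\<close>.\<close>
  define M where "M = mat s s (\<lambda>(i, j). if i < r then cf (A (Suc i)) {#Suc j#} else 0)"
  have M: "M \<in> carrier_mat s s" by (simp add: M_def)
  have "det M = 0"
  proof -
    have "M = mat\<^sub>r s s (\<lambda>i. if i = r then 0\<^sub>v s else row M i)"
      by (rule eq_matI) (auto simp: M_def)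
    then show ?thesis
      using det_row_0[of r s "row M"] r(1) M by auto
  qed
  then obtain v where v: "v \<in> carrier_vec s" "v \<noteq> 0\<^sub>v s" "M *\<^sub>v v = 0\<^sub>v s"
    using det_0_iff_vec_prod_zero[OF M] by blast
  define u where "u l = (if l \<in> {1..s} then v $ (l - 1) else 0)" for l
  have u0: "u l = 0" if "l \<notin> {1..s}" for l using that by (auto simp: u_def)
  obtain j where "j < s" "v $ j \<noteq> 0"
    using v(1,2) by (metis carrier_vecD eq_vecI index_zero_vec(1) index_zero_vec(2))
  then have "u (Suc j) \<noteq> 0" by (simp add: u_def)
  have lin: "lin_val (vars n) u (A i) = 0" if i: "i \<in> {1..r}" for i
  proof -
    have "lin_val (vars n) u (A i) = (\<Sum>l\<in>{1..s}. cf (A i) {#l#} * u l)"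
      unfolding lin_val_def using r u0 by (intro sum.mono_neutral_right) auto
    also have "\<dots> = (\<Sum>j\<in>{0..<s}. cf (A i) {#Suc j#} * v $ j)"
      by (rule sum.reindex_bij_witness[of _ Suc "\<lambda>l. l - 1"]) (auto simp: u_def One_nat_def)
    also have "\<dots> = (M *\<^sub>v v) $ (i - 1)"
    proof -
      have "i - 1 < r" "i - 1 < s" "Suc (i - 1) = i" using i r(1) by auto
      then show ?thesis using v(1) by (simp add: M_def scalar_prod_def)
    qed
    also have "\<dots> = 0"
    proof -
      have "i - 1 < s" using i r(1) by auto
      then show ?thesis by (simp add: v(3))
    qed
    finally show ?thesis .
  qed
  have rn: "r \<le> n" using r by simp
  have pair: "2 * k - 1 \<in> {1..r}" "2 * k \<in> {1..r}" if "k \<in> {1..r div 2}" for k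
    using that by auto
  have sub: "i \<in> vars n" if "i \<in> {1..r}" for i using that rn by auto
  have sq: "r \<in> {1..r}" if "odd r" using that odd_pos by (auto simp: Suc_le_eq One_nat_def)
  let ?f = "F (nform n r)"
  have "polar (vars n) u i ?f = 0" if i: "i \<in> vars n" for i
    unfolding nform_image[OF F rn] A_def[symmetric] polar_add polar_sum
    using lin pair sub sq A by (auto simp: polar_mult[OF char _ i] polar_zero)
  moreover have "quad_val (vars n) u ?f = 0"
  proof -
    have one: "1 \<in> vars n" using r by auto
    show ?thesis
      unfolding nform_image[OF F rn] A_def[symmetric] quad_val_add quad_val_sum
      using lin pair sub sq A by (auto simp: quad_val_mult[OF _ one] quad_val_zero)
  qed
  moreover have "cf (jetm 2 ?f) m = cf ?f m" if "size m = 2" for m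
    using that by (simp add: cf_jetm)
  ultimately show thesis
    using that[of u] u0 \<open>u (Suc j) \<noteq> 0\<close> polar_cong[of "jetm 2 ?f" ?f] quad_val_cong[of "jetm 2 ?f" ?f]
    by metis
qed

lemma polar_hyp:
  assumes char: "CHAR('a::field) = 2" and m: "2 * m \<le> n" and k: "k \<in> {1..m}"
  shows "polar (vars n) u (2 * k - 1) (hyp m :: 'a mps) = u (2 * k)"
    "polar (vars n) u (2 * k) (hyp m :: 'a mps) = u (2 * k - 1)"
proof -
  have *: "polar (vars n) u i (hyp m :: 'a mps)
      = (\<Sum>k\<in>{1..m}. (if i = 2 * k - 1 then u (2 * k) else 0) + (if i = 2 * k then u (2 * k - 1) else 0))"
    if "i \<in> vars n" for i
    unfolding hyp_def polar_sum
  proof (rule sum.cong[OF refl])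
    fix k assume "k \<in> {1..m}"
    then have k: "2 * k - 1 \<in> vars n" "2 * k \<in> vars n" using m by auto
    show "polar (vars n) u i (X (2 * k - 1) * X (2 * k))
        = (if i = 2 * k - 1 then u (2 * k) else 0) + (if i = 2 * k then u (2 * k - 1) else 0)"
      using k mpow_X[OF k(1)] mpow_X[OF k(2)] that
      by (subst polar_mult[OF char _ that]) (auto simp: cf_X lin_val_X)
  qed
  have i: "2 * k - 1 \<in> vars n" "2 * k \<in> vars n" using k m by auto
  have e: "(2 * k - 1 = 2 * k' - 1) = (k' = k)" "(2 * k - 1 = 2 * k') = False"
    "(2 * k = 2 * k' - 1) = False" "(2 * k = 2 * k') = (k' = k)" if "k' \<in> {1..m}" for k'
    using k that unfolding atLeastAtMost_iff by presburger+
  have "(\<Sum>k'\<in>{1..m}. (if 2 * k - 1 = 2 * k' - 1 then u (2 * k') else 0) + (if 2 * k - 1 = 2 * k' then u (2 * k' - 1) else 0))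
    = (\<Sum>k'\<in>{1..m}. if k' = k then u (2 * k) else 0)"
    by (rule sum.cong[OF refl]) (simp only: e, simp)
  then show "polar (vars n) u (2 * k - 1) (hyp m :: 'a mps) = u (2 * k)"
    unfolding *[OF i(1)] using k by simp
  have "(\<Sum>k'\<in>{1..m}. (if 2 * k = 2 * k' - 1 then u (2 * k') else 0) + (if 2 * k = 2 * k' then u (2 * k' - 1) else 0))
    = (\<Sum>k'\<in>{1..m}. if k' = k then u (2 * k - 1) else 0)"
    by (rule sum.cong[OF refl]) (simp only: e, simp)
  then show "polar (vars n) u (2 * k) (hyp m :: 'a mps) = u (2 * k - 1)"
    unfolding *[OF i(2)] using k by simp
qed

lemma polar_square:
  assumes char: "CHAR('a::field) = 2" and "finite V" "i \<in> V" "f \<in> mpow V (Suc 0)"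
  shows "polar V u i (f * f :: 'a mps) = 0"
  using assms by (subst polar_mult[OF char]) (auto simp: char2_add_self)

text \<open>A possible final square has no polar form, and the polar form of the hyperbolic part
  just exchanges partners; so a kernel vector of the Gram matrix has all coordinates zero.\<close>

lemma det_gram_nform:
  assumes char: "CHAR('a::field) = 2" and r: "r div 2 = m" "r \<le> n"
  shows "det (gram (2 * m) (cf (nform n r :: 'a mps))) \<noteq> 0"
proof
  let ?s = "2 * m" and ?f = "nform n r :: 'a mps"
  assume "det (gram ?s (cf ?f)) = 0"
  then obtain v where v: "v \<in> carrier_vec ?s" "v \<noteq> 0\<^sub>v ?s" "gram ?s (cf ?f) *\<^sub>v v = 0\<^sub>v ?s"
    using det_0_iff_vec_prod_zero[of "gram ?s (cf ?f)" ?s] by auto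
  have s: "?s \<le> n" using r by auto
  define u where "u l = (if l \<in> {1..?s} then v $ (l - 1) else 0)" for l
  have u0: "u l = 0" if "l \<notin> {1..?s}" for l using that by (auto simp: u_def)
  have vu: "v = vec ?s (\<lambda>j. u (Suc j))"
    using v(1) by (intro eq_vecI) (auto simp: u_def)
  have "polar (vars n) u i ?f = 0" if "i \<in> {1..?s}" for i
  proof -
    have "i - 1 < ?s" "Suc (i - 1) = i" using that by auto
    then show ?thesis using gram_polar[of "i - 1" ?s n u ?f] s u0 v(3) vu by auto
  qed
  moreover have "polar (vars n) u i ?f = polar (vars n) u i (hyp m :: 'a mps)" if "i \<in> {1..?s}" for i
  proof -
    have "i \<in> vars n" using that s by auto
    moreover have "X r \<in> mpow (vars n) (Suc 0)" if "odd r"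
      using that r(2) odd_pos[of r] by (intro mpow_X) auto
    ultimately have "polar (vars n) u i (if odd r then X r * X r else 0 :: 'a mps) = 0"
      by (auto simp: polar_zero intro!: polar_square[OF char])
    then show ?thesis using r by (simp add: nform_def polar_add)
  qed
  ultimately have p: "polar (vars n) u i (hyp m :: 'a mps) = 0" if "i \<in> {1..?s}" for i
    using that by simp
  have "u l = 0" for l
  proof (cases "l \<in> {1..?s}")
    case True
    show ?thesis
    proof (cases "even l")
      case True
      then obtain k where k: "l = 2 * k" by (elim evenE)
      with \<open>l \<in> {1..?s}\<close> have "k \<in> {1..m}" "2 * k - 1 \<in> {1..?s}"
        unfolding atLeastAtMost_iff by presburger+
      with polar_hyp(1)[OF char s, of k u] p k show ?thesis by simp
    next
      case False
      define k where "k = (l + 1) div 2"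
      have k: "l = 2 * k - 1" "k \<in> {1..m}" "2 * k \<in> {1..?s}"
        using False \<open>l \<in> {1..?s}\<close> unfolding k_def atLeastAtMost_iff by presburger+
      with polar_hyp(2)[OF char s, of k u] p show ?thesis by simp
    qed
  qed (rule u0)
  then have "v = 0\<^sub>v ?s" by (subst vu) (auto intro: eq_vecI)
  with v(2) show False by simp
qed


lemma polyfun_quad_val:
  assumes "\<And>i. i \<in> vars n \<Longrightarrow> (\<lambda>a. w a i) \<in> polyfun (jmons n 2)"
  shows "(\<lambda>a. quad_val (vars n) (w a) (Mps a)) \<in> polyfun (jmons n 2)"
proof -
  have "(\<lambda>a. if size m = 2 then a m * (\<Prod>i\<in>#m. w a i) else 0) \<in> polyfun (jmons n 2)"
    if "m \<in> mons (vars n) 2" for m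
  proof (cases "size m = 2")
    case True
    then have "(\<lambda>a. a m * (\<Prod>i\<in>#m. w a i)) \<in> polyfun (jmons n 2)"
      using that by (intro polyfun.mult polyfun.coord polyfun_prod_mset assms) (auto simp: jmons_def mons_iff)
    with True show ?thesis by simp
  qed (simp add: polyfun.const)
  then show ?thesis unfolding quad_val_def mps.sel by (rule polyfun_sum)
qed

lemma gram_kernel:
  fixes u :: "nat \<Rightarrow> 'a::field"
  assumes s: "s \<le> n" and u: "\<And>l. l \<notin> {1..s} \<Longrightarrow> u l = 0" "\<exists>l. u l \<noteq> 0"
    and polar: "\<And>i. i \<in> vars n \<Longrightarrow> polar (vars n) u i (Mps a) = 0"
  shows "det (gram s a) = 0"
proof -
  let ?v = "vec s (\<lambda>j. u (Suc j))"
  obtain l where l: "u l \<noteq> 0" "l \<in> {1..s}" using u by blast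
  then have l': "l - 1 < s" "Suc (l - 1) = l" by auto
  then have "?v $ (l - 1) \<noteq> 0\<^sub>v s $ (l - 1)" using l(1) by simp
  then have "?v \<noteq> 0\<^sub>v s" by metis
  moreover have "gram s a *\<^sub>v ?v = 0\<^sub>v s"
  proof (rule eq_vecI)
    fix i assume "i < dim_vec (0\<^sub>v s :: 'a vec)"
    then have i: "i < s" "Suc i \<in> vars n" using s by auto
    show "(gram s a *\<^sub>v ?v) $ i = 0\<^sub>v s $ i"
      using gram_polar[of i s n u "Mps a"] s u(1) polar[OF i(2)] i by simp
  qed (simp add: gram_def)
  ultimately show ?thesis
    using det_0_iff_vec_prod_zero[OF gram_carrier] vec_carrier by blast
qed

text \<open>
  The vector spanning the radical of the restriction to \<open>2 * m + 1\<close> variables, by Cramer's rule; it is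
  polynomial in the coefficients.
\<close>

definition radical_vec :: "nat \<Rightarrow> 'a::field series \<Rightarrow> nat \<Rightarrow> 'a" where
  "radical_vec t a l = (if l \<in> {1..t}
     then \<Sum>j\<in>{0..<t}. adj_mat (gram t a) $$ (l - 1, j) * a {#Suc j, Suc t#}
     else if l = Suc t then det (gram t a) else 0)"

text \<open>The first \<open>t\<close> radical conditions form a linear system with matrix
  \<open>gram t a\<close>; multiplying by the adjugate solves it, and signs are irrelevant in
  characteristic two. Where the determinant is nonzero, every such \<open>u\<close> is a multiple of
  \<open>radical_vec t a\<close>.\<close>

lemma radical_vec_kernel:
  fixes u :: "nat \<Rightarrow> 'a::field"
  assumes char: "CHAR('a) = 2" and s: "Suc t \<le> n" and u: "\<And>l. l \<notin> {1..Suc t} \<Longrightarrow> u l = 0"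
    and polar: "\<And>i. i \<in> vars n \<Longrightarrow> polar (vars n) u i (Mps a) = 0"
  shows "det (gram t a) * u l = u (Suc t) * radical_vec t a l"
proof -
  let ?B = "gram t a" and ?v = "vec t (\<lambda>j. u (Suc j))" and ?b = "\<lambda>j. a {#Suc j, Suc t#}"
  have Bv: "(?B *\<^sub>v ?v) $ i = u (Suc t) * ?b i" if i: "i < t" for i
  proof -
    have "polar (vars n) u (Suc i) (Mps a) = (\<Sum>l\<in>{1..Suc t} - {Suc i}. a {#Suc i, l#} * u l)"
      using gram_polar[of i "Suc t" n u "Mps a"] gram_mult_vec[of i "Suc t" a u] i s u by simp
    also have "{1..Suc t} - {Suc i} = insert (Suc t) ({1..t} - {Suc i})"
      using i by auto
    also have "(\<Sum>l\<in>insert (Suc t) ({1..t} - {Suc i}). a {#Suc i, l#} * u l)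
        = ?b i * u (Suc t) + (?B *\<^sub>v ?v) $ i"
      by (subst sum.insert) (auto simp: gram_mult_vec[OF i])
    finally have "(?B *\<^sub>v ?v) $ i + u (Suc t) * ?b i = 0"
      using polar[of "Suc i"] i s by (simp add: algebra_simps)
    then show ?thesis by (metis add_eq_0_iff char2_uminus(1)[OF char])
  qed
  have "det ?B * u l = u (Suc t) * radical_vec t a l" if l: "l \<in> {1..t}"
  proof -
    have l': "l - 1 < t" "Suc (l - 1) = l" using l by auto
    have "adj_mat ?B *\<^sub>v (?B *\<^sub>v ?v) = (adj_mat ?B * ?B) *\<^sub>v ?v"
      by (rule assoc_mult_mat_vec[OF adj_mat(1)[OF gram_carrier] gram_carrier, symmetric]) auto
    also have "\<dots> = det ?B \<cdot>\<^sub>v ?v"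
      by (subst adj_mat(3)[OF gram_carrier]) (auto intro!: eq_vecI)
    finally have "(adj_mat ?B *\<^sub>v (?B *\<^sub>v ?v)) $ (l - 1) = det ?B * u l"
      using l' by simp
    moreover have "(adj_mat ?B *\<^sub>v (?B *\<^sub>v ?v)) $ (l - 1)
        = (\<Sum>j\<in>{0..<t}. adj_mat ?B $$ (l - 1, j) * (?B *\<^sub>v ?v) $ j)"
      using l' adj_mat(1)[OF gram_carrier, of t a]
      by (simp add: scalar_prod_def gram_def del: index_mult_mat_vec) (simp add: scalar_prod_def gram_def)
    moreover have "\<dots> = (\<Sum>j\<in>{0..<t}. adj_mat ?B $$ (l - 1, j) * (u (Suc t) * ?b j))"
      by (rule sum.cong) (auto simp: Bv)
    ultimately show ?thesis
      using l by (simp add: radical_vec_def sum_distrib_left mult.left_commute)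
  qed
  moreover have "det ?B * u l = u (Suc t) * radical_vec t a l" if "l \<notin> {1..t}"
    using that u[of l] by (cases "l = Suc t") (auto simp: radical_vec_def)
  ultimately show ?thesis by blast
qed

lemma polyfun_radical_vec:
  assumes "Suc t \<le> n"
  shows "(\<lambda>a :: 'a::field series. radical_vec t a l) \<in> polyfun (jmons n 2)"
proof -
  have g: "(\<lambda>a. gram_entry a i j) \<in> polyfun (jmons n 2)" if "i < t" "j < t" for i j
    using assms that by (intro polyfun_gram_entry) auto
  consider "l \<in> {1..t}" | "l = Suc t" | "l \<notin> {1..t}" "l \<noteq> Suc t" by blast
  then show ?thesis
  proof cases
    case 1
    then have "(\<lambda>a. \<Sum>j\<in>{0..<t}. adj_mat (gram t a) $$ (l - 1, j) * a {#Suc j, Suc t#}) \<in> polyfun (jmons n 2)"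
      using assms unfolding gram_def
      by (intro polyfun_sum polyfun.mult polyfun.coord polyfun_adj g) (auto simp: jmons_def)
    with 1 show ?thesis by (simp add: radical_vec_def)
  next
    case 2
    then show ?thesis
      using polyfun_det[of t gram_entry, OF g] by (simp add: radical_vec_def gram_def)
  next
    case 3
    then have "radical_vec t a l = 0" for a :: "'a series" by (simp only: radical_vec_def if_False)
    then show ?thesis by (simp add: polyfun.const)
  qed
qed

text \<open>The variable \<open>2 * m + 1\<close> occurs in the representative only through its
  square, so the radical vector is the determinant times the last unit vector.\<close>

lemma quad_val_nform_odd:
  assumes char: "CHAR('a::field) = 2" and t: "2 * m + 1 \<le> n"
  shows "quad_val (vars n) (radical_vec (2 * m) (cf (nform n (2 * m + 1)))) (nform n (2 * m + 1) :: 'a mps)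
    = (det (gram (2 * m) (cf (nform n (2 * m + 1) :: 'a mps))))\<^sup>2"
proof -
  let ?t = "2 * m" and ?f = "nform n (2 * m + 1) :: 'a mps"
  let ?w = "radical_vec ?t (cf ?f)"
  have f: "?f = hyp m + X (2 * m + 1) * X (2 * m + 1)" by (rule nform_odd[OF t])
  have "cf ?f {#Suc j, Suc ?t#} = 0" if "j < ?t" for j
  proof -
    have "cf (hyp m :: 'a mps) {#Suc j, Suc ?t#} = 0"
      using hyp_homog[of m ?t, where 'a = 'a] unfolding homog_def by fastforce
    then show ?thesis using that by (simp add: f cf_X_mult cf_X)
  qed
  then have w0: "?w l = 0" if "l \<noteq> Suc ?t" for l
    using that by (auto simp: radical_vec_def)
  have one: "2 * m + 1 \<in> vars n" using t by auto
  have "quad_val (vars n) ?w (hyp m :: 'a mps) = 0"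
    unfolding hyp_def quad_val_sum
  proof (rule sum.neutral, rule ballI)
    fix k assume "k \<in> {1..m}"
    then have k: "2 * k - 1 \<in> vars n" "2 * k \<in> vars n" "2 * k \<noteq> Suc ?t" using t by (auto, presburger?)
    then show "quad_val (vars n) ?w (X (2 * k - 1) * X (2 * k) :: 'a mps) = 0"
      using mpow_X[OF k(1), where 'a = 'a] mpow_X[OF k(2), where 'a = 'a]
      by (simp add: quad_val_mult[OF _ one] lin_val_X w0)
  qed
  moreover have "quad_val (vars n) ?w (X (2 * m + 1) * X (2 * m + 1) :: 'a mps) = (?w (Suc ?t))\<^sup>2"
    using mpow_X[OF one, where 'a = 'a] one by (simp add: quad_val_mult[OF _ one] lin_val_X power2_eq_square Suc_eq_plus1)
  ultimately show ?thesis
    by (simp add: f quad_val_add) (simp add: radical_vec_def)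
qed

text \<open>In characteristic two the polar form alone does not separate the orbits: for odd
  \<open>s\<close> the representatives for \<open>s\<close> and \<open>s - 1\<close> have the same
  one, and differ in the value of the quadratic form on the radical. So \<open>P\<close> is a Gram
  determinant for even \<open>s\<close> and also contains that value for odd \<open>s\<close>; a
  linear coefficient detects the orbit of \<open>X 1\<close>.\<close>

lemma orbit_separation:
  assumes char: "CHAR('a::field) = 2" and n: "1 \<le> n" and s: "s \<le> n + 1"
  shows "\<exists>P\<in>polyfun (jmons n 2). P (cf (nform n s :: 'a mps)) \<noteq> 0 \<and>
    (\<forall>r<s. \<forall>F. alg_auto (vars n) F \<longrightarrow> P (cf (jetm 2 (F (nform n r)))) = 0)"
proof -
  consider "s = n + 1" | "s \<le> n" "even s" | "s \<le> n" "odd s" using s by linarith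
  then show ?thesis
  proof cases
    case 1
    have "cf (jetm 2 (F (nform n r))) {#1#} = 0" if "r < s" "alg_auto (vars n) F" for r and F :: "'a mps \<Rightarrow> 'a mps"
    proof -
      have "nform n r \<in> mpow (vars n) 2" using nform_mpow(2)[OF n, of r] that(1) 1 homogD by auto
      from alg_auto_mpow[OF _ that(2) this] have "cf (F (nform n r)) {#1#} = 0" by (intro mpowD) auto
      then show ?thesis by (simp add: cf_jetm)
    qed
    then show ?thesis
      using 1 n by (intro bexI[of _ "\<lambda>a. a {#1#}"]) (auto simp: nform_def cf_X jmons_def intro: polyfun.coord)
  next
    case 2
    have "det (gram s (cf (jetm 2 (F (nform n r))))) = 0"
      if r: "r < s" and F: "alg_auto (vars n) F" for r and F :: "'a mps \<Rightarrow> 'a mps"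
    proof (rule orbit_kernel[OF char F r 2(1)])
      fix u :: "nat \<Rightarrow> 'a"
      assume "\<And>l. l \<notin> {1..s} \<Longrightarrow> u l = 0" "\<exists>l. u l \<noteq> 0"
        "\<And>i. i \<in> vars n \<Longrightarrow> polar (vars n) u i (jetm 2 (F (nform n r))) = 0"
      then show ?thesis by (intro gram_kernel[OF 2(1), of u]) auto
    qed
    moreover have "(\<lambda>a. det (gram s a)) \<in> polyfun (jmons n 2)"
      unfolding gram_def using 2(1) by (intro polyfun_det polyfun_gram_entry)
    moreover have "det (gram s (cf (nform n s :: 'a mps))) \<noteq> 0"
      using det_gram_nform[OF char, of s "s div 2" n] 2 by simp
    ultimately show ?thesis by (intro bexI[of _ "\<lambda>a. det (gram s a)"]) auto
  next
    case 3
    then obtain m where m: "s = 2 * m + 1" by (elim oddE)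
    \<comment> \<open>The determinant as a factor makes \<open>?P\<close> vanish where Cramer's rule
      gives no information; elsewhere the radical vector is proportional to the vector from
      \<open>orbit_kernel\<close>.\<close>
    let ?P = "\<lambda>a. det (gram (2 * m) a) * quad_val (vars n) (radical_vec (2 * m) a) (Mps a :: 'a mps)"
    have sm: "s = Suc (2 * m)" "Suc (2 * m) \<le> n" using 3 m by auto
    have "?P (cf (jetm 2 (F (nform n r)))) = 0"
      if r: "r < s" and F: "alg_auto (vars n) F" for r and F :: "'a mps \<Rightarrow> 'a mps"
    proof (rule orbit_kernel[OF char F r 3(1)])
      let ?a = "cf (jetm 2 (F (nform n r)))"
      let ?d = "det (gram (2 * m) ?a)"
      fix u :: "nat \<Rightarrow> 'a"
      assume u: "\<And>l. l \<notin> {1..s} \<Longrightarrow> u l = 0" "\<exists>l. u l \<noteq> 0"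
        and p: "\<And>i. i \<in> vars n \<Longrightarrow> polar (vars n) u i (jetm 2 (F (nform n r))) = 0"
        and q: "quad_val (vars n) u (jetm 2 (F (nform n r))) = 0"
      have k: "?d * u l = u s * radical_vec (2 * m) ?a l" for l
        using radical_vec_kernel[OF char sm(2), of u ?a l] u(1) p sm(1) by auto
      show ?thesis
      proof (cases "?d = 0")
        case False
        \<comment> \<open>Otherwise all coordinates would vanish by \<open>k\<close>, since the
          determinant is nonzero.\<close>
        have "u s \<noteq> 0"
        proof
          assume "u s = 0"
          then have "u l = 0" for l using k[of l] False by simp
          with u(2) show False by blast
        qed
        then have "radical_vec (2 * m) ?a = (\<lambda>l. ?d / u s * u l)"
          using k by (auto simp: field_simps)
        then have "quad_val (vars n) (radical_vec (2 * m) ?a) (Mps ?a) = (?d / u s)\<^sup>2 * quad_val (vars n) u (Mps ?a)"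
          by (simp only: quad_val_scale)
        with q show ?thesis by simp
      qed simp
    qed
    moreover have "?P \<in> polyfun (jmons n 2)"
    proof (rule polyfun.mult)
      show "(\<lambda>a. det (gram (2 * m) a)) \<in> polyfun (jmons n 2)"
        unfolding gram_def using sm(2) by (intro polyfun_det polyfun_gram_entry) auto
      show "(\<lambda>a. quad_val (vars n) (radical_vec (2 * m) a) (Mps a :: 'a mps)) \<in> polyfun (jmons n 2)"
        by (intro polyfun_quad_val polyfun_radical_vec sm(2))
    qed
    moreover have "?P (cf (nform n s :: 'a mps)) \<noteq> 0"
      using quad_val_nform_odd[OF char, of m n] det_gram_nform[OF char, of s m n] 3(1) m by simp
    ultimately show ?thesis by (intro bexI[of _ ?P]) auto
  qed
qed

section \<open>The orbits of 2-jets\<close>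

definition jet_orbit :: "nat \<Rightarrow> nat \<Rightarrow> 'a::field series set" where
  "jet_orbit n r = {cf (jetm 2 (F (nform n r))) | F. alg_auto (vars n) F}"

lemma jet_orbitI: "alg_auto (vars n) F \<Longrightarrow> a = cf (jetm 2 (F (nform n r))) \<Longrightarrow> a \<in> jet_orbit n r"
  by (auto simp: jet_orbit_def)

lemma jet_orbitE:
  assumes "a \<in> jet_orbit n r"
  obtains F where "alg_auto (vars n) F" "a = cf (jetm 2 (F (nform n r)))"
  using assms by (auto simp: jet_orbit_def)

lemma jet_orbit_jpoints:
  assumes "1 \<le> n"
  shows "jet_orbit n r \<subseteq> jpoints n 2"
proof
  fix a assume "a \<in> jet_orbit n r"
  then obtain F where F: "alg_auto (vars n) F" "a = cf (jetm 2 (F (nform n r)))"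
    by (rule jet_orbitE)
  show "a \<in> jpoints n 2"
    unfolding F(2) by (rule jetm_jpoints[OF alg_auto_mpow[OF _ F(1) nform_mpow(1)[OF assms]]]) simp
qed

lemma nform_jet_orbit: "1 \<le> n \<Longrightarrow> cf (nform n r) \<in> jet_orbit n r"
  by (rule jet_orbitI[OF alg_auto_id]) (simp add: jetm_nform)

lemma jetm_idem: "jetm k (jetm k f) = jetm k f"
  by (rule mps_eqI) (simp add: cf_jetm)

lemma jet_orbit_auto:
  assumes "1 \<le> n" "a \<in> jet_orbit n r" "alg_auto (vars n) F"
  shows "cf (jetm 2 (F (Mps a))) \<in> jet_orbit n r"
proof -
  obtain G where G: "alg_auto (vars n) G" "a = cf (jetm 2 (G (nform n r)))"
    using assms(2) by (rule jet_orbitE)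
  have s: "G (nform n r) \<in> ser (vars n)"
    using alg_endoD(1)[OF alg_auto_endo[OF G(1)] nform_ser[OF assms(1)]] .
  have "jetm 2 (F (Mps a)) = jetm 2 (F (G (nform n r)))"
    using G(2) by (intro jetm_auto[OF _ assms(3) _ s]) (auto simp: jetm_idem jetm_ser[OF s])
  then show ?thesis
    by (intro jet_orbitI[OF alg_auto_comp[OF assms(3) G(1)]]) simp
qed

lemma jet_orbit_to_nform:
  assumes "1 \<le> n" "f \<in> ser (vars n)" "cf (jetm 2 f) \<in> jet_orbit n r"
  obtains F where "alg_auto (vars n) F" "jetm 2 (F f) = nform n r"
proof -
  obtain G where G: "alg_auto (vars n) G" "cf (jetm 2 f) = cf (jetm 2 (G (nform n r)))"
    using assms(3) by (rule jet_orbitE)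
  obtain F where F: "alg_auto (vars n) F" "\<And>f. f \<in> ser (vars n) \<Longrightarrow> F (G f) = f"
    using alg_auto_inv[OF G(1)] by metis
  note s = nform_ser[OF assms(1), of r]
  have "jetm 2 f = jetm 2 (G (nform n r))" using G(2) by (intro mps_eqI) simp
  then have "jetm 2 (F f) = jetm 2 (F (G (nform n r)))"
    using alg_endoD(1)[OF alg_auto_endo[OF G(1)] s] by (intro jetm_auto[OF _ F(1) assms(2)]) auto
  then show thesis using that[OF F(1)] by (simp add: F(2)[OF s] jetm_nform[OF assms(1)])
qed

lemma jet_orbit_transitive:
  assumes n: "1 \<le> n" and "a \<in> jet_orbit n r" "b \<in> jet_orbit n r"
  shows "\<exists>F. alg_auto (vars n) F \<and> b = cf (jetm 2 (F (Mps a)))"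
proof -
  have "a \<in> jpoints n 2" using assms(2) by (rule subsetD[OF jet_orbit_jpoints[OF n]])
  then have a: "Mps a \<in> ser (vars n)" "jetm 2 (Mps a) = Mps a"
    unfolding jpoints_iff by (auto intro: mpow_ser)
  obtain F where F: "alg_auto (vars n) F" "jetm 2 (F (Mps a)) = nform n r"
    using jet_orbit_to_nform[OF n a(1), of r] a(2) assms(2) by auto
  obtain G where G: "alg_auto (vars n) G" "b = cf (jetm 2 (G (nform n r)))"
    using assms(3) by (rule jet_orbitE)
  note s = alg_endoD(1)[OF alg_auto_endo[OF F(1)] a(1)]
  have "jetm 2 (G (F (Mps a))) = jetm 2 (G (nform n r))"
    by (intro jetm_auto[OF _ G(1) s nform_ser[OF n]]) (simp_all add: F(2) jetm_nform[OF n])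
  then show ?thesis
    using G(2) by (intro exI[of _ "G \<circ> F"]) (auto intro: alg_auto_comp[OF G(1) F(1)])
qed

lemma req_jet_orbit:
  assumes "a \<in> jpoints n 2" "req (vars n) (Mps a) (nform n r)"
  shows "a \<in> jet_orbit n r"
proof -
  obtain F where F: "alg_auto (vars n) F" "Mps a = F (nform n r)"
    using req_sym[OF assms(2)] by (auto simp: req_def)
  have "a = cf (Mps a)" by simp
  also have "Mps a = jetm 2 (F (nform n r))" using assms(1) F(2) by (simp add: jpoints_iff)
  finally show ?thesis by (rule jet_orbitI[OF F(1)])
qed

lemma two_jet_classification:
  fixes a :: "'a::alg_closed_field series"
  assumes char: "CHAR('a) = 2" and n: "1 \<le> n" and a: "a \<in> jpoints n 2"
  shows "\<exists>r\<le>n + 1. req (vars n) (Mps a) (nform n r)"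
proof (cases "\<exists>p\<in>vars n. a {#p#} \<noteq> 0")
  case True
  then obtain p where p: "p \<in> vars n" "a {#p#} \<noteq> 0" by blast
  have "req (vars n) (Mps a) (X p)"
    using a p by (intro submersion_req) (auto simp: jpoints_iff)
  moreover have "req (vars n) (X p) (X 1 :: 'a mps)"
    using p n by (intro req_X) auto
  ultimately have "req (vars n) (Mps a) (X 1)" by (rule req_trans)
  then show ?thesis by (intro exI[of _ "n + 1"]) (simp add: nform_def)
next
  case False
  have "Mps a \<in> homog (vars n) 2"
  proof -
    have "set_mset m \<subseteq> vars n \<and> size m = 2" if "a m \<noteq> 0" for m
    proof -
      have m: "m \<in> jmons n 2" using that a by (auto simp: affine_points_def)
      have "size m \<noteq> 1"
      proof
        assume "size m = 1"
        then obtain p where "m = {#p#}" using size_1_singleton_mset by blast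
        with m that False show False by (auto simp: jmons_def)
      qed
      with m show ?thesis by (auto simp: jmons_def)
    qed
    then show ?thesis by (simp add: homog_def)
  qed
  then have "\<exists>r\<le>n. req (vars n) (hyp 0 + Mps a) (nform n r)"
    by (intro quad_classification[OF char]) (auto simp: hyp_def)
  then obtain r where "r \<le> n" "req (vars n) (Mps a) (nform n r)" by (auto simp: hyp_def)
  then show ?thesis by (intro exI[of _ r]) auto
qed

lemma jet_orbit_cover:
  fixes a :: "'a::alg_closed_field series"
  assumes "CHAR('a) = 2" "1 \<le> n" "a \<in> jpoints n 2"
  shows "\<exists>r\<le>n + 1. a \<in> jet_orbit n r"
  using two_jet_classification[OF assms] req_jet_orbit[OF assms(3)] by blast

lemma jet_orbit_disjoint:
  assumes char: "CHAR('a::field) = 2" and n: "1 \<le> n" and rs: "r < s" "s \<le> n + 1"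
  shows "jet_orbit n r \<inter> (jet_orbit n s :: 'a series set) = {}"
proof (rule ccontr)
  assume "\<not> ?thesis"
  then obtain a :: "'a series" where a: "a \<in> jet_orbit n r" "a \<in> jet_orbit n s" by blast
  obtain P where P: "P \<in> polyfun (jmons n 2)" "P (cf (nform n s :: 'a mps)) \<noteq> 0"
      "\<forall>r<s. \<forall>F. alg_auto (vars n) F \<longrightarrow> P (cf (jetm 2 (F (nform n r)))) = 0"
    using orbit_separation[OF char n rs(2)] by (elim bexE conjE) (rule that)
  obtain F where F: "alg_auto (vars n) F" "cf (nform n s) = cf (jetm 2 (F (Mps a)))"
    using jet_orbit_transitive[OF n a(2) nform_jet_orbit[OF n]] by (elim exE conjE that)
  have "cf (nform n s :: 'a mps) \<in> jet_orbit n r"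
    unfolding F(2) by (rule jet_orbit_auto[OF n a(1) F(1)])
  then obtain G where G: "alg_auto (vars n) G" "cf (nform n s :: 'a mps) = cf (jetm 2 (G (nform n r)))"
    by (rule jet_orbitE)
  have "P (cf (nform n s)) = 0"
    unfolding G(2) by (rule P(3)[rule_format, OF rs(1) G(1)])
  with P(2) show False by contradiction
qed

text \<open>An automorphism takes the given point to its representative. The separating polynomial
  composed with it is nonzero at the point and zero on all orbits of smaller index, so its
  nonvanishing set is the required neighbourhood.\<close>

lemma jet_orbit_open:
  assumes char: "CHAR('a::alg_closed_field) = 2" and n: "1 \<le> n"
  shows "openin (zariski (affine_space (jmons n 2)))
    (\<Union>r\<in>{s..n + 1}. jet_orbit n r :: 'a series set)" (is "openin _ ?U")
  unfolding openin_affine_iff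
proof (intro conjI ballI)
  show "?U \<subseteq> jpoints n 2" using jet_orbit_jpoints[OF n] by blast
  fix a assume "a \<in> ?U"
  then obtain r where r: "s \<le> r" "r \<le> n + 1" "a \<in> jet_orbit n r" by auto
  obtain P where P: "P \<in> polyfun (jmons n 2)" "P (cf (nform n r :: 'a mps)) \<noteq> 0"
      "\<forall>t<r. \<forall>F. alg_auto (vars n) F \<longrightarrow> P (cf (jetm 2 (F (nform n t)))) = 0"
    using orbit_separation[OF char n r(2)] by (elim bexE conjE) (rule that)
  have Pt: "P b = 0" if "t < r" "b \<in> jet_orbit n t" for b t
    using that(2) by (rule jet_orbitE) (simp add: P(3)[rule_format, OF that(1)])
  obtain F where F: "alg_auto (vars n) F" "cf (nform n r) = cf (jetm 2 (F (Mps a)))"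
    using jet_orbit_transitive[OF n r(3) nform_jet_orbit[OF n]] by (elim exE conjE that)
  obtain P' where P': "P' \<in> polyfun (jmons n 2)" "\<forall>b\<in>jpoints n 2. P' b = P (cf (jetm 2 (F (Mps b))))"
    using polyfun_auto[OF F(1) P(1)] by (elim bexE) (rule that)
  have "P' a \<noteq> 0"
    using bspec[OF P'(2) subsetD[OF jet_orbit_jpoints[OF n] r(3)]] F(2) P(2) by simp
  moreover have "{b \<in> jpoints n 2. P' b \<noteq> 0} \<subseteq> ?U"
  proof clarify
    fix b assume b: "b \<in> jpoints n 2" "P' b \<noteq> 0"
    obtain t where t: "t \<le> n + 1" "b \<in> jet_orbit n t"
      using jet_orbit_cover[OF char n b(1)] by blast
    have "\<not> t < r"
      using Pt[of t] jet_orbit_auto[OF n t(2) F(1)] b P'(2) by auto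
    with t r show "b \<in> ?U" by auto
  qed
  ultimately show "\<exists>p\<in>polyfun (jmons n 2). p a \<noteq> 0 \<and> {b \<in> jpoints n 2. p b \<noteq> 0} \<subseteq> ?U"
    using P'(1) by blast
qed

text \<open>Consecutive orbits are joined by explicit lines: adding \<open>t\<close> times
  \<open>X 1\<close>, adding \<open>t\<close> times the square of a new variable, or, with
  \<open>x\<close> the variable of the final square and \<open>y\<close> a new one,
  \<open>x^2 + t x y = x (x + t y)\<close>.\<close>

lemma nform_degeneration:
  assumes char: "CHAR('a::alg_closed_field) = 2" and n: "1 \<le> n" and r: "r \<le> n"
  shows "\<exists>D\<in>mpow (vars n) (Suc 0). \<forall>t. t \<noteq> 0 \<longrightarrow>
    req (vars n) (nform n r + Con t * D :: 'a mps) (nform n (Suc r))"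
proof -
  consider "r = n" | "r < n" "even r" | "r < n" "odd r" using r by linarith
  then show ?thesis
  proof cases
    case 1
    have one: "1 \<in> vars n" using n by auto
    have "req (vars n) (nform n r + Con t * X 1 :: 'a mps) (X 1)" if "t \<noteq> 0" for t
    proof (rule submersion_req[OF _ one])
      show "nform n r + Con t * X 1 \<in> mpow (vars n) (Suc 0)"
        using nform_mpow(1)[OF n] mpow_X[OF one] by (intro mpow_add mpow_Con_mult)
      have "nform n r \<in> mpow (vars n) 2" using nform_mpow(2)[OF n r] by (rule homogD)
      then have "cf (nform n r :: 'a mps) {#1#} = 0" by (rule mpowD) simp
      then show "cf (nform n r + Con t * X 1) {#1#} \<noteq> 0" using that by (simp add: cf_X)
    qed simp
    then show ?thesis
      using 1 mpow_X[OF one] by (intro bexI[of _ "X 1"]) (auto simp: nform_def)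
  next
    case 2
    then obtain m where m: "r = 2 * m" by (elim evenE)
    define y where "y = Suc r"
    have y: "y \<in> vars n" using 2 by (auto simp: y_def)
    have mn: "2 * m \<le> n" "2 * m + 1 \<le> n" using 2 m by auto
    have "req (vars n) (nform n r + Con t * (X y * X y) :: 'a mps) (nform n (Suc r))" if "t \<noteq> 0" for t
    proof -
      obtain c where c: "c ^ 2 = t" using nth_root_exists[of 2 t] by auto
      let ?A = "Con c * X y :: 'a mps"
      have A: "?A \<in> homog (vars n) (Suc 0)" using homog_X[OF y] by (intro homog_Con_mult) (simp add: One_nat_def)
      have F: "alg_auto (vars n) (change_var (vars n) y ?A)"
        using that c by (intro change_var_homog_auto A y finite_atLeastAtMost) (auto simp: cf_X)
      have hf: "hyp m \<in> ser (vars n - {y})"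
        using hyp_ser[of m "2 * m"] by (rule mpow_mono) (use mn in \<open>auto simp: y_def m\<close>)
      have "nform n (Suc r) = (hyp m + X y * X y :: 'a mps)"
        using nform_odd[OF mn(2), where 'a = 'a] by (simp add: m y_def Suc_eq_plus1)
      then have "change_var (vars n) y ?A (nform n (Suc r)) = hyp m + ?A * ?A"
        using change_var_fixes[OF _ homogD[OF A] hf] change_var_X[OF _ homogD[OF A] y, of y]
        by (simp only: change_var_hom[OF finite_atLeastAtMost homogD[OF A]] finite_atLeastAtMost if_True simp_thms)
      also have "\<dots> = nform n r + Con t * (X y * X y)"
        using nform_even[OF mn(1), where 'a = 'a] by (simp add: m c[symmetric] power2_eq_square Con_simps algebra_simps)
      finally have "req (vars n) (nform n (Suc r)) (nform n r + Con t * (X y * X y) :: 'a mps)"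
        by (rule reqI[OF F nform_ser[OF n]])
      then show ?thesis by (rule req_sym)
    qed
    then show ?thesis
      using mpow_X[OF y] X_ser[OF y] by (intro bexI[of _ "X y * X y"]) (auto intro: mpow_mult_left)
  next
    case 3
    then obtain m where m: "r = 2 * m + 1" by (elim oddE)
    define x y where "x = r" and "y = Suc r"
    have xy: "x \<in> vars n" "y \<in> vars n" "x \<noteq> y" using 3 m by (auto simp: x_def y_def)
    have mn: "2 * (m + 1) \<le> n" "2 * m + 1 \<le> n" using 3 m by auto
    have "req (vars n) (nform n r + Con t * (X x * X y) :: 'a mps) (nform n (Suc r))" if "t \<noteq> 0" for t
    proof -
      let ?A = "Con t * X y + X x :: 'a mps"
      have A: "?A \<in> homog (vars n) (Suc 0)"
        using homog_X[OF xy(1)] homog_X[OF xy(2)] by (intro homog_add homog_Con_mult) (simp_all add: One_nat_def)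
      have F: "alg_auto (vars n) (change_var (vars n) y ?A)"
        using that xy(3) by (intro change_var_homog_auto A xy(2) finite_atLeastAtMost) (auto simp: cf_X)
      have hf: "hyp m \<in> ser (vars n - {y})"
        using hyp_ser[of m "2 * m"] by (rule mpow_mono) (use mn in \<open>auto simp: y_def m\<close>)
      have "nform n (Suc r) = (hyp m + X x * X y :: 'a mps)"
      proof -
        have e: "Suc r = 2 * Suc m" "2 * m + 1 = x" "2 * m + 2 = y" by (simp_all add: m x_def y_def)
        have "nform n (2 * Suc m) = (hyp (Suc m) :: 'a mps)" by (rule nform_even) (use mn in simp)
        then show ?thesis unfolding e(1) hyp_Suc e(2,3) .
      qed
      then have "change_var (vars n) y ?A (nform n (Suc r)) = hyp m + X x * ?A"
        using change_var_fixes[OF _ homogD[OF A] hf] change_var_X[OF _ homogD[OF A] xy(1), of y]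
          change_var_X[OF _ homogD[OF A] xy(2), of y] xy(3)
        by (simp only: change_var_hom[OF finite_atLeastAtMost homogD[OF A]] finite_atLeastAtMost if_True if_False simp_thms)
      also have "\<dots> = nform n r + Con t * (X x * X y)"
        using nform_odd[OF mn(2), where 'a = 'a] by (simp add: m x_def algebra_simps)
      finally have "req (vars n) (nform n (Suc r)) (nform n r + Con t * (X x * X y) :: 'a mps)"
        by (rule reqI[OF F nform_ser[OF n]])
      then show ?thesis by (rule req_sym)
    qed
    then show ?thesis
      using mpow_X[OF xy(2)] X_ser[OF xy(1)] by (intro bexI[of _ "X x * X y"]) (auto intro: mpow_mult_left)
  qed
qed

lemma jet_line:
  assumes F: "alg_auto (vars n) F" and g: "g \<in> ser (vars n)" "D \<in> ser (vars n)"
  shows "cf (jetm k (F (g + Con t * D))) = (\<lambda>m. cf (jetm k (F g)) m + t * cf (jetm k (F D)) m)"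
  using g by (auto simp: cf_jetm alg_endoD(3)[OF alg_auto_endo[OF F]] alg_endo_simps(3)[OF alg_auto_endo[OF F]]
      mpow_Con_mult)

text \<open>The line of degeneration starts at the given point, so an open set around this point
  contains almost all of the line, and the points with \<open>t\<close> nonzero lie in the next
  orbit.\<close>

lemma jet_orbit_closure_step:
  assumes char: "CHAR('a::alg_closed_field) = 2" and n: "1 \<le> n" and r: "r \<le> n"
    and U: "openin (zariski (affine_space (jmons n 2))) U"
    and meets: "U \<inter> (jet_orbit n r :: 'a series set) \<noteq> {}"
  shows "U \<inter> jet_orbit n (Suc r) \<noteq> {}"
proof -
  obtain a where a: "a \<in> U" "a \<in> jet_orbit n r" using meets by blast
  then obtain F where F: "alg_auto (vars n) F" "a = cf (jetm 2 (F (nform n r)))" by (meson jet_orbitE)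
  obtain D :: "'a mps" where D: "D \<in> mpow (vars n) (Suc 0)"
      "\<And>t. t \<noteq> 0 \<Longrightarrow> req (vars n) (nform n r + Con t * D) (nform n (Suc r))"
    using nform_degeneration[OF char n r] by metis
  let ?g = "\<lambda>t. cf (jetm 2 (F (nform n r + Con t * D)))"
  note line = jet_line[OF F(1) nform_ser[OF n] mpow_ser[OF D(1)], of 2 r]
  have pts: "cf (jetm 2 (F (nform n r))) \<in> jpoints n 2" "cf (jetm 2 (F D)) \<in> jpoints n 2"
    using nform_mpow(1)[OF n] D(1) alg_auto_mpow[OF _ F(1)] by (auto intro!: jetm_jpoints)
  have "(\<lambda>m. cf (jetm 2 (F (nform n r))) m + 0 * cf (jetm 2 (F D)) m) \<in> U"
    using a(1) F(2) by simp
  from open_line_cofinite[OF U pts this] have "finite {t. ?g t \<notin> U}"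
    by (simp only: line)
  then have "finite ({t. ?g t \<notin> U} \<union> {0})" by simp
  then obtain t where t: "t \<notin> {t. ?g t \<notin> U} \<union> {0}"
    using ex_new_if_finite[OF infinite_alg_closed] by blast
  then obtain G where G: "alg_auto (vars n) G" "nform n r + Con t * D = G (nform n (Suc r))"
    using req_sym[OF D(2)[of t]] by (auto simp: req_def)
  have "?g t \<in> jet_orbit n (Suc r)"
    unfolding G(2) by (rule jet_orbitI[OF alg_auto_comp[OF F(1) G(1)]]) simp
  with t show ?thesis by auto
qed

lemma jet_orbit_closure:
  assumes char: "CHAR('a::alg_closed_field) = 2" and n: "1 \<le> n" and rs: "r \<le> s" "s \<le> n + 1"
    and U: "openin (zariski (affine_space (jmons n 2))) U"
    and meets: "U \<inter> (jet_orbit n r :: 'a series set) \<noteq> {}"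
  shows "U \<inter> jet_orbit n s \<noteq> {}"
  using rs
proof (induction s rule: dec_induct)
  case base
  then show ?case using meets by simp
next
  case (step s)
  then show ?case by (intro jet_orbit_closure_step[OF char n _ U]) auto
qed

lemma two_jet_modality:
  assumes char: "CHAR('a::alg_closed_field) = 2" and n: "1 \<le> n"
  shows "open_modality (right_jet_group n 2) (jet_act n 2) (jet_space n 2 :: ('a series, 'a) kspace) U = 0"
  unfolding jet_space_eq
\<comment> \<open>The largest index \<open>n + 1\<close> belongs to the open orbit, which has to be
  the first stratum; hence the reversed numbering.\<close>
proof (rule open_modality_finite_orbits[where N = "n + 2" and S = "\<lambda>i. jet_orbit n (n + 1 - i)"])
  show "(\<Union>i<n + 2. jet_orbit n (n + 1 - i)) = (jpoints n 2 :: 'a series set)"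
  proof
    show "jpoints n 2 \<subseteq> (\<Union>i<n + 2. jet_orbit n (n + 1 - i) :: 'a series set)"
    proof
      fix a :: "'a series" assume "a \<in> jpoints n 2"
      then obtain r where "r \<le> n + 1" "a \<in> jet_orbit n r" using jet_orbit_cover[OF char n] by blast
      then show "a \<in> (\<Union>i<n + 2. jet_orbit n (n + 1 - i))" by (intro UN_I[of "n + 1 - r"]) auto
    qed
  qed (use jet_orbit_jpoints[OF n] in blast)
  show "jet_orbit n (n + 1 - i) \<inter> jet_orbit n (n + 1 - j) = ({} :: 'a series set)" if "i < j" "j < n + 2" for i j
    using jet_orbit_disjoint[OF char n, of "n + 1 - j" "n + 1 - i"] that by (simp add: Int_commute)
  show "jet_orbit n (n + 1 - i) \<noteq> ({} :: 'a series set)" for i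
    using nform_jet_orbit[OF n] by blast
  show "openin (zariski (affine_space (jmons n 2))) (\<Union>i<j. jet_orbit n (n + 1 - i) :: 'a series set)"
    if "j \<le> n + 2" for j
  proof -
    have "(\<Union>i<j. jet_orbit n (n + 1 - i) :: 'a series set) = (\<Union>r\<in>{n + 2 - j..n + 1}. jet_orbit n r)"
    proof (intro equalityI subsetI)
      fix a :: "'a series" assume "a \<in> (\<Union>i<j. jet_orbit n (n + 1 - i))"
      then obtain i where "i < j" "a \<in> jet_orbit n (n + 1 - i)" by blast
      with that show "a \<in> (\<Union>r\<in>{n + 2 - j..n + 1}. jet_orbit n r)" by (intro UN_I[of "n + 1 - i"]) auto
    next
      fix a :: "'a series" assume "a \<in> (\<Union>r\<in>{n + 2 - j..n + 1}. jet_orbit n r)"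
      then obtain r where "n + 2 - j \<le> r" "r \<le> n + 1" "a \<in> jet_orbit n r" by auto
      with that show "a \<in> (\<Union>i<j. jet_orbit n (n + 1 - i))" by (intro UN_I[of "n + 1 - r"]) auto
    qed
    then show ?thesis using jet_orbit_open[OF char n] by simp
  qed
  show "U' \<inter> jet_orbit n (n + 1 - i) \<noteq> {}"
    if "i \<le> j" "openin (zariski (affine_space (jmons n 2))) U'" "U' \<inter> jet_orbit n (n + 1 - j) \<noteq> {}"
    for i j and U' :: "'a series set"
    using that by (intro jet_orbit_closure[OF char n _ _ that(2,3)]) auto
  fix i and x y :: "'a series"
  assume x: "x \<in> jet_orbit n (n + 1 - i)"
  then have xp: "x \<in> jpoints n 2" using jet_orbit_jpoints[OF n] by blast
  show "jet_act n 2 g x \<in> jet_orbit n (n + 1 - i)" if "g \<in> right_jet_group n 2" for g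
  proof -
    have "\<exists>g'\<in>right_jet_group n 2. jet_act n 2 g x = jet_act n 2 g' x" using that by blast
    then obtain F where "alg_auto (vars n) F" "jet_act n 2 g x = cf (jetm 2 (F (Mps x)))"
      unfolding jet_orbit_iff[OF xp] by blast
    with jet_orbit_auto[OF n x] show ?thesis by simp
  qed
  show "\<exists>g\<in>right_jet_group n 2. y = jet_act n 2 g x" if "y \<in> jet_orbit n (n + 1 - i)"
    using jet_orbit_transitive[OF n x that] jet_orbit_iff[OF xp] by blast
qed

text \<open>A neighbourhood of the 2-jet of the hyperbolic form also contains jets with a linear
  term. Morse's lemma settles the orbit \<open>r = n\<close>, the inverse function theorem the orbit
  \<open>r = n + 1\<close>.\<close>

lemma two_determined_req:
  assumes n: "1 \<le> n" "even n" and g: "g \<in> mpow (vars n) (Suc 0)"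
    and orb: "cf (jetm 2 g) \<in> jet_orbit n r" "n \<le> r" "r \<le> n + 1"
  shows "req (vars n) g (nform n r :: 'a::field mps)"
proof -
  obtain F where F: "alg_auto (vars n) F" "jetm 2 (F g) = nform n r"
    using jet_orbit_to_nform[OF n(1) mpow_ser[OF g] orb(1)] by metis
  have Fg: "F g \<in> mpow (vars n) (Suc 0)" using alg_auto_mpow[OF _ F(1) g] by simp
  have "req (vars n) (F g) (nform n r)"
  proof (cases "r = n")
    case True
    have three: "Suc 2 = 3" by simp
    have "F g - nform n r \<in> mpow (vars n) 3"
      using jetm_diff[OF mpow_ser[OF Fg], of 2] F(2) by (simp only: three)
    moreover have "nform n r = (hyp (n div 2) :: 'a mps)"
      using n(2) True by (simp add: nform_def)
    ultimately show ?thesis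
      using morse_lemma[OF n(2) mpow_ser[OF Fg]] by simp
  next
    case False
    then have r: "nform n r = (X 1 :: 'a mps)" using orb by (simp add: nform_def)
    have "cf (F g) {#1#} = cf (jetm 2 (F g)) {#1#}" by (simp add: cf_jetm)
    also have "\<dots> = 1" by (simp add: F(2) r cf_X)
    finally show ?thesis unfolding r using n(1) by (intro submersion_req Fg) auto
  qed
  moreover have "req (vars n) g (F g)" using F(1) mpow_ser[OF g] by (auto intro: reqI)
  ultimately show ?thesis using req_trans by blast
qed

theorem A1_right_simple:
  fixes f :: "'a::alg_closed_field series"
  assumes char: "CHAR('a) = 2" and n: "1 \<le> n" "even n" and f: "f \<in> max_ideal n"
    and A1: "right_equivalent n f (A1_series n)"
  shows "right_simple n f"
proof -
  have fs: "Mps f \<in> mpow (vars n) (Suc 0)" using f by (simp add: max_ideal_iff)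
  have "req (vars n) (Mps f) (nform n n)"
    using A1 n(2) by (simp add: right_equivalent_iff[OF mpow_ser[OF fs]] A1_series_eq nform_def)
  then obtain F where F: "alg_auto (vars n) F" "Mps f = F (nform n n)"
    by (blast dest: req_sym intro: that elim: req_def[THEN iffD1, THEN conjunct2, THEN exE])
  have jf: "jet 2 f \<in> jet_orbit n n"
    using F(2) by (intro jet_orbitI[OF F(1)]) (simp add: jetm_def flip: F(2))
  \<comment> \<open>The two largest orbits form an open set; it serves both to show that
    \<open>2\<close> is sufficiently large and as the neighbourhood that bounds the
    modality.\<close>
  let ?U = "\<Union>r\<in>{n..n + 1}. jet_orbit n r :: 'a series set"
  have "sufficiently_large n f 2"
    unfolding sufficiently_large_def jet_space_eq
  proof (intro exI[of _ ?U] conjI ballI impI)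
    show "openin (zariski (affine_space (jmons n 2))) ?U" by (rule jet_orbit_open[OF char n(1)])
    show "jet 2 f \<in> ?U" using jf by auto
    fix g assume g: "g \<in> max_ideal n" "jet 2 g \<in> ?U"
    then obtain r where r: "n \<le> r" "r \<le> n + 1" "jet 2 g \<in> jet_orbit n r" by auto
    show "right_determined n 2 g"
      unfolding right_determined_def
    proof (intro ballI impI)
      fix h :: "'a series" assume h: "h \<in> max_ideal n" "jet 2 h = jet 2 g"
      have "req (vars n) (Mps h) (nform n r)" "req (vars n) (Mps g) (nform n r)"
        using r h g by (auto intro!: two_determined_req n simp: jetm_def max_ideal_iff)
      then have "req (vars n) (Mps h) (Mps g)" using req_sym req_trans by blast
      then show "right_equivalent n h g"
        using h(1) mpow_ser by (subst right_equivalent_iff) (auto simp: max_ideal_iff)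
    qed
  qed
  then have "right_modality n f \<le> modality (right_jet_group n 2) (jet_act n 2) (jet_space n 2) (jet 2 f)"
    unfolding right_modality_def by (intro INF_lower) simp
  also have "\<dots> \<le> open_modality (right_jet_group n 2) (jet_act n 2) (jet_space n 2) ?U"
    unfolding modality_def using jet_orbit_open[OF char n(1)] jf
    by (intro INF_lower) (auto simp: jet_space_eq)
  also have "\<dots> = 0" by (rule two_jet_modality[OF char n(1)])
  finally show ?thesis by (simp add: right_simple_def)
qed

section \<open>Families with infinitely many orbits\<close>

lemma affine_closedin_singleton:
  assumes "finite I" "x \<in> affine_points I"
  shows "closedin (zariski (affine_space I)) {x}"
proof -
  have "openin (zariski (affine_space I)) (affine_points I - {x})"
    unfolding openin_affine_iff
  proof (intro conjI ballI)
    fix y assume y: "y \<in> affine_points I - {x}"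
    then obtain i where "y i \<noteq> x i" by (auto simp: fun_eq_iff)
    then have i: "i \<in> I" "y i \<noteq> x i" using y assms(2) by (auto simp: affine_points_def)
    have "(\<lambda>a. a i + - x i) \<in> polyfun I" by (intro polyfun.add polyfun.coord polyfun.const i(1))
    with i show "\<exists>p\<in>polyfun I. p y \<noteq> 0 \<and> {b \<in> affine_points I. p b \<noteq> 0} \<subseteq> affine_points I - {x}"
      by (intro bexI[of _ "\<lambda>a. a i + - x i"]) auto
  qed auto
  with assms(2) show ?thesis by (simp add: closedin_def)
qed

text \<open>Any other point has a neighbourhood that misses \<open>y\<close>: an affine chart
  without \<open>y\<close>, or a chart with \<open>y\<close> removed, where \<open>y\<close> is cut
  out by the coordinates. It supplies the small member of a chain of closed sets.\<close>

lemma variety_closedin_singleton: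
  fixes Y :: "('p, 'k::field) kspace"
  assumes "variety Y" "y \<in> topspace (zariski Y)"
  shows "closedin (zariski Y) {y}"
proof -
  have pre: "prevariety Y" using assms(1) by (simp add: variety_def)
  obtain \<U> where \<U>: "\<Union>\<U> = topspace (zariski Y)" "\<And>U. U \<in> \<U> \<Longrightarrow> openin (zariski Y) U"
      "\<And>U. U \<in> \<U> \<Longrightarrow> affine_variety (induced Y U)"
    using conjunct2[OF pre[unfolded prevariety_def]] by (elim exE conjE) (rule that, blast+)
  have nb: "\<exists>W. openin (zariski Y) W \<and> x \<in> W \<and> y \<notin> W" if x: "x \<in> topspace (zariski Y)" "x \<noteq> y" for x
  proof -
    obtain U where U: "U \<in> \<U>" "x \<in> U" using x \<U>(1) by blast
    show ?thesis
    proof (cases "y \<in> U")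
      case True
      obtain N C and \<phi> :: "'p \<Rightarrow> nat \<Rightarrow> 'k" where
          C: "closedin (zariski (affine_space {..<N})) C"
        and iso: "kspace_iso (induced Y U) (induced (affine_space {..<N}) C) \<phi>"
        using \<U>(3)[OF U(1)] unfolding affine_variety_def by (elim exE conjE) (rule that)
      let ?T = "subtopology (zariski Y) U" and ?A = "zariski (affine_space {..<N}) :: (nat \<Rightarrow> 'k) topology"
      have hom: "homeomorphic_map ?T (subtopology ?A C) \<phi>"
        using iso by (simp add: kspace_iso_def induced_def)
      have top: "topspace ?T = U" using openin_subset[OF \<U>(2)[OF U(1)]] by auto
      have "\<phi> y \<in> topspace (subtopology ?A C)"
        using homeomorphic_imp_surjective_map[OF hom] True top by blast
      then have "closedin (subtopology ?A C) {\<phi> y}"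
        by (intro closedin_subset_topspace[of ?A] affine_closedin_singleton) auto
      then have "closedin ?T {x \<in> topspace ?T. \<phi> x \<in> {\<phi> y}}"
        using homeomorphic_imp_continuous_map[OF hom] closedin_continuous_map_preimage by blast
      moreover have "{x \<in> topspace ?T. \<phi> x \<in> {\<phi> y}} = {y}"
        using homeomorphic_imp_injective_map[OF hom] True unfolding top inj_on_def by auto
      ultimately have "openin ?T (U - {y})" using top by (metis closedin_def)
      then have "openin (zariski Y) (U - {y})" using \<U>(2)[OF U(1)] by (metis openin_trans_full)
      then show ?thesis using U x by (intro exI[of _ "U - {y}"]) auto
    next
      case False
      then show ?thesis using U \<U>(2) by blast
    qed
  qed
  have "openin (zariski Y) (topspace (zariski Y) - {y})"
  proof (subst openin_subopen, rule ballI)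
    fix x assume x: "x \<in> topspace (zariski Y) - {y}"
    then obtain W where "openin (zariski Y) W" "x \<in> W" "y \<notin> W" using nb by blast
    then show "\<exists>T. openin (zariski Y) T \<and> x \<in> T \<and> T \<subseteq> topspace (zariski Y) - {y}"
      using openin_subset by (intro exI[of _ W]) auto
  qed
  then show ?thesis using assms(2) by (simp add: closedin_def)
qed

lemma krull_dim_ge_1:
  assumes "irreducible_closedin T A" "irreducible_closedin T B" "A \<subset> B"
  shows "1 \<le> krull_dim T"
proof -
  have "\<exists>C. (\<forall>i\<le>(1::nat). irreducible_closedin T (C i)) \<and> (\<forall>i<1. C i \<subset> C (Suc i))"
    using assms by (intro exI[of _ "\<lambda>i. if i = 0 then A else B"]) auto
  then have "enat 1 \<in> {enat l | l. \<exists>C. (\<forall>i\<le>l. irreducible_closedin T (C i)) \<and> (\<forall>i<l. C i \<subset> C (Suc i))}"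
    by blast
  then show ?thesis unfolding krull_dim_def by (simp add: Sup_upper one_enat_def)
qed

text \<open>
  An infinite part of the line lies in one stratum, hence all of it up to finitely many points; its
  image in the quotient is irreducible, since two disjoint cofinite subsets of the line cannot be
  nonempty.
\<close>

lemma strat_modality_line:
  fixes a b :: "'i \<Rightarrow> 'k::field"
  defines "\<gamma> \<equiv> \<lambda>t i. a i + t * b i"
  assumes inf: "infinite (UNIV :: 'k set)"
    and strat: "rosenlicht_stratification G act (affine_space I) strat"
    and U: "openin (zariski (affine_space I)) U" "\<gamma> s \<in> U"
    and pts: "a \<in> affine_points I" "b \<in> affine_points I"
    and vary: "\<And>B. finite B \<Longrightarrow> \<exists>t t'. t \<notin> B \<and> t' \<notin> B \<and> \<not> (\<exists>g\<in>G. \<gamma> t' = act g (\<gamma> t))"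
  shows "1 \<le> strat_modality strat U"
proof -
  let ?X = "affine_space I :: ('i \<Rightarrow> 'k, 'k) kspace"
  have \<gamma>: "\<gamma> t \<in> affine_points I" for t
    using pts by (auto simp: \<gamma>_def affine_points_def)
  have cof: "finite {t. \<gamma> t \<notin> W}" if "openin (zariski ?X) W" "\<gamma> t \<in> W" for W t
    using open_line_cofinite[OF that(1) pts, of t] that(2) by (simp add: \<gamma>_def)
  have "(\<Union>(S, p, Y)\<in>set strat. S) = affine_points I"
    using strat by (simp add: rosenlicht_stratification_def)
  then have "UNIV = (\<Union>st\<in>set strat. {t. \<gamma> t \<in> fst st})"
    using \<gamma> by (fastforce simp: case_prod_unfold)
  then obtain st where st: "st \<in> set strat" "infinite {t. \<gamma> t \<in> fst st}"
    using inf by (metis (no_types, lifting) List.finite_set finite_UN_I)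
  obtain S p Y where SpY: "st = (S, p, Y)" by (cases st)
  obtain i where i: "i < length strat" "strat ! i = (S, p, Y)"
    using st(1) SpY by (metis in_set_conv_nth)
  have *: "locally_closedin (zariski ?X) S" "variety Y" "geometric_quotient G act (induced ?X S) p Y"
    using strat i unfolding rosenlicht_stratification_def by (auto simp: Let_def)
  obtain V C where VC: "openin (zariski ?X) V" "closedin (zariski ?X) C" "S = V \<inter> C"
    using *(1) by (auto simp: locally_closedin_def)
  have infS: "infinite {t. \<gamma> t \<in> S}" using st(2) SpY by simp
  \<comment> \<open>A closed set that misses one point of the line contains only finitely many of
    its points.\<close>
  have inC: "\<gamma> t \<in> C" for t
  proof (rule ccontr)
    assume "\<gamma> t \<notin> C"
    then have "finite {t. \<gamma> t \<notin> affine_points I - C}"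
      using VC(2) \<gamma> by (intro cof[of _ t]) (auto simp: closedin_def)
    moreover have "{t. \<gamma> t \<in> S} \<subseteq> {t. \<gamma> t \<notin> affine_points I - C}" using VC(3) by auto
    ultimately show False using infS finite_subset by blast
  qed
  obtain t1 where "\<gamma> t1 \<in> S" using infS by (metis (mono_tags) Collect_empty_eq finite.emptyI)
  then have finV: "finite {t. \<gamma> t \<notin> V}" using VC by (intro cof[of _ t1]) auto
  define T where "T = {t. \<gamma> t \<in> U \<inter> S}"
  have "- T \<subseteq> {t. \<gamma> t \<notin> U} \<union> {t. \<gamma> t \<notin> V}" using inC VC(3) by (auto simp: T_def)
  then have finT: "finite (- T)"
    using cof[OF U] finV finite_subset by blast
  let ?P = "p ` (U \<inter> S)"
  let ?Z = "subtopology (zariski Y) ?P" and ?y = "\<lambda>t. p (\<gamma> t)"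
  have Ssub: "S \<subseteq> affine_points I" using VC openin_subset by fastforce
  have topS: "topspace (zariski (induced ?X S)) = S" using Ssub by (auto simp: induced_def)
  have cont: "continuous_map (zariski (induced ?X S)) (zariski Y) p"
    using *(3) by (auto simp: geometric_quotient_def intro: quotient_imp_continuous_map)
  have Ptop: "?P \<subseteq> topspace (zariski Y)"
    using continuous_map_image_subset_topspace[OF cont] topS by auto
  have topZ: "topspace ?Z = ?P" using Ptop by auto
  have yT: "?y t \<in> ?P" if "t \<in> T" for t using that by (auto simp: T_def)
  \<comment> \<open>The preimage of \<open>A\<close> is closed in the stratum, so if it misses a
    point of the line in the stratum, it meets the line in a finite set.\<close>
  have irr: "?y ` T \<subseteq> A" if A: "closedin ?Z A" "infinite {t \<in> T. ?y t \<in> A}" for A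
  proof (rule ccontr)
    assume "\<not> ?y ` T \<subseteq> A"
    then obtain t where t: "t \<in> T" "?y t \<notin> A" by auto
    obtain A' where A': "closedin (zariski Y) A'" "A = A' \<inter> ?P"
      using A(1) by (auto simp: closedin_subtopology)
    have "closedin (zariski (induced ?X S)) {x \<in> S. p x \<in> A'}"
      using closedin_continuous_map_preimage[OF cont A'(1)] topS by simp
    then have "openin (subtopology (zariski ?X) S) (S - {x \<in> S. p x \<in> A'})"
      using topS by (simp add: closedin_def induced_def)
    then obtain W where W: "openin (zariski ?X) W" "S - {x \<in> S. p x \<in> A'} = W \<inter> S"
      by (auto simp: openin_subtopology)
    have "\<gamma> t \<in> S" "?y t \<notin> A'" using t A'(2) yT by (auto simp: T_def)
    then have "\<gamma> t \<in> W" using W(2) by blast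
    then have "finite {t. \<gamma> t \<notin> W}" by (rule cof[OF W(1)])
    moreover have "{t \<in> T. ?y t \<in> A} \<subseteq> {t. \<gamma> t \<notin> W}"
      using W(2) A'(2) by (auto simp: T_def)
    ultimately show False using A(2) finite_subset by blast
  qed
  let ?C = "?Z closure_of (?y ` T)"
  obtain t t' where tt: "t \<in> T" "t' \<in> T" "\<not> (\<exists>g\<in>G. \<gamma> t' = act g (\<gamma> t))"
    using vary[OF finT] by auto
  \<comment> \<open>Fibres of the quotient map are orbits, so the image of the line has two points,
    and a point lies strictly inside its closure.\<close>
  have ne: "?y t \<noteq> ?y t'"
    using *(3) tt topS unfolding geometric_quotient_def T_def by auto
  have sub: "?y ` T \<subseteq> ?C"
    using yT topZ by (intro closure_of_subset) auto
  have infT: "infinite T" using finT inf by (metis Compl_partition finite_Un)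
  have "irreducible_closedin ?Z ?C"
    unfolding irreducible_closedin_def
  proof (intro conjI allI impI)
    show "?C \<noteq> {}" using sub tt(1) by auto
    fix A B assume AB: "closedin ?Z A \<and> closedin ?Z B \<and> ?C \<subseteq> A \<union> B"
    then have "T \<subseteq> {t \<in> T. ?y t \<in> A} \<union> {t \<in> T. ?y t \<in> B}" using sub by auto
    then have "infinite {t \<in> T. ?y t \<in> A} \<or> infinite {t \<in> T. ?y t \<in> B}"
      using infT finite_subset by blast
    then show "?C \<subseteq> A \<or> ?C \<subseteq> B"
      using irr AB by (meson closure_of_minimal)
  qed simp
  moreover have "irreducible_closedin ?Z {?y t}"
  proof -
    have "closedin (zariski Y) {?y t}"
      using yT[OF tt(1)] Ptop by (intro variety_closedin_singleton *(2)) auto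
    then have "closedin ?Z {?y t}"
      using yT[OF tt(1)] by (intro closedin_subset_topspace) auto
    then show ?thesis by (auto simp: irreducible_closedin_def)
  qed
  moreover have "{?y t} \<subset> ?C" using sub tt(1,2) ne by auto
  ultimately have "1 \<le> krull_dim ?Z" by (intro krull_dim_ge_1)
  also have "\<dots> \<le> strat_modality strat U"
    unfolding strat_modality_def using st(1) SpY by (intro SUP_upper2[of "(S, p, Y)"]) auto
  finally show ?thesis .
qed

section \<open>Invariants of degenerate series\<close>

text \<open>Agreement on the variables \<open>d\<close> orders beyond the first gives agreement
  \<open>d\<close> orders beyond the order of \<open>f\<close>. With \<open>d = 1\<close>, only the
  linear part of an automorphism acts on cubic terms modulo order four.\<close>

lemma local_endo_cong_strong:
  assumes "finite V" "local_endo V F" "local_endo V G"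
    and "\<And>i. i \<in> V \<Longrightarrow> F (X i) - G (X i) \<in> mpow V (Suc d)" and "f \<in> mpow V k"
  shows "F f - G f \<in> mpow V (k + d)"
  using assms(5)
proof (induction k arbitrary: f)
  case 0
  have "F f - G f \<in> mpow V (Suc d)" by (rule local_endo_cong[OF assms(1-4) 0])
  then show ?case by (auto intro: mpow_mono)
next
  case (Suc k)
  note F = local_endo_alg[OF assms(2)] and G = local_endo_alg[OF assms(3)]
  let ?q = "\<lambda>i. quot_var V i f"
  have q: "?q i \<in> mpow V k" for i
    using quot_var_mpow[OF Suc.prems] by simp
  have "F f - G f = (\<Sum>i\<in>V. F (X i) * F (?q i) - G (X i) * G (?q i))"
    using alg_endo_decompose[OF assms(1) F mpow_ser[OF Suc.prems]]
      alg_endo_decompose[OF assms(1) G mpow_ser[OF Suc.prems]] by (simp add: sum_subtractf)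
  also have "\<dots> \<in> mpow V (Suc k + d)"
  proof (rule mpow_sum)
    fix i assume i: "i \<in> V"
    have "F (X i) * F (?q i) - G (X i) * G (?q i) \<in> mpow V (Suc 0 + k + d)"
    proof (rule mpow_diff_cong)
      show "F (X i) \<in> mpow V (Suc 0)" using assms(2) i by (simp add: local_endo_def)
      show "G (?q i) \<in> mpow V k" by (rule local_endo_mpow[OF assms(1,3) q])
      show "F (X i) - G (X i) \<in> mpow V (Suc 0 + d)" using assms(4)[OF i] by simp
      show "F (?q i) - G (?q i) \<in> mpow V (k + d)" by (rule Suc.IH[OF q])
    qed
    then show "F (X i) * F (?q i) - G (X i) * G (?q i) \<in> mpow V (Suc k + d)" by simp
  qed
  finally show ?case .
qed

lemma restrict_vars_mult: "restrict_vars R (f * g) = restrict_vars R f * restrict_vars R g"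
proof (rule mps_eqI)
  fix m
  have "cf (restrict_vars R f * restrict_vars R g) m
      = (\<Sum>p\<in>splits m. if set_mset m \<subseteq> R then cf f (fst p) * cf g (snd p) else 0)"
    unfolding cf_mult case_prod_unfold by (rule sum.cong) (auto simp: restrict_vars_def splits_def)
  then show "cf (restrict_vars R (f * g)) m = cf (restrict_vars R f * restrict_vars R g) m"
    by (simp add: restrict_vars_def cf_mult case_prod_unfold)
qed

lemma restrict_vars_add: "restrict_vars R (f + g) = restrict_vars R f + restrict_vars R g"
  by (rule mps_eqI) (simp add: restrict_vars_def)

lemma restrict_vars_diff: "restrict_vars R (f - g) = restrict_vars R f - restrict_vars R g"
  by (rule mps_eqI) (simp add: restrict_vars_def)

lemma restrict_vars_X: "restrict_vars R (X i) = (if i \<in> R then X i else 0)"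
  by (rule mps_eqI) (auto simp: restrict_vars_def cf_X)

lemma restrict_vars_Con_mult: "restrict_vars R (Con c * f) = Con c * restrict_vars R f"
  by (rule mps_eqI) (simp add: restrict_vars_def)

lemma restrict_vars_mpow': "f \<in> mpow V k \<Longrightarrow> restrict_vars R f \<in> mpow V k"
  using restrict_vars_mpow mpow_mono by (metis Int_lower1 order_refl)

lemma local_endo_restrict: "local_endo V (restrict_vars R)"
  unfolding local_endo_def alg_endo_def
proof (intro conjI ballI allI)
  show "restrict_vars R ` ser V \<subseteq> ser V" by (auto intro: restrict_vars_mpow')
  show "restrict_vars R (Con c) = Con c" for c
    by (rule mps_eqI) (auto simp: restrict_vars_def cf_Con)
qed (auto simp: restrict_vars_add restrict_vars_mult restrict_vars_X intro: mpow_X)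

text \<open>Coefficients are left arbitrary so that the members of the line need not be normalised:
  their quadratic parts have this form for all parameters. The squares do not contribute to the
  polar form in characteristic two.\<close>

definition diag_form :: "nat \<Rightarrow> nat \<Rightarrow> (nat \<Rightarrow> 'a) \<Rightarrow> (nat \<Rightarrow> 'a) \<Rightarrow> 'a::field mps" where
  "diag_form n m \<tau> e = (\<Sum>k\<in>{1..m}. Con (\<tau> k) * (X (2 * k - 1) * X (2 * k)))
    + (\<Sum>i\<in>vars n. Con (e i) * (X i * X i))"

lemma diag_form_image:
  assumes "alg_endo (vars n) F" "2 * m \<le> n"
  shows "F (diag_form n m \<tau> e) = (\<Sum>k\<in>{1..m}. Con (\<tau> k) * (F (X (2 * k - 1)) * F (X (2 * k))))
    + (\<Sum>i\<in>vars n. Con (e i) * (F (X i) * F (X i)))"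
proof -
  note E = assms(1)
  have X: "X (2 * k - 1) \<in> ser (vars n)" "X (2 * k) \<in> ser (vars n)" if "k \<in> {1..m}" for k
    using that assms(2) by (auto intro!: X_ser)
  have XX: "X (2 * k - 1) * X (2 * k) \<in> ser (vars n)" if "k \<in> {1..m}" for k
    by (rule mpow_mult_left[OF X(1)[OF that] X(2)[OF that]])
  have Xs: "X i * X i \<in> ser (vars n)" if "i \<in> vars n" for i
    by (rule mpow_mult_left[OF X_ser[OF that] X_ser[OF that]])
  have "F (diag_form n m \<tau> e) = F (\<Sum>k\<in>{1..m}. Con (\<tau> k) * (X (2 * k - 1) * X (2 * k)))
      + F (\<Sum>i\<in>vars n. Con (e i) * (X i * X i))"
    unfolding diag_form_def by (intro alg_endoD(3)[OF E] mpow_sum mpow_Con_mult XX Xs)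
  also have "F (\<Sum>k\<in>{1..m}. Con (\<tau> k) * (X (2 * k - 1) * X (2 * k)))
      = (\<Sum>k\<in>{1..m}. F (Con (\<tau> k) * (X (2 * k - 1) * X (2 * k))))"
    by (intro alg_endo_sum[OF E] mpow_Con_mult XX)
  also have "\<dots> = (\<Sum>k\<in>{1..m}. Con (\<tau> k) * (F (X (2 * k - 1)) * F (X (2 * k))))"
    using alg_endo_simps(3)[OF E XX] alg_endoD(4)[OF E X] by (intro sum.cong) auto
  also have "F (\<Sum>i\<in>vars n. Con (e i) * (X i * X i)) = (\<Sum>i\<in>vars n. F (Con (e i) * (X i * X i)))"
    by (intro alg_endo_sum[OF E] mpow_Con_mult Xs)
  also have "\<dots> = (\<Sum>i\<in>vars n. Con (e i) * (F (X i) * F (X i)))"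
    using alg_endo_simps(3)[OF E Xs] alg_endoD(4)[OF E X_ser X_ser] by (intro sum.cong) auto
  finally show ?thesis .
qed

lemma diag_form_homog: "2 * m \<le> n \<Longrightarrow> diag_form n m \<tau> e \<in> homog (vars n) 2"
proof -
  assume m: "2 * m \<le> n"
  have h: "X i * X j \<in> homog (vars n) 2" if "i \<in> vars n" "j \<in> vars n" for i j
    using homog_mult[OF homog_X[OF that(1)] homog_X[OF that(2)]] by (simp add: numeral_2_eq_2)
  show ?thesis
    unfolding diag_form_def using m
    by (intro homog_add homog_sum homog_Con_mult h) auto
qed

lemma cf_diag_form_cross:
  fixes \<tau> e :: "nat \<Rightarrow> 'a::field"
  assumes "2 * m < j" "l \<noteq> j"
  shows "cf (diag_form n m \<tau> e) {#l, j#} = 0"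
proof -
  have "cf (X (2 * k - 1) * X (2 * k) :: 'a mps) {#l, j#} = 0" if "k \<in> {1..m}" for k
    using that assms(1) by (auto simp: cf_X_mult cf_X)
  moreover have "cf (X i * X i :: 'a mps) {#l, j#} = 0" for i
    using assms(2) by (auto simp: cf_X_mult cf_X)
  ultimately show ?thesis by (simp add: diag_form_def)
qed

lemma cf_diag_form_square:
  fixes \<tau> e :: "nat \<Rightarrow> 'a::field"
  assumes "2 * m < j" "j \<in> vars n"
  shows "cf (diag_form n m \<tau> e) {#j, j#} = e j"
proof -
  have "cf (X (2 * k - 1) * X (2 * k) :: 'a mps) {#j, j#} = 0" if "k \<in> {1..m}" for k
    using that assms(1) by (auto simp: cf_X_mult cf_X)
  moreover have "e i * cf (X i * X i :: 'a mps) {#j, j#} = (if i = j then e j else 0)" for i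
    by (auto simp: cf_X_mult cf_X)
  ultimately show ?thesis using assms(2) by (simp add: diag_form_def)
qed

text \<open>
  The radical of the polar form, spanned by the last coordinate vectors, is preserved by the linear
  part of an equivalence.
\<close>

lemma radical_preserved:
  fixes F :: "'a::field mps \<Rightarrow> 'a mps"
  assumes char: "CHAR('a) = 2" and m: "2 * m \<le> n" and F: "alg_auto (vars n) F"
    and \<tau>: "\<And>k. k \<in> {1..m} \<Longrightarrow> \<tau> k \<noteq> 0"
    and g: "g - diag_form n m \<tau> e \<in> mpow (vars n) 3"
    and g': "F g - diag_form n m \<tau>' e' \<in> mpow (vars n) 3"
    and j: "2 * m < j" "j \<in> vars n" and i: "i \<in> {1..2 * m}"
  shows "cf (F (X i)) {#j#} = 0"
proof -
  let ?V = "vars n"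
  note L = alg_auto_local[OF F] and E = alg_auto_endo[OF F]
  define a where "a i = F (X i)" for i
  have a: "a i \<in> mpow ?V (Suc 0)" if "i \<in> ?V" for i
    using that L by (simp add: a_def local_endo_def)
  have pair: "2 * k - 1 \<in> ?V" "2 * k \<in> ?V" if "k \<in> {1..m}" for k using that m by auto
  have dser: "diag_form n m \<tau> e \<in> ser ?V"
    using diag_form_homog[OF m] homogD mpow_ser by blast
  have gser: "g \<in> ser ?V" using mpow_add[OF mpow_ser[OF g] dser] by simp
  have FF: "F g - F (diag_form n m \<tau> e) \<in> mpow ?V 3"
    using alg_auto_mpow[OF _ F g] alg_endo_simps(5)[OF E gser dser] by simp
  \<comment> \<open>For \<open>l\<close> other than \<open>j\<close> this is the coefficient of
    \<open>X l * X j\<close> in \<open>F g\<close>: squares have no mixed terms, and in the target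
    \<open>X j\<close> belongs to the radical. For \<open>l = j\<close> everything is
    doubled.\<close>
  have zero: "(\<Sum>k\<in>{1..m}. \<tau> k * (cf (a (2 * k - 1)) {#l#} * cf (a (2 * k)) {#j#}
      + cf (a (2 * k - 1)) {#j#} * cf (a (2 * k)) {#l#})) = 0" if l: "l \<in> ?V" for l
  proof (cases "l = j")
    case True
    then show ?thesis by (simp add: char2_add_self[OF char])
  next
    case False
    have "cf (F g) {#l, j#} = cf (diag_form n m \<tau>' e') {#l, j#}"
      by (rule mpow_diffD[OF g']) simp
    then have "cf (F g) {#l, j#} = 0" using cf_diag_form_cross[OF j(1) False, of n \<tau>' e'] by simp
    moreover have "cf (F g) {#l, j#} = cf (F (diag_form n m \<tau> e)) {#l, j#}"
      by (rule mpow_diffD[OF FF]) simp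
    ultimately have "cf (F (diag_form n m \<tau> e)) {#l, j#} = 0" by simp
    moreover have "cf (a i * a i) {#l, j#} = 0" if "i \<in> ?V" for i
      using cf_mult_pair[OF _ l j(2) a[OF that] a[OF that]] False
      by (simp add: char2_add_self[OF char] mult.commute)
    moreover have "cf (a (2 * k - 1) * a (2 * k)) {#l, j#} = cf (a (2 * k - 1)) {#l#} * cf (a (2 * k)) {#j#}
      + cf (a (2 * k - 1)) {#j#} * cf (a (2 * k)) {#l#}" if "k \<in> {1..m}" for k
      using cf_mult_pair[OF _ l j(2) a[OF pair(1)[OF that]] a[OF pair(2)[OF that]]] False by simp
    ultimately show ?thesis
      unfolding diag_form_image[OF E m] a_def[symmetric] by simp
  qed
  define pt :: "nat \<Rightarrow> nat" where "pt i = (if odd i then i + 1 else i - 1)" for i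
  define c where "c i = \<tau> ((i + 1) div 2) * cf (a (pt i)) {#j#}" for i
  \<comment> \<open>\<open>u\<close> bundles \<open>zero\<close> for all \<open>l\<close> into one
    statement, that \<open>F u\<close> has no linear part. As \<open>F\<close> is invertible,
    \<open>u\<close> has none either, so each \<open>c i\<close> vanishes, and \<open>\<tau>\<close>
    can be cancelled.\<close>
  define u where "u = (\<Sum>i\<in>{1..2 * m}. Con (c i) * X i)"
  have sub: "i \<in> ?V" if "i \<in> {1..2 * m}" for i using that m by auto
  have u: "u \<in> mpow ?V (Suc 0)"
    unfolding u_def using sub by (intro mpow_sum mpow_Con_mult) (auto intro: mpow_X)
  have Fu: "F u = (\<Sum>i\<in>{1..2 * m}. Con (c i) * a i)"
    unfolding u_def a_def using sub
    by (subst alg_endo_sum[OF E]) (auto intro!: mpow_Con_mult X_ser sum.cong simp: alg_endo_simps(3)[OF E X_ser])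
  have "cf (F u) {#l#} = 0" if l: "l \<in> ?V" for l
  proof -
    have "cf (F u) {#l#} = (\<Sum>i\<in>{1..2 * m}. c i * cf (a i) {#l#})"
      by (simp add: Fu)
    also have "\<dots> = (\<Sum>k\<in>{1..m}. c (2 * k - 1) * cf (a (2 * k - 1)) {#l#} + c (2 * k) * cf (a (2 * k)) {#l#})"
      by (rule sum_pairs[symmetric])
    also have "\<dots> = (\<Sum>k\<in>{1..m}. \<tau> k * (cf (a (2 * k - 1)) {#l#} * cf (a (2 * k)) {#j#}
      + cf (a (2 * k - 1)) {#j#} * cf (a (2 * k)) {#l#}))"
    proof (rule sum.cong[OF refl])
      fix k assume "k \<in> {1..m}"
      then have "2 * k - 1 + 1 = 2 * k" "(2 * k + 1) div 2 = k" "odd (2 * k - 1)" by auto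
      then have "c (2 * k - 1) = \<tau> k * cf (a (2 * k)) {#j#}" "c (2 * k) = \<tau> k * cf (a (2 * k - 1)) {#j#}"
        by (simp_all add: c_def pt_def)
      then show "c (2 * k - 1) * cf (a (2 * k - 1)) {#l#} + c (2 * k) * cf (a (2 * k)) {#l#}
          = \<tau> k * (cf (a (2 * k - 1)) {#l#} * cf (a (2 * k)) {#j#} + cf (a (2 * k - 1)) {#j#} * cf (a (2 * k)) {#l#})"
        by (simp add: algebra_simps)
    qed
    finally show ?thesis using zero[OF l] by simp
  qed
  then have "(\<Sum>l\<in>?V. Con (cf (F u) {#l#}) * X l) = 0"
    by (intro sum.neutral) (auto simp: Con_simps)
  moreover have "F u \<in> mpow ?V (Suc 0)" using alg_auto_mpow[OF _ F u] by simp
  ultimately have Fu2: "F u \<in> mpow ?V 2"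
    using mpow_linear_part[of ?V "F u"] by simp
  obtain G where G: "alg_auto ?V G" "\<And>f. f \<in> ser ?V \<Longrightarrow> G (F f) = f"
    using alg_auto_inv[OF F] by metis
  have "u \<in> mpow ?V 2"
    using alg_auto_mpow[OF _ G(1) Fu2] G(2)[OF mpow_ser[OF u]] by simp
  then have "cf u {#p#} = 0" for p by (rule mpowD) simp
  then have c0: "c p = 0" if "p \<in> {1..2 * m}" for p
    using cf_linear_sum[of "{1..2 * m}" c p] that unfolding u_def by simp
  have "pt i \<in> {1..2 * m} \<and> pt (pt i) = i \<and> (pt i + 1) div 2 \<in> {1..m}"
    using i unfolding pt_def atLeastAtMost_iff by (cases "odd i") (simp_all, presburger+)
  then show ?thesis using c0[of "pt i"] \<tau>[of "(pt i + 1) div 2"] by (simp add: c_def a_def)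
qed


text \<open>The mixed term of the square is doubled and disappears, so the precision becomes order
  four even if \<open>f\<close> and \<open>g\<close> have order one, where order three would be
  expected.\<close>

lemma square_cong_char2:
  fixes f g :: "'a::field mps"
  assumes char: "CHAR('a) = 2" and "f - g \<in> mpow V 2"
  shows "f * f - g * g \<in> mpow V 4"
proof -
  have "f * f - g * g = (f - g) * (f - g) + (g * (f - g) + g * (f - g))"
    by (simp add: algebra_simps)
  then have "f * f - g * g = (f - g) * (f - g)"
    by (simp only: char2_mps_add_self[OF char] add_0_right)
  then show ?thesis using mpow_mult[OF assms(2) assms(2)] by simp
qed

text \<open>
  Modulo terms of order four, the restriction of \<open>F g\<close> to the radical only depends on the restriction
  of \<open>g\<close> and of the linear part of \<open>F\<close>; the square terms are unaffected by the quadratic part of \<open>F\<close>,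
  as the characteristic is two.
\<close>

lemma restriction_to_radical:
  fixes F :: "'a::field mps \<Rightarrow> 'a mps"
  assumes char: "CHAR('a) = 2" and m: "2 * m \<le> n" and F: "alg_auto (vars n) F"
    and \<tau>: "\<And>k. k \<in> {1..m} \<Longrightarrow> \<tau> k \<noteq> 0"
    and g: "g - diag_form n m \<tau> e \<in> mpow (vars n) 3"
    and g': "g' - diag_form n m \<tau>' e' \<in> mpow (vars n) 3"
    and Fg: "F g - g' \<in> mpow (vars n) 4"
    and size: "set_mset w \<subseteq> {2 * m + 1..n}" "size w < 4"
  defines "l \<equiv> \<lambda>i. \<Sum>j\<in>{2 * m + 1..n}. Con (cf (F (X i)) {#j#}) * X j"
  shows "cf g' w = (\<Sum>i\<in>{2 * m + 1..n}. e i * cf (l i * l i) w)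
    + cf (subst_series (vars n) (\<lambda>i. if i \<in> {2 * m + 1..n} then l i else 0)
        (restrict_vars {2 * m + 1..n} (g - diag_form n m \<tau> e))) w"
proof -
  let ?V = "vars n" and ?R = "{2 * m + 1..n}"
  let ?d = "diag_form n m \<tau> e"
  let ?H = "restrict_vars ?R \<circ> F"
  let ?S = "subst_series ?V (\<lambda>i. if i \<in> ?R then l i else 0)"
  note E = alg_auto_endo[OF F]
  have RV: "?R \<subseteq> ?V" by auto
  have l: "l i \<in> mpow ?V (Suc 0)" for i
    unfolding l_def using RV by (intro mpow_sum mpow_Con_mult) (auto intro: mpow_X)
  have a: "(if i \<in> ?R then l i else 0) \<in> mpow ?V (Suc 0)" for i using l by simp
  have S: "local_endo ?V ?S" by (rule local_endo_subst[OF finite_atLeastAtMost a])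
  have SX: "?S (X i) = (if i \<in> ?R then l i else 0)" if "i \<in> ?V" for i
    using subst_series_X[of ?V _ ?V, OF _ a that] by simp
  have H: "local_endo ?V ?H"
    by (intro local_endo_comp local_endo_restrict alg_auto_local F) simp
  note EH = local_endo_alg[OF H] and ES = local_endo_alg[OF S]
  have dh: "?d \<in> mpow ?V 2" using homogD[OF diag_form_homog[OF m]] .
  have gs: "g \<in> ser ?V" using mpow_add[OF mpow_ser[OF g] mpow_ser[OF dh]] by simp
  have g's: "g' \<in> ser ?V"
    using mpow_diff[OF alg_endoD(1)[OF E gs] mpow_ser[OF Fg]] by simp
  have Fd': "F g - diag_form n m \<tau>' e' \<in> mpow ?V 3"
    using mpow_add[OF mpow_mono[OF Fg, of 3 ?V] g'] by simp
  have HS: "?H (X i) - ?S (X i) \<in> mpow ?V 2" if i: "i \<in> ?V" for i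
  proof -
    have FX: "F (X i) \<in> mpow ?V (Suc 0)" using alg_auto_local[OF F] i by (simp add: local_endo_def)
    have "restrict_vars ?R (\<Sum>j\<in>?V. Con (cf (F (X i)) {#j#}) * X j) = l i"
    proof -
      have "restrict_vars ?R (\<Sum>j\<in>?V. Con (cf (F (X i)) {#j#}) * X j)
          = (\<Sum>j\<in>?V. restrict_vars ?R (Con (cf (F (X i)) {#j#}) * X j))"
        by (intro alg_endo_sum[OF local_endo_alg[OF local_endo_restrict[of ?V]]] mpow_Con_mult X_ser)
      also have "\<dots> = (\<Sum>j\<in>?V. Con (cf (F (X i)) {#j#}) * (if j \<in> ?R then X j else 0))"
        by (simp only: restrict_vars_Con_mult restrict_vars_X)
      also have "\<dots> = l i"
        unfolding l_def using RV by (intro sum.mono_neutral_cong_right) auto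
      finally show ?thesis .
    qed
    then have "?H (X i) - l i \<in> mpow ?V 2"
      using restrict_vars_mpow'[OF mpow_linear_part[OF _ FX], of ?R] by (simp add: restrict_vars_diff)
    \<comment> \<open>Outside the radical this means that \<open>l i\<close> is zero, which is
      \<open>radical_preserved\<close>.\<close>
    moreover have "l i = ?S (X i)"
    proof (cases "i \<in> ?R")
      case False
      then have "i \<in> {1..2 * m}" using i by auto
      then have "cf (F (X i)) {#j#} = 0" if "j \<in> ?R" for j
        using that by (intro radical_preserved[OF char m F \<tau> g Fd']) auto
      then show ?thesis using SX[OF i] False by (auto simp: l_def Con_simps intro!: sum.neutral)
    next
      case True
      then show ?thesis unfolding SX[OF i] by simp
    qed
    ultimately show ?thesis by simp
  qed
  have cubic: "?H (g - ?d) - ?S (g - ?d) \<in> mpow ?V (3 + 1)"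
    using HS by (intro local_endo_cong_strong[OF _ H S _ g]) (auto simp: numeral_2_eq_2 One_nat_def)
  have S0: "?S (X i) = 0" if "i \<in> {1..2 * m}" for i
    using that m by (subst SX) auto
  \<comment> \<open>On the radical both factors of a hyperbolic product have order two, so the
    product has order four; the squares are covered by \<open>square_cong_char2\<close>.\<close>
  have "?H ?d - ?S ?d \<in> mpow ?V 4"
  proof -
    have "?H ?d - ?S ?d = (\<Sum>k\<in>{1..m}. Con (\<tau> k) * (?H (X (2 * k - 1)) * ?H (X (2 * k)) - ?S (X (2 * k - 1)) * ?S (X (2 * k))))
      + (\<Sum>i\<in>vars n. Con (e i) * (?H (X i) * ?H (X i) - ?S (X i) * ?S (X i)))"
      unfolding diag_form_image[OF EH m] diag_form_image[OF ES m]
      by (simp add: sum_subtractf right_diff_distrib)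
    moreover have "?H (X (2 * k - 1)) * ?H (X (2 * k)) - ?S (X (2 * k - 1)) * ?S (X (2 * k)) \<in> mpow ?V 4"
      if "k \<in> {1..m}" for k
    proof -
      have k: "2 * k - 1 \<in> {1..2 * m}" "2 * k \<in> {1..2 * m}" using that by auto
      then have "?H (X (2 * k - 1)) \<in> mpow ?V 2" "?H (X (2 * k)) \<in> mpow ?V 2"
        using HS[of "2 * k - 1"] HS[of "2 * k"] S0[OF k(1)] S0[OF k(2)] m by auto
      note mpow_mult[OF this]
      moreover have "(2 :: nat) + 2 = 4" by simp
      ultimately show ?thesis by (simp only: S0[OF k(1)] mult_zero_left diff_zero)
    qed
    moreover have "?H (X i) * ?H (X i) - ?S (X i) * ?S (X i) \<in> mpow ?V 4" if "i \<in> ?V" for i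
      by (rule square_cong_char2[OF char HS[OF that]])
    ultimately show ?thesis by (auto intro!: mpow_add mpow_sum mpow_Con_mult)
  qed
  with cubic have "?H (g - ?d) - ?S (g - ?d) + (?H ?d - ?S ?d) \<in> mpow ?V 4"
    by (intro mpow_add) simp_all
  then have "?H g - ?S g \<in> mpow ?V 4"
    using alg_endo_simps(5)[OF EH gs mpow_ser[OF dh]] alg_endo_simps(5)[OF ES gs mpow_ser[OF dh]]
    by simp
  moreover have "?H g - restrict_vars ?R g' \<in> mpow ?V 4"
    using restrict_vars_mpow'[OF Fg, of ?R] by (simp add: restrict_vars_diff)
  ultimately have "restrict_vars ?R g' - ?S g \<in> mpow ?V 4"
    using mpow_diff by fastforce
  from mpow_diffD[OF this size(2)] have "cf g' w = cf (?S g) w"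
    using size(1) by (simp add: restrict_vars_def)
  moreover have "?S g = ?S ?d + ?S (g - ?d)"
  proof -
    have "?d + (g - ?d) = g" by simp
    then show ?thesis by (subst subst_series_add[symmetric]) (simp only:)
  qed
  moreover have "cf (?S ?d) w = (\<Sum>i\<in>?R. e i * cf (l i * l i) w)"
  proof -
    have "?S ?d = (\<Sum>i\<in>?V. Con (e i) * (?S (X i) * ?S (X i)))"
      unfolding diag_form_image[OF ES m] using S0 by (auto intro!: sum.neutral)
    also have "\<dots> = (\<Sum>i\<in>?R. Con (e i) * (l i * l i))"
      using RV SX by (intro sum.mono_neutral_cong_right) auto
    finally show ?thesis by simp
  qed
  \<comment> \<open>Each discarded monomial contains a variable outside the radical, which
    \<open>?S\<close> sends to zero.\<close>
  moreover have "?S (g - ?d) = ?S (restrict_vars ?R (g - ?d))"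
  proof -
    let ?h = "g - ?d"
    have "(\<Sum>i\<in>?V - ?R. X i * quot_var (?V - ?R) i ?h) = ?h - restrict_vars (- (?V - ?R)) ?h"
      by (rule quot_var_sum) simp
    moreover have "restrict_vars (- (?V - ?R)) ?h = restrict_vars ?R ?h"
      using mpow_ser[OF g] unfolding ser_iff by (intro mps_eqI) (auto simp: restrict_vars_def)
    ultimately have "?h = restrict_vars ?R ?h + (\<Sum>i\<in>?V - ?R. X i * quot_var (?V - ?R) i ?h)"
      by simp
    moreover have "?S (\<Sum>i\<in>?V - ?R. X i * quot_var (?V - ?R) i ?h) = 0"
      unfolding subst_series_sum using S0 subst_series_mult[of ?V _ ?V, OF _ a]
      by (intro sum.neutral) auto
    moreover have "?S (restrict_vars ?R ?h + (\<Sum>i\<in>?V - ?R. X i * quot_var (?V - ?R) i ?h))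
        = ?S (restrict_vars ?R ?h) + ?S (\<Sum>i\<in>?V - ?R. X i * quot_var (?V - ?R) i ?h)"
      by (rule subst_series_add)
    ultimately show ?thesis by (simp only: add_0_right)
  qed
  ultimately show ?thesis by simp
qed

section \<open>Invariants of the cubic part on the radical\<close>

definition rank_max :: "nat \<Rightarrow> nat" where
  "rank_max n = (n - 1) div 2"

text \<open>\<open>rank_max n\<close> is the largest \<open>m\<close> with \<open>2 * m < n\<close>,
  so the radical has dimension one for odd and two for even \<open>n\<close>. In the even case
  \<open>e n = 0\<close> puts the last coordinate axis into the zero set of the quadratic form on
  the radical.\<close>

definition degenerate :: "nat \<Rightarrow> 'a::field mps \<Rightarrow> bool" where
  "degenerate n g \<longleftrightarrow> (\<exists>\<tau> e. (\<forall>k\<in>{1..rank_max n}. \<tau> k \<noteq> 0) \<and> (even n \<longrightarrow> e n = 0) \<and>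
    g - diag_form n (rank_max n) \<tau> e \<in> mpow (vars n) 3)"

lemma cf_three_eqI:
  assumes "f \<in> mpow V 3" "g \<in> mpow V 3" "\<And>m. size m = 3 \<Longrightarrow> cf f m = cf g m"
  shows "f - g \<in> mpow V 4"
proof (rule mpow_diffI)
  fix m :: monom assume "size m < 4"
  then consider "size m < 3" | "size m = 3" by linarith
  then show "cf f m = cf g m"
    using assms mpowD[OF assms(1), of m] mpowD[OF assms(2), of m] by cases auto
qed (use assms mpow_ser in auto)

lemma size_3_mset:
  assumes "size m = 3" "set_mset m \<subseteq> {y, z}"
  shows "m = {#y, y, y#} \<or> m = {#y, y, z#} \<or> m = {#y, z, z#} \<or> m = {#z, z, z#}"
proof -
  have "size m = Suc 2" using assms(1) by simp
  then obtain i m' where i: "m = {#i#} + m'" "size m' = 2" by (rule size_mset_SucE)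
  then obtain j k where "m' = {#j, k#}" using size_2_mset by blast
  with i assms(2) show ?thesis by (auto simp: add_mset_commute)
qed

text \<open>On the one-dimensional radical the linear part of \<open>F\<close> is multiplication by
  some \<open>A\<close>, and no other part of \<open>F\<close> reaches the two coefficients.\<close>

lemma odd_invariants:
  fixes F :: "'a::field mps \<Rightarrow> 'a mps"
  assumes char: "CHAR('a) = 2" and n: "odd n" and F: "alg_auto (vars n) F"
    and g: "degenerate n g" and g': "degenerate n g'" and Fg: "F g - g' \<in> mpow (vars n) 4"
  shows "\<exists>A. cf g' {#n, n#} = A\<^sup>2 * cf g {#n, n#} \<and> cf g' {#n, n, n#} = A ^ 3 * cf g {#n, n, n#}"
proof -
  define m where "m = rank_max n"
  have m: "2 * m + 1 = n" using n by (auto simp: m_def rank_max_def elim!: oddE)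
  have mn: "2 * m \<le> n" "2 * m < n" and nV: "n \<in> vars n" and R: "{2 * m + 1..n} = {n}" using m by auto
  obtain \<tau> e where \<tau>: "\<And>k. k \<in> {1..m} \<Longrightarrow> \<tau> k \<noteq> 0" and gd: "g - diag_form n m \<tau> e \<in> mpow (vars n) 3"
    using g unfolding degenerate_def m_def by blast
  obtain \<tau>' e' where gd': "g' - diag_form n m \<tau>' e' \<in> mpow (vars n) 3"
    using g' unfolding degenerate_def m_def by blast
  define A where "A = cf (F (X n)) {#n#}"
  let ?h = "restrict_vars {n} (g - diag_form n m \<tau> e)" and ?l = "Con A * X n :: 'a mps"
  let ?S = "subst_series (vars n) (\<lambda>i. if i \<in> {n} then Con (cf (F (X i)) {#n#}) * X n else 0)"
  have main: "cf g' w = e n * cf (?l * ?l) w + cf (?S ?h) w" if "set_mset w \<subseteq> {n}" "size w < 4" for w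
    using restriction_to_radical[OF char mn(1) F \<tau> gd gd' Fg, of w] that
    unfolding R by (simp add: A_def cong: if_cong)
  have en: "e n = cf g {#n, n#}"
    using cf_diag_form_square[OF mn(2) nV, of \<tau> e] mpow_diffD[OF gd, of "{#n, n#}"] by simp
  have l: "(if i \<in> {n} then Con (cf (F (X i)) {#n#}) * X n else 0) \<in> mpow (vars n) (Suc 0)" for i
    using mpow_X[OF nV] by (auto intro: mpow_Con_mult)
  have h3: "?h \<in> mpow (vars n) 3" by (rule restrict_vars_mpow'[OF gd])
  have c: "cf (g - diag_form n m \<tau> e) {#n, n, n#} = cf g {#n, n, n#}"
    using diag_form_homog[OF mn(1), of \<tau> e] unfolding homog_def by fastforce
  have S: "local_endo (vars n) ?S" by (rule local_endo_subst[OF finite_atLeastAtMost l])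
  have "cf (?S ?h) {#n, n#} = 0"
    by (rule mpowD[OF local_endo_mpow[OF finite_atLeastAtMost S h3]]) simp
  then have 2: "cf g' {#n, n#} = A\<^sup>2 * cf g {#n, n#}"
    using main[of "{#n, n#}"] en by (simp add: cf_X_mult cf_X power2_eq_square mult.assoc mult.left_commute[of "X n"])
  let ?c = "cf g {#n, n, n#}"
  let ?P = "Con ?c * (X n * (X n * X n)) :: 'a mps"
  have "?h - ?P \<in> mpow (vars n) 4"
  proof (rule cf_three_eqI[OF h3])
    have "X n * (X n * X n) \<in> mpow (vars n) (Suc 0 + (Suc 0 + Suc 0))"
      using mpow_X[OF nV] by (intro mpow_mult)
    then show "?P \<in> mpow (vars n) 3" by (intro mpow_Con_mult) (simp add: numeral_3_eq_3)
    fix w :: monom assume "size w = 3"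
    show "cf ?h w = cf ?P w"
    proof (cases "set_mset w \<subseteq> {n}")
      case True
      then have "w = {#n, n, n#}" using size_3_mset[of w n n] \<open>size w = 3\<close> by auto
      then show ?thesis using c by (simp add: restrict_vars_def cf_X_mult cf_X)
    next
      case False
      have "?P \<in> ser {n}" by (intro mpow_Con_mult mpow_mult_left X_ser) auto
      then have "cf ?P w = 0" using False unfolding ser_iff by blast
      then show ?thesis using False by (simp add: restrict_vars_def)
    qed
  qed
  from local_endo_mpow[OF finite_atLeastAtMost S this] have "cf (?S (?h - ?P)) {#n, n, n#} = 0"
    by (rule mpowD) simp
  moreover have "?S ?h = ?S (?h - ?P) + ?S ?P"
    by (subst subst_series_add[symmetric]) (simp only: diff_add_cancel)
  then have "cf (?S ?h) {#n, n, n#} = cf (?S (?h - ?P)) {#n, n, n#} + cf (?S ?P) {#n, n, n#}"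
    by (simp only: cf_simps)
  ultimately have "cf (?S ?h) {#n, n, n#} = cf (?S ?P) {#n, n, n#}"
    by (simp only: add_0)
  also have "?S ?P = Con ?c * (?l * (?l * ?l))"
  proof -
    let ?a = "\<lambda>i. if i \<in> {n} then Con (cf (F (X i)) {#n#}) * X n else 0"
    have "?S (X n) = ?l"
      using subst_series_X[where a = ?a and W = "vars n", OF finite_atLeastAtMost l nV] by (simp add: A_def)
    then show ?thesis
      using subst_series_mult[where a = ?a and W = "vars n" and V = "vars n", OF finite_atLeastAtMost l]
      by (simp only: subst_series_Con[OF finite_atLeastAtMost])
  qed
  also have "\<dots> = Con (?c * A ^ 3) * (X n * (X n * X n))"
    by (simp add: Con_simps power3_eq_cube algebra_simps)
  also have "cf \<dots> {#n, n, n#} = A ^ 3 * ?c" by (simp add: cf_X_mult cf_X)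
  finally have "cf g' {#n, n, n#} = A ^ 3 * ?c"
    using main[of "{#n, n, n#}"] by (simp add: cf_X_mult cf_X mult.assoc mult.left_commute[of "X n"])
  with 2 show ?thesis by blast
qed

text \<open>The combination of cubic coefficients is the square root of the discriminant of the
  binary cubic, which is a square in characteristic two; hence it is multiplied by the cube of the
  determinant \<open>a * d\<close> of the triangular substitution on the radical. The coefficient of
  the cube of \<open>X n\<close> is the value of the cubic on the preserved axis.\<close>

lemma even_invariants:
  fixes F :: "'a::field mps \<Rightarrow> 'a mps"
  assumes char: "CHAR('a) = 2" and n: "even n" "2 \<le> n" and y: "y = n - 1" and F: "alg_auto (vars n) F"
    and g: "degenerate n g" and g': "degenerate n g'" and Fg: "F g - g' \<in> mpow (vars n) 4"
    and q: "cf g {#y, y#} \<noteq> 0"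
  shows "\<exists>a d. cf g' {#y, y#} = a\<^sup>2 * cf g {#y, y#} \<and> cf g' {#n, n, n#} = d ^ 3 * cf g {#n, n, n#} \<and>
    cf g' {#y, y, y#} * cf g' {#n, n, n#} + cf g' {#y, y, n#} * cf g' {#y, n, n#}
    = a ^ 3 * d ^ 3 * (cf g {#y, y, y#} * cf g {#n, n, n#} + cf g {#y, y, n#} * cf g {#y, n, n#})"
proof -
  define m where "m = rank_max n"
  have m: "2 * m + 2 = n" using n unfolding m_def rank_max_def by presburger
  have mn: "2 * m \<le> n" "2 * m < n" "2 * m < y" and nV: "n \<in> vars n" and yV: "y \<in> vars n"
    and yn: "y \<noteq> n" "n \<noteq> y" and R: "{2 * m + 1..n} = {y, n}"
    using m y by auto
  obtain \<tau> e where \<tau>: "\<And>k. k \<in> {1..m} \<Longrightarrow> \<tau> k \<noteq> 0" and gd: "g - diag_form n m \<tau> e \<in> mpow (vars n) 3"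
      and en: "e n = 0"
    using g n unfolding degenerate_def m_def by blast
  obtain \<tau>' e' where gd': "g' - diag_form n m \<tau>' e' \<in> mpow (vars n) 3" and en': "e' n = 0"
    using g' n unfolding degenerate_def m_def by blast
  define a b c d where "a = cf (F (X y)) {#y#}" and "b = cf (F (X y)) {#n#}"
    and "c = cf (F (X n)) {#y#}" and "d = cf (F (X n)) {#n#}"
  let ?h = "restrict_vars {y, n} (g - diag_form n m \<tau> e)"
  define l where "l i = Con (cf (F (X i)) {#y#}) * X y + Con (cf (F (X i)) {#n#}) * X n" for i
  have ly: "l y = Con a * X y + Con b * X n" and ln: "l n = Con c * X y + Con d * X n"
    by (simp_all add: l_def a_def b_def c_def d_def)
  let ?S = "subst_series (vars n) (\<lambda>i. if i \<in> {y, n} then l i else 0)"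
  have ls: "(\<Sum>j\<in>{y, n}. Con (cf (F (X i)) {#j#}) * X j) = l i" for i
    using yn(1) by (simp add: l_def)
  have main: "cf g' w = e y * cf (l y * l y) w + cf (?S ?h) w" if "set_mset w \<subseteq> {y, n}" "size w < 4" for w
    using restriction_to_radical[OF char mn(1) F \<tau> gd gd' Fg, of w] that yn(1) en
    unfolding R ls by simp
  have ey: "e y = cf g {#y, y#}"
    using cf_diag_form_square[OF mn(3) yV, of \<tau> e] mpow_diffD[OF gd, of "{#y, y#}"] by simp
  have li: "(if i \<in> {y, n} then l i else 0) \<in> mpow (vars n) (Suc 0)" for i
    using mpow_X[OF nV] mpow_X[OF yV] by (auto simp: l_def intro!: mpow_add mpow_Con_mult)
  have h3: "?h \<in> mpow (vars n) 3" by (rule restrict_vars_mpow'[OF gd])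
  have S: "local_endo (vars n) ?S" by (rule local_endo_subst[OF finite_atLeastAtMost li])
  have Sh2: "cf (?S ?h) w = 0" if "size w = 2" for w
    by (rule mpowD[OF local_endo_mpow[OF finite_atLeastAtMost S h3]]) (simp add: that)
  have lsq: "l y * l y = Con (a * a) * (X y * X y) + Con (b * b) * (X n * X n)
      + (Con (a * b) * (X y * X n) + Con (a * b) * (X y * X n))"
    by (simp add: ly Con_simps algebra_simps)
  have lsq: "l y * l y = Con (a * a) * (X y * X y) + Con (b * b) * (X n * X n)"
    unfolding lsq by (simp only: char2_mps_add_self[OF char] add_0_right)
  have "cf g' {#n, n#} = 0"
    using cf_diag_form_square[OF mn(2) nV, of \<tau>' e'] mpow_diffD[OF gd', of "{#n, n#}"] en' by simp
  \<comment> \<open>The square of \<open>X n\<close> is absent from both quadratic parts, so the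
    substitution must not bring \<open>X n\<close> into the image of \<open>X y\<close>: it is
    triangular.\<close>
  then have "e y * (b * b) = 0"
    using main[of "{#n, n#}"] Sh2[of "{#n, n#}"] yn by (simp add: lsq cf_X_mult cf_X)
  then have b0: "b = 0" using q ey by simp
  have 2: "cf g' {#y, y#} = a\<^sup>2 * cf g {#y, y#}"
    using main[of "{#y, y#}"] Sh2[of "{#y, y#}"] yn ey by (simp add: lsq cf_X_mult cf_X power2_eq_square)
  have ly': "l y = Con a * X y" by (simp add: ly b0 Con_simps)
  have g3: "cf (g - diag_form n m \<tau> e) w = cf g w" if "size w = 3" for w
    using diag_form_homog[OF mn(1), of \<tau> e] that unfolding homog_def by fastforce
  define \<alpha> \<beta> \<gamma> \<delta> where "\<alpha> = cf g {#y, y, y#}" and "\<beta> = cf g {#y, y, n#}"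
    and "\<gamma> = cf g {#y, n, n#}" and "\<delta> = cf g {#n, n, n#}"
  let ?yyy = "X y * (X y * X y) :: 'a mps" and ?yyn = "X y * (X y * X n) :: 'a mps"
    and ?ynn = "X y * (X n * X n) :: 'a mps" and ?nnn = "X n * (X n * X n) :: 'a mps"
  let ?P = "Con \<alpha> * ?yyy + Con \<beta> * ?yyn + Con \<gamma> * ?ynn + Con \<delta> * ?nnn"
  have "?h - ?P \<in> mpow (vars n) 4"
  proof (rule cf_three_eqI[OF h3])
    have "X i * (X j * X k) \<in> mpow (vars n) 3" if "i \<in> vars n" "j \<in> vars n" "k \<in> vars n" for i j k
    proof -
      have "X i * (X j * X k) \<in> mpow (vars n) (Suc 0 + (Suc 0 + Suc 0))"
        using that by (intro mpow_mult) (auto intro: mpow_X)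
      then show ?thesis by (simp add: numeral_3_eq_3)
    qed
    then show "?P \<in> mpow (vars n) 3" using nV yV by (intro mpow_add mpow_Con_mult)
    fix w :: monom assume w: "size w = 3"
    show "cf ?h w = cf ?P w"
    proof (cases "set_mset w \<subseteq> {y, n}")
      case True
      have h: "cf ?h w = cf g w" using True g3[OF w] by (simp add: restrict_vars_def)
      from size_3_mset[OF w True] show ?thesis unfolding h
        using yn by (elim disjE) (simp_all add: cf_X_mult cf_X \<alpha>_def \<beta>_def \<gamma>_def \<delta>_def)
    next
      case False
      have "X i * (X j * X k) \<in> (ser {y, n} :: 'a mps set)" if "i \<in> {y, n}" "j \<in> {y, n}" "k \<in> {y, n}" for i j k
        by (intro mpow_mult_left X_ser that)
      then have "cf (X i * (X j * X k) :: 'a mps) w = 0" if "i \<in> {y, n}" "j \<in> {y, n}" "k \<in> {y, n}" for i j k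
        using that False unfolding ser_iff by blast
      then show ?thesis using False by (simp add: restrict_vars_def)
    qed
  qed
  note P = local_endo_mpow[OF finite_atLeastAtMost S this]
  have S3: "cf (?S ?h) w = cf (?S ?P) w" if "size w = 3" for w
  proof -
    have "cf (?S (?h - ?P)) w = 0" by (rule mpowD[OF P]) (simp add: that)
    moreover have "?S ?h = ?S (?h - ?P) + ?S ?P"
      by (subst subst_series_add[symmetric]) (simp only: diff_add_cancel)
    then have "cf (?S ?h) w = cf (?S (?h - ?P)) w + cf (?S ?P) w"
      by (simp only: cf_simps)
    ultimately show ?thesis by (simp only: add_0)
  qed
  have two: "(2 :: 'a) = 0" using char2_add_self[OF char, of 1] by simp
  have three: "(3 :: 'a) = 1" using two by (metis add_0 numeral_plus_one semiring_norm(5))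
  have SX: "?S (X y) = l y" "?S (X n) = l n"
    using subst_series_X[where a = "\<lambda>i. if i \<in> {y, n} then l i else 0" and W = "vars n", OF finite_atLeastAtMost li nV]
      subst_series_X[where a = "\<lambda>i. if i \<in> {y, n} then l i else 0" and W = "vars n", OF finite_atLeastAtMost li yV]
    by simp_all
  note Smult = subst_series_mult[where a = "\<lambda>i. if i \<in> {y, n} then l i else 0" and W = "vars n" and V = "vars n",
      OF finite_atLeastAtMost li]
  have "?S ?P = Con \<alpha> * (l y * (l y * l y)) + Con \<beta> * (l y * (l y * l n))
      + Con \<gamma> * (l y * (l n * l n)) + Con \<delta> * (l n * (l n * l n))"
    by (simp only: subst_series_add Smult subst_series_Con[OF finite_atLeastAtMost] SX)
  also have "\<dots> = Con (\<alpha> * a ^ 3 + \<beta> * a\<^sup>2 * c + \<gamma> * a * c\<^sup>2 + \<delta> * c ^ 3) * ?yyy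
      + Con (\<beta> * a\<^sup>2 * d + (\<gamma> * a * c * d + \<gamma> * a * c * d) + (\<delta> * c\<^sup>2 * d + \<delta> * c\<^sup>2 * d + \<delta> * c\<^sup>2 * d)) * ?yyn
      + Con (\<gamma> * a * d\<^sup>2 + (\<delta> * c * d\<^sup>2 + \<delta> * c * d\<^sup>2 + \<delta> * c * d\<^sup>2)) * ?ynn
      + Con (\<delta> * d ^ 3) * ?nnn"
    unfolding ly' ln power2_eq_square power3_eq_cube Con_simps by (simp add: algebra_simps)
  finally have SP: "?S ?P = \<dots>" .
  have cube: "cf (l y * l y) w = 0" if "size w = 3" for w
  proof -
    have "l y * l y = Con (a * a) * (X y * X y)" by (simp add: lsq b0 Con_simps)
    then show ?thesis using that by (auto simp: cf_X_mult cf_X dest!: multi_member_split)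
  qed
  have 3: "cf g' w = cf (?S ?P) w" if "size w = 3" "set_mset w \<subseteq> {y, n}" for w
    using main[of w] S3[of w] cube[of w] that by simp
  have yyy: "cf g' {#y, y, y#} = \<alpha> * a ^ 3 + \<beta> * a\<^sup>2 * c + \<gamma> * a * c\<^sup>2 + \<delta> * c ^ 3"
    using 3[of "{#y, y, y#}"] yn unfolding SP by (simp add: cf_X_mult cf_X)
  have yyn: "cf g' {#y, y, n#} = \<beta> * a\<^sup>2 * d + \<delta> * c\<^sup>2 * d"
    using 3[of "{#y, y, n#}"] yn unfolding SP by (simp add: cf_X_mult cf_X char2_add_self[OF char] two three)
  have ynn: "cf g' {#y, n, n#} = \<gamma> * a * d\<^sup>2 + \<delta> * c * d\<^sup>2"
    using 3[of "{#y, n, n#}"] yn unfolding SP by (simp add: cf_X_mult cf_X char2_add_self[OF char] two three)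
  have nnn: "cf g' {#n, n, n#} = \<delta> * d ^ 3"
    using 3[of "{#n, n, n#}"] yn unfolding SP by (simp add: cf_X_mult cf_X)
  have "cf g' {#y, y, y#} * cf g' {#n, n, n#} + cf g' {#y, y, n#} * cf g' {#y, n, n#}
    = a ^ 3 * d ^ 3 * (\<alpha> * \<delta> + \<beta> * \<gamma>)
      + 2 * (\<delta> * d ^ 3 * (\<beta> * a\<^sup>2 * c + \<gamma> * a * c\<^sup>2 + \<delta> * c ^ 3))"
    unfolding yyy yyn ynn nnn by (simp add: power2_eq_square power3_eq_cube algebra_simps)
  then have "cf g' {#y, y, y#} * cf g' {#n, n, n#} + cf g' {#y, y, n#} * cf g' {#y, n, n#}
    = a ^ 3 * d ^ 3 * (\<alpha> * \<delta> + \<beta> * \<gamma>)"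
    by (simp add: two)
  with 2 nnn show ?thesis
    unfolding \<alpha>_def \<beta>_def \<gamma>_def \<delta>_def by (intro exI[of _ a] exI[of _ d]) (simp add: mult.commute)
qed

text \<open>The index \<open>z\<close> is \<open>n\<close> for odd and \<open>n - 1\<close> for even
  \<open>n\<close>: it is the first variable of the radical, the one whose square may occur in the
  quadratic form on it.\<close>

definition inv_sq :: "nat \<Rightarrow> 'a::field mps \<Rightarrow> 'a" where
  "inv_sq n g = (let z = 2 * rank_max n + 1 in cf g {#z, z#})"

text \<open>The value of the cubic on the preserved axis of a two-dimensional radical. For odd
  \<open>n\<close> there is no such axis, and \<open>1\<close> lets both parities share the formula
  for the invariant.\<close>

definition inv_den :: "nat \<Rightarrow> 'a::field mps \<Rightarrow> 'a" where
  "inv_den n g = (if odd n then 1 else cf g {#n, n, n#})"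

text \<open>For even \<open>n\<close>, the square root of the discriminant of the cubic on the
  radical.\<close>

definition inv_num :: "nat \<Rightarrow> 'a::field mps \<Rightarrow> 'a" where
  "inv_num n g = (let z = 2 * rank_max n + 1 in if odd n then cf g {#z, z, z#}
     else cf g {#z, z, z#} * cf g {#n, n, n#} + cf g {#z, z, n#} * cf g {#z, n, n#})"

lemma rank_max_odd: "odd n \<Longrightarrow> 2 * rank_max n + 1 = n"
  by (auto simp: rank_max_def elim!: oddE)

lemma rank_max_even: "even n \<Longrightarrow> 2 \<le> n \<Longrightarrow> 2 * rank_max n + 2 = n"
  unfolding rank_max_def by presburger

text \<open>Hence \<open>inv_num\<^sup>2 / (inv_den\<^sup>2 * inv_sq\<^sup>3)\<close> is an invariant.\<close>

lemma invariant_ratio: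
  fixes F :: "'a::field mps \<Rightarrow> 'a mps"
  assumes char: "CHAR('a) = 2" and n: "2 \<le> n" and F: "alg_auto (vars n) F"
    and g: "degenerate n g" and g': "degenerate n g'" and Fg: "F g - g' \<in> mpow (vars n) 4"
    and q: "inv_sq n g \<noteq> 0"
  shows "(inv_num n g')\<^sup>2 * ((inv_den n g)\<^sup>2 * inv_sq n g ^ 3)
    = (inv_num n g)\<^sup>2 * ((inv_den n g')\<^sup>2 * inv_sq n g' ^ 3)"
proof (cases "odd n")
  case True
  then obtain A where "cf g' {#n, n#} = A\<^sup>2 * cf g {#n, n#}" "cf g' {#n, n, n#} = A ^ 3 * cf g {#n, n, n#}"
    using odd_invariants[OF char _ F g g' Fg] by blast
  with True show ?thesis
    unfolding inv_num_def inv_den_def inv_sq_def Let_def rank_max_odd[OF True]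
    by (simp add: power_mult_distrib flip: power_mult)
next
  case False
  define y where "y = n - 1"
  have y: "2 * rank_max n + 1 = y" using rank_max_even[of n] False n by (simp add: y_def)
  have q': "cf g {#y, y#} \<noteq> 0" using q by (simp add: inv_sq_def y)
  obtain a d where *: "cf g' {#y, y#} = a\<^sup>2 * cf g {#y, y#}" "cf g' {#n, n, n#} = d ^ 3 * cf g {#n, n, n#}"
      "cf g' {#y, y, y#} * cf g' {#n, n, n#} + cf g' {#y, y, n#} * cf g' {#y, n, n#}
       = a ^ 3 * d ^ 3 * (cf g {#y, y, y#} * cf g {#n, n, n#} + cf g {#y, y, n#} * cf g {#y, n, n#})"
    using even_invariants[OF char _ n y_def F g g' Fg q'] False by blast
  have "inv_num n g' = a ^ 3 * d ^ 3 * inv_num n g"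
    using False *(3) by (simp add: inv_num_def y)
  moreover have "inv_den n g' = d ^ 3 * inv_den n g" using False *(2) by (simp add: inv_den_def)
  moreover have "inv_sq n g' = a\<^sup>2 * inv_sq n g" using *(1) by (simp add: inv_sq_def y)
  ultimately show ?thesis by (simp add: power_mult_distrib mult_ac flip: power_mult)
qed

text \<open>The missing hyperbolic pairs raise the polar form to its largest degenerate rank, the
  square makes the quadratic form on the radical nonzero for general parameters, and the cubes make
  the invariant depend on the parameter.\<close>

definition deform :: "nat \<Rightarrow> nat \<Rightarrow> 'a::field mps" where
  "deform n r = (let z = 2 * rank_max n + 1 in
    (\<Sum>k\<in>{r div 2 + 1..rank_max n}. X (2 * k - 1) * X (2 * k)) + X z * X z + X z * (X z * X z)
      + (if even n then X n * (X n * X n) else 0))"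

lemma rank_max_bounds:
  assumes "2 \<le> n" "r \<le> n" "\<not> (even n \<and> r = n)"
  shows "r div 2 \<le> rank_max n" "2 * rank_max n + 1 \<le> n"
  using assms unfolding rank_max_def by presburger+

lemma mpow_XXX:
  assumes "i \<in> V" "j \<in> V" "k \<in> V"
  shows "X i * (X j * X k) \<in> mpow V 3"
proof -
  have "X i * (X j * X k) \<in> mpow V (Suc 0 + (Suc 0 + Suc 0))"
    using assms by (intro mpow_mult) (auto intro: mpow_X)
  then show ?thesis by (simp add: numeral_3_eq_3)
qed

lemma deform_mpow:
  assumes "2 \<le> n"
  shows "deform n r \<in> mpow (vars n) (Suc 0)"
proof -
  have z: "2 * rank_max n + 1 \<in> vars n" using assms unfolding rank_max_def atLeastAtMost_iff by presburger
  have n: "n \<in> vars n" using assms by auto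
  have "X (2 * k - 1) * X (2 * k) \<in> mpow (vars n) (Suc 0)" if "k \<in> {r div 2 + 1..rank_max n}" for k
    using that z by (intro mpow_mult_left X_ser) (auto intro!: mpow_X)
  then show ?thesis
    unfolding deform_def Let_def using z n
    by (auto intro!: mpow_add mpow_sum mpow_mult_left X_ser intro: mpow_X)
qed

text \<open>The summand \<open>h\<close> leaves room for the additional cube by which small jet
  orders are excluded.\<close>

lemma degenerate_family:
  fixes f :: "'a::field mps"
  assumes n: "2 \<le> n" "r \<le> n" "\<not> (even n \<and> r = n)" and f: "f - nform n r \<in> mpow (vars n) 3"
    and t: "t \<noteq> 0" and h: "h \<in> mpow (vars n) 3"
  shows "degenerate n (f + Con t * deform n r + h)"
proof -
  let ?m = "rank_max n" and ?z = "2 * rank_max n + 1"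
  note m = rank_max_bounds[OF n]
  have zV: "?z \<in> vars n" and nV: "n \<in> vars n" using m n by auto
  define \<tau> where "\<tau> k = (if k \<le> r div 2 then 1 else t)" for k :: nat
  \<comment> \<open>The square in \<open>nform n r\<close> and the one added by
    \<open>deform\<close> can belong to the same variable, hence a sum. If not, the former lies
    inside one of the new pairs, where the polar form does not see it.\<close>
  define e where "e i = (if odd r \<and> i = r then 1 else 0) + (if i = ?z then t else 0)" for i
  let ?P = "\<lambda>k. X (2 * k - 1) * X (2 * k) :: 'a mps"
  have "{1..?m} = {1..r div 2} \<union> {r div 2 + 1..?m}" using m(1) by auto
  then have "(\<Sum>k\<in>{1..?m}. Con (\<tau> k) * ?P k)
      = (\<Sum>k\<in>{1..r div 2}. Con (\<tau> k) * ?P k) + (\<Sum>k\<in>{r div 2 + 1..?m}. Con (\<tau> k) * ?P k)"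
    by (simp only:) (rule sum.union_disjoint, auto)
  moreover have "(\<Sum>k\<in>{1..r div 2}. Con (\<tau> k) * ?P k) = hyp (r div 2)"
    unfolding hyp_def by (rule sum.cong) (auto simp: \<tau>_def Con_simps)
  moreover have "(\<Sum>k\<in>{r div 2 + 1..?m}. Con (\<tau> k) * ?P k) = Con t * (\<Sum>k\<in>{r div 2 + 1..?m}. ?P k)"
    unfolding sum_distrib_left by (rule sum.cong) (auto simp: \<tau>_def)
  ultimately have pairs: "(\<Sum>k\<in>{1..?m}. Con (\<tau> k) * ?P k) = hyp (r div 2) + Con t * (\<Sum>k\<in>{r div 2 + 1..?m}. ?P k)"
    by simp
  have "(\<Sum>i\<in>vars n. Con (e i) * (X i * X i))
      = (\<Sum>i\<in>vars n. (if i = r then if odd r then X r * X r else 0 else 0)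
        + (if i = ?z then Con t * (X ?z * X ?z) else 0) :: 'a mps)"
    by (rule sum.cong) (auto simp: e_def Con_simps distrib_right)
  also have "\<dots> = (if odd r then X r * X r else 0) + Con t * (X ?z * X ?z)"
    using zV n(2) odd_pos[of r] by (auto simp: sum.distrib)
  finally have squares: "(\<Sum>i\<in>vars n. Con (e i) * (X i * X i))
      = ((if odd r then X r * X r else 0) + Con t * (X ?z * X ?z) :: 'a mps)" .
  have "f + Con t * deform n r + h - diag_form n ?m \<tau> e
      = (f - nform n r) + (Con t * (X ?z * (X ?z * X ?z)) + Con t * (if even n then X n * (X n * X n) else 0)) + h"
    using n(2) unfolding diag_form_def pairs squares by (simp add: deform_def nform_def Let_def algebra_simps)
  also have "\<dots> \<in> mpow (vars n) 3"
    using f h zV nV by (intro mpow_add mpow_Con_mult) (auto intro!: mpow_XXX)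
  finally have "f + Con t * deform n r + h - diag_form n ?m \<tau> e \<in> mpow (vars n) 3" .
  moreover have "e n = 0" if "even n"
    using that rank_max_even[OF that n(1)] n(3) by (auto simp: e_def)
  ultimately show ?thesis
    unfolding degenerate_def using t by (intro exI[of _ \<tau>] exI[of _ e]) (auto simp: \<tau>_def)
qed

text \<open>The degrees of numerator, denominator and square coefficient are \<open>1\<close>,
  \<open>0\<close>, \<open>1\<close> for odd and \<open>2\<close>, \<open>1\<close>,
  \<open>1\<close> for even \<open>n\<close>. The inequality, \<open>2 < 3\<close> or
  \<open>4 < 5\<close>, prevents the invariant from being constant.\<close>

lemma family_invariants:
  fixes f :: "'a::field mps" and r :: nat
  assumes n: "2 \<le> n"
  defines "g \<equiv> \<lambda>t. f + Con t * deform n r"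
  obtains Pm Pd Pq where "\<And>t. inv_num n (g t) = poly Pm t" "\<And>t. inv_den n (g t) = poly Pd t"
    "\<And>t. inv_sq n (g t) = poly Pq t" "Pm \<noteq> 0" "Pd \<noteq> 0" "Pq \<noteq> 0"
    "2 * degree Pm < 2 * degree Pd + 3 * degree Pq"
proof -
  let ?z = "2 * rank_max n + 1"
  define S where "S = (\<Sum>k\<in>{r div 2 + 1..rank_max n}. X (2 * k - 1) * X (2 * k) :: 'a mps)"
  have D: "deform n r = S + X ?z * X ?z + X ?z * (X ?z * X ?z)
      + (if even n then X n * (X n * X n) else 0)"
    by (simp add: deform_def S_def Let_def)
  have pair0: "cf S w = 0"
    if "w = {#?z, ?z#} \<or> size w = 3" for w
  proof -
    have "cf (X (2 * k - 1) * X (2 * k) :: 'a mps) w = 0" if "k \<in> {r div 2 + 1..rank_max n}" for k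
      using \<open>w = {#?z, ?z#} \<or> size w = 3\<close> that
      by (auto simp: cf_X_mult cf_X dest!: multi_member_split)
    then show ?thesis by (simp add: S_def)
  qed
  have zz: "cf (g t) {#?z, ?z#} = cf f {#?z, ?z#} + t" for t
    unfolding g_def D by (simp add: pair0 cf_X_mult cf_X)
  show thesis
  proof (cases "odd n")
    case True
    have "cf (g t) {#?z, ?z, ?z#} = cf f {#?z, ?z, ?z#} + t" for t
      unfolding g_def D using True by (simp add: pair0 cf_X_mult cf_X)
    with zz True show thesis
      by (intro that[of "[:cf f {#?z, ?z, ?z#}, 1:]" "1" "[:cf f {#?z, ?z#}, 1:]"])
        (simp_all add: inv_num_def inv_den_def inv_sq_def Let_def)
  next
    case False
    then have even: "even n" by simp
    have zn: "?z \<noteq> n" "n \<noteq> ?z" using rank_max_even[OF even n] by auto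
    have zzz: "cf (g t) {#?z, ?z, ?z#} = cf f {#?z, ?z, ?z#} + t"
      and zzn: "cf (g t) {#?z, ?z, n#} = cf f {#?z, ?z, n#}"
      and znn: "cf (g t) {#?z, n, n#} = cf f {#?z, n, n#}"
      and nnn: "cf (g t) {#n, n, n#} = cf f {#n, n, n#} + t" for t
      unfolding g_def D using even zn by (simp_all add: pair0 cf_X_mult cf_X)
    let ?Pm = "[:cf f {#?z, ?z, ?z#} * cf f {#n, n, n#} + cf f {#?z, ?z, n#} * cf f {#?z, n, n#},
      cf f {#?z, ?z, ?z#} + cf f {#n, n, n#}, 1:]"
    show thesis
    proof (rule that[of ?Pm "[:cf f {#n, n, n#}, 1:]" "[:cf f {#?z, ?z#}, 1:]"])
      show "inv_num n (g t) = poly ?Pm t" for t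
        unfolding inv_num_def Let_def zzz zzn znn nnn using even by (simp add: algebra_simps)
    qed (use even in \<open>simp_all add: inv_den_def inv_sq_def Let_def nnn zz\<close>)
  qed
qed

text \<open>The ratio is cross-multiplied to avoid division. With \<open>t\<close> fixed off all
  zeros, equality for \<open>t'\<close> is a polynomial equation whose two sides have different
  degrees, so only finitely many \<open>t'\<close> satisfy it.\<close>

lemma varying_ratio:
  fixes Pm Pd Pq :: "'a::field poly"
  assumes inf: "infinite (UNIV :: 'a set)" and B: "finite B" and ne: "Pm \<noteq> 0" "Pd \<noteq> 0" "Pq \<noteq> 0"
    and deg: "2 * degree Pm < 2 * degree Pd + 3 * degree Pq"
  obtains t t' where "t \<notin> B" "t' \<notin> B" "poly Pq t \<noteq> 0"
    "(poly Pm t')\<^sup>2 * ((poly Pd t)\<^sup>2 * poly Pq t ^ 3) \<noteq> (poly Pm t)\<^sup>2 * ((poly Pd t')\<^sup>2 * poly Pq t' ^ 3)"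
proof -
  have roots: "finite {t. poly P t = 0}" if "P \<noteq> 0" for P :: "'a poly"
    using that by (rule poly_roots_finite)
  have fin: "finite (B \<union> {t. poly Pm t = 0} \<union> {t. poly Pd t = 0} \<union> {t. poly Pq t = 0})"
    using B ne roots by simp
  obtain t where "t \<notin> B \<union> {t. poly Pm t = 0} \<union> {t. poly Pd t = 0} \<union> {t. poly Pq t = 0}"
    using ex_new_if_finite[OF inf fin] by (elim exE) (rule that)
  then have t: "t \<notin> B" "poly Pm t \<noteq> 0" "poly Pd t \<noteq> 0" "poly Pq t \<noteq> 0"
    by simp_all
  define c where "c = (poly Pd t)\<^sup>2 * poly Pq t ^ 3"
  define d where "d = (poly Pm t)\<^sup>2"
  have cd: "c \<noteq> 0" "d \<noteq> 0" using t by (simp_all add: c_def d_def)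
  let ?Q = "Polynomial.smult c (Pm ^ 2) - Polynomial.smult d (Pd ^ 2 * Pq ^ 3)"
  have "degree (Polynomial.smult c (Pm ^ 2)) < degree (Polynomial.smult d (Pd ^ 2 * Pq ^ 3))"
    using ne deg cd by (simp add: degree_mult_eq degree_power_eq)
  then have "?Q \<noteq> 0" by (metis right_minus_eq less_irrefl)
  then have fin: "finite (B \<union> {t. poly ?Q t = 0})" using B roots by blast
  obtain t' where "t' \<notin> B \<union> {t. poly ?Q t = 0}"
    using ex_new_if_finite[OF inf fin] by (elim exE) (rule that)
  then have t': "t' \<notin> B" "poly ?Q t' \<noteq> 0" by simp_all
  then have "(poly Pm t')\<^sup>2 * c \<noteq> d * ((poly Pd t')\<^sup>2 * poly Pq t' ^ 3)"
    by (simp add: mult.commute)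
  with t t' that show thesis by (simp add: c_def d_def)
qed

text \<open>Jet order, neighbourhood and stratification are all given by an adversary. So the line
  is drawn once, in the space of series through the normalised \<open>f1\<close>, carried back to
  \<open>f\<close> by \<open>\<Psi>\<close>, and only then projected to
  \<open>k\<close>-jets.\<close>

theorem degenerate_not_simple:
  fixes f :: "'a::alg_closed_field series"
  assumes char: "CHAR('a) = 2" and n: "2 \<le> n" "r \<le> n" "\<not> (even n \<and> r = n)"
    and \<Psi>: "alg_auto (vars n) \<Psi>" and f: "Mps f = \<Psi> f1" and f1: "f1 - nform n r \<in> mpow (vars n) 3"
  shows "1 \<le> right_modality n f"
  unfolding right_modality_def
proof (rule INF_greatest)
  fix k assume "k \<in> {k. sufficiently_large n f k}"
  then obtain U0 where U0: "openin (zariski (jet_space n k)) U0" "jet k f \<in> U0"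
      "\<And>g. g \<in> max_ideal n \<Longrightarrow> jet k g \<in> U0 \<Longrightarrow> right_determined n k g"
    by (auto simp: sufficiently_large_def)
  let ?V = "vars n" and ?I = "jmons n k"
  let ?D = "deform n r :: 'a mps"
  define g where "g t = f1 + Con t * ?D" for t
  define \<gamma> where "\<gamma> t = cf (jetm k (\<Psi> (g t)))" for t
  note E = alg_auto_endo[OF \<Psi>]
  have n1: "1 \<le> n" using n by simp
  have D1: "?D \<in> mpow ?V (Suc 0)" by (rule deform_mpow[OF n(1)])
  have f11: "f1 \<in> mpow ?V (Suc 0)"
    using mpow_add[OF mpow_mono[OF f1, of "Suc 0" ?V] nform_mpow(1)[OF n1, of r]] by simp
  have g1: "g t \<in> mpow ?V (Suc 0)" for t
    unfolding g_def by (intro mpow_add mpow_Con_mult f11 D1)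
  note gs = mpow_ser[OF g1]
  have \<Psi>g: "\<Psi> (g t) \<in> mpow ?V (Suc 0)" for t
    by (rule alg_auto_mpow[OF _ \<Psi> g1]) simp
  define a b where "a = cf (jetm k (\<Psi> f1))" and "b = cf (jetm k (\<Psi> ?D))"
  have line: "\<gamma> t = (\<lambda>m. a m + t * b m)" for t
    unfolding \<gamma>_def g_def a_def b_def by (rule jet_line[OF \<Psi> mpow_ser[OF f11] mpow_ser[OF D1]])
  have pts: "a \<in> jpoints n k" "b \<in> jpoints n k"
    unfolding a_def b_def using alg_auto_mpow[OF _ \<Psi> f11] alg_auto_mpow[OF _ \<Psi> D1]
    by (auto intro: jetm_jpoints)
  have \<gamma>0: "\<gamma> 0 = jet k f" by (simp add: \<gamma>_def g_def Con_simps f[symmetric] jetm_def)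
  obtain G where G: "alg_auto ?V G" "\<And>h. h \<in> ser ?V \<Longrightarrow> G (\<Psi> h) = h"
    using alg_auto_inv[OF \<Psi>] by metis
  obtain Pm Pd Pq where P: "\<And>t. inv_num n (g t) = poly Pm t" "\<And>t. inv_den n (g t) = poly Pd t"
      "\<And>t. inv_sq n (g t) = poly Pq t" "Pm \<noteq> 0" "Pd \<noteq> 0" "Pq \<noteq> 0"
      "2 * degree Pm < 2 * degree Pd + 3 * degree Pq"
    unfolding g_def using family_invariants[OF n(1), of f1 r] by metis
  have deg: "degenerate n (g t)" if "t \<noteq> 0" for t
    using degenerate_family[OF n f1 that, of 0] by (simp add: g_def)
  \<comment> \<open>For smaller \<open>k\<close> an added cube is invisible to the
    \<open>k\<close>-jet, so determinacy would make a general member of the line equivalent to its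
    perturbation. But the cube adds \<open>inv_den\<close> to \<open>inv_num\<close>, and equality
    of the squares then forces \<open>inv_den\<close> to vanish.\<close>
  have k3: "3 \<le> k"
  proof (rule ccontr)
    assume "\<not> 3 \<le> k"
    then have k2: "Suc k \<le> 3" by simp
    have "\<gamma> 0 \<in> U0" using U0(2) \<gamma>0 by simp
    then have "finite {t. \<gamma> t \<notin> U0}"
      using open_line_cofinite[OF U0(1)[unfolded jet_space_eq] pts, of 0] by (simp add: line)
    then have fin: "finite ({t. \<gamma> t \<notin> U0} \<union> {0} \<union> {t. poly Pd t = 0} \<union> {t. poly Pq t = 0})"
      using poly_roots_finite[OF P(5)] poly_roots_finite[OF P(6)] by simp
    obtain t where "t \<notin> {t. \<gamma> t \<notin> U0} \<union> {0} \<union> {t. poly Pd t = 0} \<union> {t. poly Pq t = 0}"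
      using ex_new_if_finite[OF infinite_alg_closed fin] by (elim exE) (rule that)
    then have t: "\<gamma> t \<in> U0" "t \<noteq> 0" "inv_den n (g t) \<noteq> 0" "inv_sq n (g t) \<noteq> 0"
      unfolding P(2,3) by simp_all
    let ?z = "2 * rank_max n + 1"
    have zV: "?z \<in> ?V" using rank_max_bounds[OF n] by simp
    define c where "c = (X ?z * (X ?z * X ?z) :: 'a mps)"
    have c3: "c \<in> mpow ?V 3" unfolding c_def by (rule mpow_XXX[OF zV zV zV])
    define h where "h = g t + c"
    have h1: "h \<in> mpow ?V (Suc 0)"
      unfolding h_def by (rule mpow_add[OF g1 mpow_mono[OF c3]]) auto
    note hs = mpow_ser[OF h1]
    have \<Psi>h: "\<Psi> h \<in> mpow ?V (Suc 0)" by (rule alg_auto_mpow[OF _ \<Psi> h1]) simp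
    have "jetm k h = jetm k (g t)"
    proof (rule jetm_eq_iff[OF hs gs, THEN iffD2])
      show "h - g t \<in> mpow ?V (Suc k)" using mpow_mono[OF c3 k2] by (simp add: h_def)
    qed
    then have "jetm k (\<Psi> h) = jetm k (\<Psi> (g t))" by (intro jetm_auto[OF _ \<Psi> hs gs]) auto
    then have "jet k (cf (\<Psi> h)) = jet k (cf (\<Psi> (g t)))" by (simp add: jetm_def)
    moreover have "right_determined n k (cf (\<Psi> (g t)))"
      using t(1) \<Psi>g by (intro U0(3)) (simp_all add: max_ideal_iff \<gamma>_def jetm_def)
    ultimately have "right_equivalent n (cf (\<Psi> h)) (cf (\<Psi> (g t)))"
      using \<Psi>h unfolding right_determined_def by (simp add: max_ideal_iff)
    then have "req ?V (\<Psi> h) (\<Psi> (g t))"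
      using mpow_ser[OF \<Psi>h] by (subst (asm) right_equivalent_iff) auto
    moreover have "req ?V h (\<Psi> h)" "req ?V (g t) (\<Psi> (g t))" using \<Psi> hs gs by (auto intro: reqI)
    ultimately have "req ?V (g t) h" using req_trans req_sym by blast
    then obtain F where F: "alg_auto ?V F" "h = F (g t)" by (auto simp: req_def)
    have degh: "degenerate n h"
      unfolding h_def g_def by (rule degenerate_family[OF n f1 t(2) c3])
    have "(inv_num n h)\<^sup>2 * ((inv_den n (g t))\<^sup>2 * inv_sq n (g t) ^ 3)
      = (inv_num n (g t))\<^sup>2 * ((inv_den n h)\<^sup>2 * inv_sq n h ^ 3)"
      by (rule invariant_ratio[OF char n(1) F(1) deg[OF t(2)] degh _ t(4)]) (simp add: F(2))
    moreover have sq: "inv_sq n h = inv_sq n (g t)"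
      by (simp add: inv_sq_def h_def c_def cf_X_mult cf_X)
    moreover have "inv_den n h = inv_den n (g t)" "inv_num n h = inv_num n (g t) + inv_den n (g t)"
    proof -
      have zzz: "cf h {#?z, ?z, ?z#} = cf (g t) {#?z, ?z, ?z#} + 1"
        by (simp add: h_def c_def cf_X_mult cf_X)
      have coeffs: "cf h {#?z, ?z, n#} = cf (g t) {#?z, ?z, n#}" "cf h {#?z, n, n#} = cf (g t) {#?z, n, n#}"
        "cf h {#n, n, n#} = cf (g t) {#n, n, n#}" if "even n"
      proof -
        have "?z \<noteq> n" "n \<noteq> ?z" using rank_max_even[OF that n(1)] by auto
        then show "cf h {#?z, ?z, n#} = cf (g t) {#?z, ?z, n#}" "cf h {#?z, n, n#} = cf (g t) {#?z, n, n#}"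
          "cf h {#n, n, n#} = cf (g t) {#n, n, n#}"
          by (simp_all add: h_def c_def cf_X_mult cf_X)
      qed
      show "inv_den n h = inv_den n (g t)"
        using coeffs(3) by (simp add: inv_den_def)
      show "inv_num n h = inv_num n (g t) + inv_den n (g t)"
      proof (cases "odd n")
        case True
        then show ?thesis by (simp add: inv_num_def inv_den_def Let_def zzz)
      next
        case False
        then have "even n" by simp
        then show ?thesis
          by (simp add: inv_num_def inv_den_def Let_def zzz coeffs distrib_right)
      qed
    qed
    ultimately have "(inv_num n (g t) + inv_den n (g t))\<^sup>2 = (inv_num n (g t))\<^sup>2"
      using t(3,4) by simp
    then have "(inv_den n (g t))\<^sup>2 + (inv_num n (g t) * inv_den n (g t) + inv_num n (g t) * inv_den n (g t)) = 0"
      by (simp add: power2_eq_square algebra_simps)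
    then have "(inv_den n (g t))\<^sup>2 = 0" by (simp only: char2_add_self[OF char] add_0_right)
    with t(3) show False by simp
  qed
  \<comment> \<open>If the jets lie in one orbit, conjugation by \<open>\<Psi>\<close> gives an
    automorphism taking \<open>g t\<close> to \<open>g t'\<close> modulo order four, as
    \<open>3 \<le> k\<close>; then the invariants coincide. Including \<open>0\<close> among the
    excluded parameters keeps both members degenerate.\<close>
  have vary: "\<exists>t t'. t \<notin> B \<and> t' \<notin> B \<and> \<not> (\<exists>\<phi>\<in>right_jet_group n k. \<gamma> t' = jet_act n k \<phi> (\<gamma> t))"
    if B: "finite B" for B
  proof -
    have fin: "finite (insert 0 B)" using B by simp
    obtain t t' where t: "t \<notin> insert 0 B" "t' \<notin> insert 0 B" "poly Pq t \<noteq> 0"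
        "(poly Pm t')\<^sup>2 * ((poly Pd t)\<^sup>2 * poly Pq t ^ 3) \<noteq> (poly Pm t)\<^sup>2 * ((poly Pd t')\<^sup>2 * poly Pq t' ^ 3)"
      by (rule varying_ratio[OF infinite_alg_closed fin P(4-7)])
    have "\<not> (\<exists>\<phi>\<in>right_jet_group n k. \<gamma> t' = jet_act n k \<phi> (\<gamma> t))"
    proof
      have "\<gamma> t \<in> jpoints n k" unfolding \<gamma>_def by (rule jetm_jpoints[OF \<Psi>g])
      moreover assume "\<exists>\<phi>\<in>right_jet_group n k. \<gamma> t' = jet_act n k \<phi> (\<gamma> t)"
      ultimately obtain F where F: "alg_auto ?V F" "\<gamma> t' = cf (jetm k (F (Mps (\<gamma> t))))"
        using jet_orbit_iff by blast
      have s: "\<Psi> (g t) \<in> ser ?V" "\<Psi> (g t') \<in> ser ?V" using mpow_ser[OF \<Psi>g] by auto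
      have Fs: "F (\<Psi> (g t)) \<in> ser ?V" by (rule alg_endoD(1)[OF alg_auto_endo[OF F(1)] s(1)])
      have "jetm k (\<Psi> (g t')) = jetm k (F (Mps (\<gamma> t)))"
        using F(2) by (intro mps_eqI) (simp add: \<gamma>_def)
      also have "\<dots> = jetm k (F (\<Psi> (g t)))"
        by (intro jetm_auto[OF _ F(1)]) (auto simp: \<gamma>_def jetm_idem jetm_ser s)
      finally have "jetm k (F (\<Psi> (g t))) = jetm k (\<Psi> (g t'))" by simp
      then have "jetm k (G (F (\<Psi> (g t)))) = jetm k (G (\<Psi> (g t')))"
        by (intro jetm_auto[OF _ G(1) Fs s(2)]) auto
      then have "G (F (\<Psi> (g t))) - g t' \<in> mpow ?V (Suc k)"
        using jetm_eq_iff[OF alg_endoD(1)[OF alg_auto_endo[OF G(1)] Fs] gs[of t']] G(2)[OF gs] by simp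
      then have FG: "(G \<circ> F \<circ> \<Psi>) (g t) - g t' \<in> mpow ?V 4"
        using k3 by (auto intro: mpow_mono)
      have "alg_auto ?V (G \<circ> F \<circ> \<Psi>)"
        by (intro alg_auto_comp G(1) F(1) \<Psi>)
      from invariant_ratio[OF char n(1) this deg deg FG] t show False unfolding P(1-3) by auto
    qed
    with t show ?thesis by blast
  qed
  show "1 \<le> modality (right_jet_group n k) (jet_act n k) (jet_space n k) (jet k f)"
    unfolding modality_def open_modality_def
  proof (intro INF_greatest)
    fix U :: "'a series set" and strat :: "('a series, 'a) stratum list"
    assume U: "U \<in> {U. openin (zariski (jet_space n k)) U \<and> jet k f \<in> U}"
      and strat: "strat \<in> {strat. rosenlicht_stratification (right_jet_group n k) (jet_act n k) (jet_space n k) strat}"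
    show "1 \<le> strat_modality strat U"
    proof (rule strat_modality_line[where a = a and b = b and s = 0 and I = ?I])
      show "infinite (UNIV :: 'a set)" by (rule infinite_alg_closed)
      show "rosenlicht_stratification (right_jet_group n k) (jet_act n k) (affine_space ?I) strat"
        using strat by (simp add: jet_space_eq)
      show "openin (zariski (affine_space ?I)) U" using U by (simp add: jet_space_eq)
      show "(\<lambda>i. a i + 0 * b i) \<in> U" using U \<gamma>0 line[of 0] by simp
    qed (use pts vary in \<open>auto simp: line\<close>)
  qed
qed

theorem theorem3p3:
  fixes n :: nat and f :: "('a::alg_closed_field) series"
  assumes "CHAR('a) = 2" and "n \<ge> 2"
    and "f \<in> max_ideal_squared n" and "milnor_number n f < \<infinity>"
  shows "right_simple n f \<longleftrightarrow> even n \<and> right_equivalent n f (A1_series n)"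
proof
  have n1: "1 \<le> n" using assms(2) by simp
  have f2: "Mps f \<in> mpow (vars n) 2" by (rule max_ideal_squared_mpow[OF assms(3)])
  then have fm: "f \<in> max_ideal n" by (auto simp: max_ideal_iff intro: mpow_mono)
  {
    assume simple: "right_simple n f"
    have fs: "Mps f \<in> ser (vars n)" using f2 by (rule mpow_ser)
    have "cf (jetm 2 (Mps f)) \<in> jpoints n 2"
      using fm by (intro jetm_jpoints) (simp add: max_ideal_iff)
    then obtain r where r: "r \<le> n + 1" "cf (jetm 2 (Mps f)) \<in> jet_orbit n r"
      using jet_orbit_cover[OF assms(1) n1] by blast
    obtain F where F: "alg_auto (vars n) F" "jetm 2 (F (Mps f)) = nform n r"
      using jet_orbit_to_nform[OF n1 fs r(2)] by blast
    have F2: "F (Mps f) \<in> mpow (vars n) 2" by (rule alg_auto_mpow[OF _ F(1) f2]) simp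
    \<comment> \<open>\<open>F\<close> preserves order two, so no linear term can appear.\<close>
    have "r \<noteq> n + 1"
    proof
      assume "r = n + 1"
      then have "cf (jetm 2 (F (Mps f))) {#1#} = 1" by (simp add: F(2) nform_def cf_X)
      then show False using mpowD[OF F2, of "{#1#}"] by (simp add: cf_jetm)
    qed
    with r have rn: "r \<le> n" by simp
    have three: "Suc 2 = 3" by simp
    have F3: "F (Mps f) - nform n r \<in> mpow (vars n) 3"
      using jetm_diff[OF mpow_ser[OF F2], of 2] F(2) by (simp only: three)
    obtain \<Psi> where \<Psi>: "alg_auto (vars n) \<Psi>" "\<And>h. h \<in> ser (vars n) \<Longrightarrow> \<Psi> (F h) = h"
      using alg_auto_inv[OF F(1)] by metis
    \<comment> \<open>In all other cases \<open>F (Mps f)\<close> can play the role of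
      \<open>f1\<close>, with the inverse of \<open>F\<close> leading back to
      \<open>f\<close>.\<close>
    have "even n \<and> r = n"
    proof (rule ccontr)
      assume "\<not> (even n \<and> r = n)"
      then have "1 \<le> right_modality n f"
        by (intro degenerate_not_simple[OF assms(1,2) rn _ \<Psi>(1) _ F3]) (simp_all add: \<Psi>(2)[OF fs])
      with simple show False by (simp add: right_simple_def)
    qed
    then have "req (vars n) (F (Mps f)) (hyp (n div 2))"
      using F3 by (intro morse_lemma mpow_ser[OF F2]) (auto simp: nform_def)
    moreover have "req (vars n) (Mps f) (F (Mps f))" using F(1) fs by (auto intro: reqI)
    ultimately have "req (vars n) (Mps f) (Mps (A1_series n))"
      unfolding A1_series_eq by (blast intro: req_trans)
    with \<open>even n \<and> r = n\<close> show "even n \<and> right_equivalent n f (A1_series n)"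
      by (simp add: right_equivalent_iff[OF fs])
  }
  assume "even n \<and> right_equivalent n f (A1_series n)"
  then show "right_simple n f"
    using A1_right_simple[OF assms(1) n1 _ fm] by blast
qed

end
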